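(* Assume that $\mathcal P$ is differentiable in quadratic mean at $P_0$ in the sense defined in the context, and that $J=\mathbb E_0\,\tilde\ell(X)\tilde\ell(X)^{\mathrm t}$ is nonsingular. Let $(m_n)_{n\ge1}$ be a subsequence of indices tending to infinity such that: (1) there is a function $g$ with $\mathbb E_0\,g(X)=0$, $\mathbb E_0\,g(X)^2<\infty$ and $\mathbb E_0\,g(X)\tilde\ell(X)=0$ such that $$\log\frac{\mathrm dP_{m_n}^n}{\mathrm dP_0^n}=\frac1{\sqrt n}\sum_{i=1}^n g(X_i)-\tfrac12\mathbb E_0\,g(X_1)^2+o_{P_0^n}(1);$$ (2) the efficient scores $\tilde\ell_{m_n}$ exist and $$\lim_{n\to\infty}\int\|\tilde\ell_{m_n}p_{m_n}^{1/2}-\tilde\ell\,p_0^{1/2}\|^2\,\mathrm d\mu=0;$$ (3) the estimators $\widehat\theta_{m_n,n}$ satisfy $$\sqrt n(\widehat\theta_{m_n,n}-\theta_0)=\frac1{\sqrt n}\sum_{i=1}^nJ_{m_n}^{-1}\tilde\ell_{m_n}(X_i)+o_{P_{m_n}^n}(1).$$ Then $\widehat\theta_{m_n,n}$ is best regular in $\mathcal P$, i.e. it is a regular sequence of estimators of $\theta_0$ with limiting law $\mathrm N(0,J^{-1})$.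
   Context: Setting. $X_1,\dots,X_n$ are i.i.d. copies of $X$ with law $P_0:=P_{\theta_0,\eta_0}$ belonging to a semiparametric family $\mathcal P=\{P_{\theta,\eta}:\theta\in\Theta,\eta\in\mathcal H\}$, with $\Theta\subset\mathbb R^p$ and $\mathcal H$ an infinite-dimensional space. The laws are dominated by a $\sigma$-finite measure $\mu$, with densities $p_{\theta,\eta}$; $p_0=p_{\theta_0,\eta_0}$. For each $m\ge1$, $\mathcal H_m=\{\eta_\gamma:\gamma\in\Gamma_m\}$, $\Gamma_m\subset\mathbb R^{k_m}$, is a parametric family of functions, and $T_m:\mathcal H_m\to\Gamma_m$, $T_m\eta_\gamma=\gamma$, is an isomorphism. $\mathcal P_m=\{P_{\theta,T_m^{-1}\gamma}:\theta\in\Theta,\gamma\in\Gamma_m\}$ is a parametric model with $\mu$-densities $p_{\theta,T_m^{-1}\gamma}$. Fix vectors $\gamma_0=\gamma_{0,m}\in\Gamma_m$ (with $\eta_{\gamma_{0,m}}$ approaching $\eta_0$ as $m\to\infty$) and put $P_m=P_{\theta_0,T_m^{-1}\gamma_0}$ with density $p_m$. $\mathbb E_0,\mathbb E_m$ denote expectation under $P_0,P_m$; a superscript $n$ denotes the $n$-fold product measure. $\|\cdot\|$ is the Euclidean norm. Parametric scores. $\dot\ell_m=\partial_\theta\log p_{\theta,T_m^{-1}\gamma}$ and $\dot v_m=\partial_\gamma\log p_{\theta,T_m^{-1}\gamma}$ evaluated at $(\theta_0,\gamma_0)$. The Fisher information blocks are $i_{m,00}=\mathbb E_m\dot\ell_m\dot\ell_m^{\mathrm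 t}$, $i_{m,01}=\mathbb E_m\dot\ell_m\dot v_m^{\mathrm t}=i_{m,10}^{\mathrm t}$, $i_{m,11}=\mathbb E_m\dot v_m\dot v_m^{\mathrm t}$. The efficient score in $\mathcal P_m$ is $\tilde\ell_m=\dot\ell_m-i_{m,01}i_{m,11}^{-1}\dot v_m$ and its variance is $J_m=\mathbb E_m\tilde\ell_m\tilde\ell_m^{\mathrm t}=i_{m,00}-i_{m,01}i_{m,11}^{-1}i_{m,10}$. $\widehat\theta_{m,n}$ is an estimator of $\theta_0$ based on $X_1,\dots,X_n$ (the maximum likelihood estimator of $\theta$ in $\mathcal P_m$). Differentiability in quadratic mean of $\mathcal P$ at $P_0$. $B$ is a linear space; for $b\in B$, $\eta_n(b)\to\eta_0$ as $n\to\infty$ and $\eta_n(0)=\eta_0$. For each $h=(\tau,b)\in\mathbb R^p\times B$, $P_{\theta_0+\tau/\sqrt n,\eta_n(b)}\in\mathcal P$ for all large $n$ and $$\lim_{n\to\infty}\int\{\sqrt n(p_{\theta_0+\tau/\sqrt n,\eta_n(b)}^{1/2}-p_0^{1/2})-\tfrac12Ah\,p_0^{1/2}\}^2\,\mathrm d\mu=0,$$ where $A:\mathbb R^p\times B\to L_2(P_0)$ is a bounded linear map. Write $Ah=\tau^{\mathrm t}\dot\ell+Db$, with $\dot\ell$ the score for $\theta$ and $D:B\to L_2(P_0)$ linear. The efficient score is $\tilde\ell=\dot\ell-\Pi\dot\ell$, with $\Pi$ the (componentwise) orthogonal projection in $L_2(P_0)$ onto the closure of $\{Db:b\in B\}$.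 Regularity. An estimator sequence $\widehat\theta_n$ is regular if there is a law $L$ such that for every $(\tau,b)\in\mathbb R^p\times B$, $\sqrt n(\widehat\theta_n-\theta_0-\tau/\sqrt n)$ converges weakly to $L$ under $P^n_{\theta_0+\tau/\sqrt n,\eta_n(b)}$. It is best regular in $\mathcal P$ if it is regular with $L=\mathrm N(0,J^{-1})$. *)

theory Defs
  imports "HOL-Probability.Probability"
begin

definition is_density :: "'x measure \<Rightarrow> ('x \<Rightarrow> real) \<Rightarrow> bool" where
  "is_density \<mu> f \<longleftrightarrow>
     f \<in> borel_measurable \<mu> \<and> (\<forall>x\<in>space \<mu>. 0 \<le> f x) \<and> (\<integral>\<^sup>+ x. ennreal (f x) \<partial>\<mu>) = 1"

definition law :: "'x measure \<Rightarrow> ('x \<Rightarrow> real) \<Rightarrow> 'x measure" where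
  "law \<mu> f = density \<mu> (\<lambda>x. ennreal (f x))"

text \<open>The sample \<open>X\<^sub>1, \<dots>, X\<^sub>n\<close> consists of the coordinates \<open>x 0, \<dots>, x (n - 1)\<close> of the
  \<open>n\<close>-fold product space.\<close>

definition product_law :: "nat \<Rightarrow> 'x measure \<Rightarrow> (nat \<Rightarrow> 'x) measure" where
  "product_law n P = (\<Pi>\<^sub>M i\<in>{..<n}. P)"

definition normalized_sum :: "nat \<Rightarrow> ('x \<Rightarrow> 'v::real_vector) \<Rightarrow> (nat \<Rightarrow> 'x) \<Rightarrow> 'v" where
  "normalized_sum n f x = (1 / sqrt (real n)) *\<^sub>R (\<Sum>i<n. f (x i))"

text \<open>\<open>R n\<close> is the size of the remainder. It is extended-real valued because a log likelihood
  ratio may equal \<open>-\<infinity>\<close>.\<close>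

definition negligible_in_probability ::
  "(nat \<Rightarrow> 'a measure) \<Rightarrow> (nat \<Rightarrow> 'a \<Rightarrow> ereal) \<Rightarrow> bool" where
  "negligible_in_probability Q R \<longleftrightarrow>
     (\<forall>\<epsilon>>0. (\<lambda>n. measure (Q n) {x \<in> space (Q n). R n x > ereal \<epsilon>}) \<longlonglongrightarrow> 0)"

text \<open>The logarithm of the likelihood ratio of the \<open>n\<close>-fold products of the laws with densities
  \<open>q\<close> and \<open>p\<close>, with \<open>log 0 = -\<infinity>\<close>. The (arbitrary) value at points where some \<open>p (x i)\<close>
  vanishes is irrelevant, since these form a null set under the product law of \<open>p\<close>. No absolute
  continuity is assumed: the ratio is the density of the absolutely continuous part.\<close>

definition log_likelihood_ratio ::
  "nat \<Rightarrow> ('x \<Rightarrow> real) \<Rightarrow> ('x \<Rightarrow> real) \<Rightarrow> (nat \<Rightarrow> 'x) \<Rightarrow> ereal" where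
  "log_likelihood_ratio n q p x =
     (let r = (\<Prod>i<n. q (x i) / p (x i)) in if r = 0 then - \<infinity> else ereal (ln r))"

definition weakly_converges ::
  "(nat \<Rightarrow> 'a::topological_space measure) \<Rightarrow> 'a measure \<Rightarrow> bool" where
  "weakly_converges Q L \<longleftrightarrow>
     (\<forall>f :: 'a \<Rightarrow> real. continuous_on UNIV f \<longrightarrow> bounded (range f) \<longrightarrow>
        (\<lambda>n. \<integral>x. f x \<partial>Q n) \<longlonglongrightarrow> (\<integral>x. f x \<partial>L))"

text \<open>The nondegenerate normal law; only meaningful for a positive definite covariance matrix.\<close>

definition mv_normal :: "real^'p \<Rightarrow> real^'p^'p \<Rightarrow> (real^'p) measure" where
  "mv_normal m \<Sigma> = density lborel (\<lambda>x. ennreal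
     (exp (- ((x - m) \<bullet> (matrix_inv \<Sigma> *v (x - m))) / 2) / sqrt ((2 * pi) ^ CARD('p) * det \<Sigma>)))"

definition second_moment :: "'x measure \<Rightarrow> ('x \<Rightarrow> real^'p) \<Rightarrow> real^'p^'p" where
  "second_moment P f = (\<chi> i j. \<integral>x. f x $ i * f x $ j \<partial>P)"


section \<open>Square integrable functions\<close>

text \<open>Elements of \<open>L\<^sub>2(P)\<close> are represented by functions; equations between them are read almost
  everywhere.\<close>

definition L2 :: "'x measure \<Rightarrow> ('x \<Rightarrow> real) set" where
  "L2 P = {f. f \<in> borel_measurable P \<and> integrable P (\<lambda>x. (f x)\<^sup>2)}"

definition L2_closure :: "'x measure \<Rightarrow> ('x \<Rightarrow> real) set \<Rightarrow> ('x \<Rightarrow> real) set" where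
  "L2_closure P S = {f \<in> L2 P. \<forall>\<epsilon>>0. \<exists>s\<in>S. (\<integral>x. (f x - s x)\<^sup>2 \<partial>P) < \<epsilon>}"

definition is_L2_projection ::
  "'x measure \<Rightarrow> ('x \<Rightarrow> real) set \<Rightarrow> ('x \<Rightarrow> real) \<Rightarrow> ('x \<Rightarrow> real) \<Rightarrow> bool" where
  "is_L2_projection P V f q \<longleftrightarrow> q \<in> V \<and> (\<forall>s\<in>V. (\<integral>x. (f x - q x) * s x \<partial>P) = 0)"

definition linear_into_L2 :: "'x measure \<Rightarrow> ('v::real_vector \<Rightarrow> 'x \<Rightarrow> real) \<Rightarrow> bool" where
  "linear_into_L2 P F \<longleftrightarrow>
     (\<forall>v. F v \<in> L2 P) \<and>
     (\<forall>v w. AE x in P. F (v + w) x = F v x + F w x) \<and>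
     (\<forall>c v. AE x in P. F (c *\<^sub>R v) x = c * F v x)"

definition bounded_linear_into_L2 ::
  "'x measure \<Rightarrow> ('v::real_normed_vector \<Rightarrow> 'x \<Rightarrow> real) \<Rightarrow> bool" where
  "bounded_linear_into_L2 P F \<longleftrightarrow>
     linear_into_L2 P F \<and> (\<exists>K. \<forall>v. sqrt (\<integral>x. (F v x)\<^sup>2 \<partial>P) \<le> K * norm v)"


section \<open>The semiparametric model\<close>

text \<open>\<open>p\<close> gives the densities, \<open>\<eta>loc n b\<close> is \<open>\<eta>\<^sub>n(b)\<close>, and \<open>A (\<tau>, b)\<close> is the score in
  direction \<open>(\<tau>, b)\<close>.\<close>

definition differentiable_in_quadratic_mean ::
  "'x measure \<Rightarrow> (real^'p \<Rightarrow> 'h::topological_space \<Rightarrow> 'x \<Rightarrow> real) \<Rightarrow> (real^'p) set \<Rightarrow> 'h set \<Rightarrow>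
   real^'p \<Rightarrow> 'h \<Rightarrow> (nat \<Rightarrow> 'b::real_normed_vector \<Rightarrow> 'h) \<Rightarrow> ((real^'p) \<times> 'b \<Rightarrow> 'x \<Rightarrow> real) \<Rightarrow> bool"
  where
  "differentiable_in_quadratic_mean \<mu> p \<Theta> H \<theta>\<^sub>0 \<eta>\<^sub>0 \<eta>loc A \<longleftrightarrow>
     (\<forall>b. (\<lambda>n. \<eta>loc n b) \<longlonglongrightarrow> \<eta>\<^sub>0) \<and>
     (\<forall>n\<ge>1. \<eta>loc n 0 = \<eta>\<^sub>0) \<and>
     bounded_linear_into_L2 (law \<mu> (p \<theta>\<^sub>0 \<eta>\<^sub>0)) A \<and>
     (\<forall>\<tau> b.
        (\<forall>\<^sub>F n in sequentially. \<theta>\<^sub>0 + (1 / sqrt (real n)) *\<^sub>R \<tau> \<in> \<Theta> \<and> \<eta>loc n b \<in> H) \<and>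
        (\<lambda>n. \<integral>\<^sup>+ x. ennreal
           ((sqrt (real n) * (sqrt (p (\<theta>\<^sub>0 + (1 / sqrt (real n)) *\<^sub>R \<tau>) (\<eta>loc n b) x)
                              - sqrt (p \<theta>\<^sub>0 \<eta>\<^sub>0 x))
             - (1/2) * A (\<tau>, b) x * sqrt (p \<theta>\<^sub>0 \<eta>\<^sub>0 x))\<^sup>2) \<partial>\<mu>) \<longlonglongrightarrow> 0)"

definition score_decomposition ::
  "'x measure \<Rightarrow> ((real^'p) \<times> 'b::real_normed_vector \<Rightarrow> 'x \<Rightarrow> real) \<Rightarrow> ('x \<Rightarrow> real^'p) \<Rightarrow>
   ('b \<Rightarrow> 'x \<Rightarrow> real) \<Rightarrow> bool" where
  "score_decomposition P A l D \<longleftrightarrow>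
     (\<forall>j. (\<lambda>x. l x $ j) \<in> L2 P) \<and> linear_into_L2 P D \<and>
     (\<forall>\<tau> b. AE x in P. A (\<tau>, b) x = \<tau> \<bullet> l x + D b x)"

text \<open>\<open>l - leff\<close> is, componentwise, a version of the projection of \<open>l\<close> onto the closure of the
  range of \<open>D\<close>.\<close>

definition is_efficient_score ::
  "'x measure \<Rightarrow> ('x \<Rightarrow> real^'p) \<Rightarrow> ('b \<Rightarrow> 'x \<Rightarrow> real) \<Rightarrow> ('x \<Rightarrow> real^'p) \<Rightarrow> bool" where
  "is_efficient_score P l D leff \<longleftrightarrow>
     (\<forall>j. is_L2_projection P (L2_closure P (range D)) (\<lambda>x. l x $ j) (\<lambda>x. l x $ j - leff x $ j))"

text \<open>Regularity of the estimator sequence \<open>\<theta>hat\<close> with limiting law \<open>L\<close>.\<close>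

definition regular_with_limit ::
  "'x measure \<Rightarrow> (real^'p \<Rightarrow> 'h \<Rightarrow> 'x \<Rightarrow> real) \<Rightarrow> real^'p \<Rightarrow> (nat \<Rightarrow> 'b \<Rightarrow> 'h) \<Rightarrow>
   (nat \<Rightarrow> (nat \<Rightarrow> 'x) \<Rightarrow> real^'p) \<Rightarrow> (real^'p) measure \<Rightarrow> bool" where
  "regular_with_limit \<mu> p \<theta>\<^sub>0 \<eta>loc \<theta>hat L \<longleftrightarrow>
     prob_space L \<and> sets L = sets borel \<and>
     (\<forall>\<tau> b. weakly_converges
        (\<lambda>n. distr (product_law n (law \<mu> (p (\<theta>\<^sub>0 + (1 / sqrt (real n)) *\<^sub>R \<tau>) (\<eta>loc n b)))) borel
               (\<lambda>x. sqrt (real n) *\<^sub>R (\<theta>hat n x - \<theta>\<^sub>0 - (1 / sqrt (real n)) *\<^sub>R \<tau>)))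
        L)"

definition best_regular ::
  "'x measure \<Rightarrow> (real^'p \<Rightarrow> 'h \<Rightarrow> 'x \<Rightarrow> real) \<Rightarrow> real^'p \<Rightarrow> 'h \<Rightarrow> (nat \<Rightarrow> 'b \<Rightarrow> 'h) \<Rightarrow>
   ('x \<Rightarrow> real^'p) \<Rightarrow> (nat \<Rightarrow> (nat \<Rightarrow> 'x) \<Rightarrow> real^'p) \<Rightarrow> bool" where
  "best_regular \<mu> p \<theta>\<^sub>0 \<eta>\<^sub>0 \<eta>loc leff \<theta>hat \<longleftrightarrow>
     regular_with_limit \<mu> p \<theta>\<^sub>0 \<eta>loc \<theta>hat
       (mv_normal 0 (matrix_inv (second_moment (law \<mu> (p \<theta>\<^sub>0 \<eta>\<^sub>0)) leff)))"


section \<open>The parametric models\<close>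

text \<open>The dimension \<open>k\<close> of the parameter \<open>\<gamma>\<close> varies with the model, so \<open>\<real>\<^sup>k\<close> is rendered as
  \<open>{..<k} \<rightarrow>\<^sub>E UNIV\<close> and matrices with a dimension \<open>k\<close> as functions whose indices are below \<open>k\<close>.\<close>

text \<open>\<open>d\<close> is the derivative of \<open>log f\<close> at 0 along \<open>S\<close>, the set of increments allowed by the
  parameter set. When \<open>S\<close> is a neighbourhood of 0 this is the ordinary derivative. Positivity of \<open>f\<close>
  near 0 is required explicitly because \<open>ln 0 = 0\<close> in the library.\<close>

definition has_log_derivative :: "real set \<Rightarrow> (real \<Rightarrow> real) \<Rightarrow> real \<Rightarrow> bool" where
  "has_log_derivative S f d \<longleftrightarrow>
     at 0 within S \<noteq> bot \<and> 0 < f 0 \<and> (\<forall>\<^sub>F t in at 0 within S. 0 < f t) \<and>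
     ((\<lambda>t. ln (f t)) has_real_derivative d) (at 0 within S)"

text \<open>\<open>l\<close> and \<open>v\<close> are the scores for \<open>\<theta>\<close> and \<open>\<gamma>\<close> at \<open>(\<theta>\<^sub>0, \<gamma>\<^sub>0)\<close> (gradients of the log density,
  almost everywhere), with finite Fisher information; \<open>\<eta>of \<gamma>\<close> is \<open>\<eta>\<^sub>\<gamma>\<close>.\<close>

definition are_parametric_scores ::
  "'x measure \<Rightarrow> (real^'p \<Rightarrow> 'h \<Rightarrow> 'x \<Rightarrow> real) \<Rightarrow> (real^'p) set \<Rightarrow> real^'p \<Rightarrow>
   nat \<Rightarrow> (nat \<Rightarrow> real) set \<Rightarrow> ((nat \<Rightarrow> real) \<Rightarrow> 'h) \<Rightarrow> (nat \<Rightarrow> real) \<Rightarrow>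
   ('x \<Rightarrow> real^'p) \<Rightarrow> ('x \<Rightarrow> nat \<Rightarrow> real) \<Rightarrow> bool" where
  "are_parametric_scores \<mu> p \<Theta> \<theta>\<^sub>0 k \<Gamma> \<eta>of \<gamma>\<^sub>0 l v \<longleftrightarrow>
     (let P = law \<mu> (p \<theta>\<^sub>0 (\<eta>of \<gamma>\<^sub>0)) in
       (\<forall>j. (\<lambda>x. l x $ j) \<in> L2 P) \<and> (\<forall>a<k. (\<lambda>x. v x a) \<in> L2 P) \<and>
       (AE x in P. \<forall>j. has_log_derivative
          {t. \<theta>\<^sub>0 + t *\<^sub>R axis j 1 \<in> \<Theta>}
          (\<lambda>t. p (\<theta>\<^sub>0 + t *\<^sub>R axis j 1) (\<eta>of \<gamma>\<^sub>0) x) (l x $ j)) \<and>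
       (AE x in P. \<forall>a<k. has_log_derivative
          {t. \<gamma>\<^sub>0(a := \<gamma>\<^sub>0 a + t) \<in> \<Gamma>}
          (\<lambda>t. p \<theta>\<^sub>0 (\<eta>of (\<gamma>\<^sub>0(a := \<gamma>\<^sub>0 a + t))) x) (v x a)))"

definition is_inverse_matrix ::
  "nat \<Rightarrow> (nat \<Rightarrow> nat \<Rightarrow> real) \<Rightarrow> (nat \<Rightarrow> nat \<Rightarrow> real) \<Rightarrow> bool" where
  "is_inverse_matrix k M K \<longleftrightarrow>
     (\<forall>a<k. \<forall>b<k. (\<Sum>c<k. M a c * K c b) = of_bool (a = b) \<and>
                  (\<Sum>c<k. K a c * M c b) = of_bool (a = b))"

definition inverse_matrix :: "nat \<Rightarrow> (nat \<Rightarrow> nat \<Rightarrow> real) \<Rightarrow> nat \<Rightarrow> nat \<Rightarrow> real" where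
  "inverse_matrix k M = (SOME K. is_inverse_matrix k M K)"

definition info01 ::
  "'x measure \<Rightarrow> ('x \<Rightarrow> real^'p) \<Rightarrow> ('x \<Rightarrow> nat \<Rightarrow> real) \<Rightarrow> 'p \<Rightarrow> nat \<Rightarrow> real" where
  "info01 P l v j a = (\<integral>x. l x $ j * v x a \<partial>P)"

definition info11 :: "'x measure \<Rightarrow> ('x \<Rightarrow> nat \<Rightarrow> real) \<Rightarrow> nat \<Rightarrow> nat \<Rightarrow> real" where
  "info11 P v a b = (\<integral>x. v x a * v x b \<partial>P)"

definition parametric_efficient_score ::
  "'x measure \<Rightarrow> nat \<Rightarrow> ('x \<Rightarrow> real^'p) \<Rightarrow> ('x \<Rightarrow> nat \<Rightarrow> real) \<Rightarrow> 'x \<Rightarrow> real^'p" where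
  "parametric_efficient_score P k l v x =
     (\<chi> j. l x $ j -
        (\<Sum>a<k. \<Sum>b<k. info01 P l v j a * inverse_matrix k (info11 P v) a b * v x b))"

text \<open>The last condition says that the efficient score is centred, so that its second moment
  matrix is its variance, as it must be for an information matrix. It is not a consequence of pointwise
  differentiability of the log densities (consider supports that depend on the parameter).\<close>

definition efficient_score_exists ::
  "'x measure \<Rightarrow> (real^'p \<Rightarrow> 'h \<Rightarrow> 'x \<Rightarrow> real) \<Rightarrow> (real^'p) set \<Rightarrow> real^'p \<Rightarrow>
   nat \<Rightarrow> (nat \<Rightarrow> real) set \<Rightarrow> ((nat \<Rightarrow> real) \<Rightarrow> 'h) \<Rightarrow> (nat \<Rightarrow> real) \<Rightarrow>
   ('x \<Rightarrow> real^'p) \<Rightarrow> ('x \<Rightarrow> nat \<Rightarrow> real) \<Rightarrow> bool" where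
  "efficient_score_exists \<mu> p \<Theta> \<theta>\<^sub>0 k \<Gamma> \<eta>of \<gamma>\<^sub>0 l v \<longleftrightarrow>
     are_parametric_scores \<mu> p \<Theta> \<theta>\<^sub>0 k \<Gamma> \<eta>of \<gamma>\<^sub>0 l v \<and>
     (let P = law \<mu> (p \<theta>\<^sub>0 (\<eta>of \<gamma>\<^sub>0)) in
       (\<exists>K. is_inverse_matrix k (info11 P v) K) \<and>
       (\<forall>j. (\<integral>x. parametric_efficient_score P k l v x $ j \<partial>P) = 0))"

end

theory Submission
  imports Defs
begin

text \<open>Let \<open>q\<close> be the density of the \<open>n\<close>-th parametric law and \<open>s\<close> that of a local
  alternative in direction \<open>(\<tau>, b)\<close>. The expansion in hypothesis (1) forces
  \<open>\<surd>n (\<surd>q - \<surd>p\<^sub>0) \<rightarrow> g \<surd>p\<^sub>0 / 2\<close> in \<open>L\<^sub>2(\<mu>)\<close>: the product affinity between \<open>q\<close> and an explicit path with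
  score \<open>g\<close> tends to 1. Together with differentiability in quadratic mean this yields
  \<open>\<surd>n (\<surd>s - \<surd>q) \<rightarrow> (A (\<tau>, b) - g) \<surd>p\<^sub>0 / 2\<close>, which has two consequences. The alternatives are
  contiguous to the parametric laws, so that the remainder in hypothesis (3) is also negligible under the
  alternatives. And the characteristic function of the normalized sum of the efficient scores, an \<open>n\<close>-th power under
  the alternative, can be computed from the one-observation integrals; no log likelihood expansion under the
  alternative is needed. Its drift is governed by
  \<open>\<integral> leff (A (\<tau>, b) - g) dP\<^sub>0 = J \<tau>\<close>, since \<open>leff\<close> is orthogonal to \<open>g\<close> and to the nuisance scores.\<close>

section \<open>Lebesgue measure and linear maps\<close>

text \<open>The parametric efficient scores are square integrable under their own laws; under
  \<open>P\<^sub>0\<close> or the alternatives they need not be. Hypothesis (2) controls only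
  products of scores with root densities, so the limits are taken in one space, L2 of \<mu>, on root
  densities. The scores are centred under the parametric laws alone. For this reason the alternative
  is expanded around the parametric law and not around \<open>P\<^sub>0\<close>: the term of order
  \<open>sqrt n\<close> then vanishes exactly.

  Hypothesis (1) contains no smoothness, only a statement in probability about a ratio that may lose
  mass. The natural path \<open>(1 + g / sqrt n) * p0\<close> may be negative, so \<open>g\<close>
  is truncated at the level n^(1/4) and recentred. This level tends to infinity, but slowly enough
  for the cubic remainder of the logarithm and the fluctuation of the squares to vanish.

  The limit law is given by its density. Its characteristic function is obtained by a linear change
  of variables, and weak convergence by a continuity theorem in several dimensions.\<close>

lemma PiM_density:
  fixes f :: "'a \<Rightarrow> ennreal"
  assumes fin: "finite I" and f[measurable]: "f \<in> borel_measurable M"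
    and M: "sigma_finite_measure M" and fM: "sigma_finite_measure (density M f)"
  shows "(\<Pi>\<^sub>M i\<in>I. density M f) = density (\<Pi>\<^sub>M i\<in>I. M) (\<lambda>x. \<Prod>i\<in>I. f (x i))"
proof (rule sym, rule product_sigma_finite.PiM_eqI)
  interpret product_sigma_finite "\<lambda>_. M" by (rule product_sigma_finite.intro) (rule M)
  show "product_sigma_finite (\<lambda>_. density M f)" by (rule product_sigma_finite.intro) (rule fM)
  show "sets (density (\<Pi>\<^sub>M i\<in>I. M) (\<lambda>x. \<Prod>i\<in>I. f (x i))) = sets (\<Pi>\<^sub>M i\<in>I. density M f)"
    by (simp cong: sets_PiM_cong)
  fix A assume "\<And>i. i \<in> I \<Longrightarrow> A i \<in> sets (density M f)"
  then have A[measurable]: "\<And>i. i \<in> I \<Longrightarrow> A i \<in> sets M" by simp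
  have [measurable]: "Pi\<^sub>E I A \<in> sets (\<Pi>\<^sub>M i\<in>I. M)"
    using A fin by (intro sets_PiM_I_finite) auto
  have fm[measurable]: "(\<lambda>x. \<Prod>i\<in>I. f (x i)) \<in> borel_measurable (\<Pi>\<^sub>M i\<in>I. M)"
    by (intro borel_measurable_prod_ennreal) measurable
  have "emeasure (density (\<Pi>\<^sub>M i\<in>I. M) (\<lambda>x. \<Prod>i\<in>I. f (x i))) (Pi\<^sub>E I A)
      = (\<integral>\<^sup>+x. (\<Prod>i\<in>I. f (x i)) * indicator (Pi\<^sub>E I A) x \<partial>(\<Pi>\<^sub>M i\<in>I. M))"
    by (subst emeasure_density) auto
  also have "\<dots> = (\<integral>\<^sup>+x. (\<Prod>i\<in>I. f (x i) * indicator (A i) (x i)) \<partial>(\<Pi>\<^sub>M i\<in>I. M))"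
  proof (rule nn_integral_cong)
    fix x assume x: "x \<in> space (\<Pi>\<^sub>M i\<in>I. M)"
    have "indicator (Pi\<^sub>E I A) x = (\<Prod>i\<in>I. indicator (A i) (x i) :: ennreal)"
      using x fin by (auto simp: indicator_def space_PiM PiE_iff split: if_splits intro!: prod_zero)
    then show "(\<Prod>i\<in>I. f (x i)) * indicator (Pi\<^sub>E I A) x = (\<Prod>i\<in>I. f (x i) * indicator (A i) (x i))"
      by (simp add: prod.distrib)
  qed
  also have "\<dots> = (\<Prod>i\<in>I. \<integral>\<^sup>+x. f x * indicator (A i) x \<partial>M)"
    using A by (intro product_nn_integral_prod[OF fin]) auto
  also have "\<dots> = (\<Prod>i\<in>I. emeasure (density M f) (A i))"
    using A by (intro prod.cong refl emeasure_density[symmetric]) auto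
  finally show "emeasure (density (\<Pi>\<^sub>M i\<in>I. M) (\<lambda>x. \<Prod>i\<in>I. f (x i))) (Pi\<^sub>E I A) = \<dots>" .
qed (rule fin)

text \<open>Lebesgue measure is determined by the volumes of boxes, and the image of the product
  measure has the right ones. This opens \<open>real^'n\<close> to integration one coordinate at a
  time.\<close>

lemma nn_integral_lborel_cartesian:
  fixes h :: "real^'n \<Rightarrow> ennreal"
  assumes "h \<in> borel_measurable borel"
  shows "(\<integral>\<^sup>+x. h x \<partial>lborel) = (\<integral>\<^sup>+f. h (\<chi> i. f i) \<partial>(\<Pi>\<^sub>M i\<in>UNIV. lborel))"
proof -
  have M: "(\<lambda>f::'n\<Rightarrow>real. (\<chi> i. f i)) \<in> measurable (\<Pi>\<^sub>M i\<in>UNIV. lborel) borel"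
    by (rule borel_measurable_euclidean_space[THEN iffD2]) (auto simp: Basis_vec_def inner_axis)
  interpret product_sigma_finite "\<lambda>_::'n. lborel :: real measure" by standard
  have "(lborel :: (real^'n) measure) = distr (\<Pi>\<^sub>M i\<in>UNIV. lborel) borel (\<lambda>f. (\<chi> i::'n. f i))"
  proof (rule lborel_eqI)
    fix l u :: "real^'n" assume lu: "\<And>b. b \<in> Basis \<Longrightarrow> l \<bullet> b \<le> u \<bullet> b"
    then have lu': "l $ i \<le> u $ i" for i
      using lu[of "axis i 1"] by (auto simp: Basis_vec_def inner_axis)
    have "emeasure (distr (\<Pi>\<^sub>M i\<in>UNIV. lborel) borel (\<lambda>f. (\<chi> i::'n. f i))) (box l u)
        = emeasure (\<Pi>\<^sub>M i\<in>UNIV. lborel) ((\<lambda>f. (\<chi> i::'n. f i)) -` box l u \<inter> space (\<Pi>\<^sub>M i\<in>UNIV. lborel))"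
      by (rule emeasure_distr[OF M]) auto
    also have "((\<lambda>f. (\<chi> i::'n. f i)) -` box l u \<inter> space (\<Pi>\<^sub>M i\<in>UNIV. (lborel::real measure))) = Pi\<^sub>E UNIV (\<lambda>i. {l $ i <..< u $ i})"
      by (auto simp: mem_box Basis_vec_def inner_axis space_PiM PiE_iff)
    also have "emeasure (\<Pi>\<^sub>M i\<in>UNIV. lborel) \<dots> = (\<Prod>i\<in>UNIV. emeasure lborel {l $ i <..< u $ i})"
      by (rule emeasure_PiM) auto
    also have "\<dots> = (\<Prod>i\<in>UNIV. ennreal ((u - l) $ i))"
      using lu' by (intro prod.cong) auto
    also have "\<dots> = ennreal (\<Prod>i\<in>UNIV. (u - l) $ i)"
      using lu' by (subst prod_ennreal) auto
    also have "(\<Prod>i\<in>UNIV. (u - l) $ i) = (\<Prod>b\<in>Basis. (u - l) \<bullet> b)"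
      unfolding Basis_vec_def
      by (subst prod.UNION_disjoint) (auto simp: inner_axis axis_eq_axis)
    finally show "emeasure (distr (\<Pi>\<^sub>M i\<in>UNIV. lborel) borel (\<lambda>f. (\<chi> i::'n. f i))) (box l u) = (\<Prod>b\<in>Basis. (u - l) \<bullet> b)" .
  qed simp
  then show ?thesis
    using nn_integral_distr[OF M, of h] assms by simp
qed

text \<open>Integrate over coordinate \<open>m\<close> with all others frozen: since
  \<open>m\<close> differs from \<open>n\<close>, the added term \<open>c * f n\<close> is then
  constant, and the inner integral is invariant under translation.\<close>

lemma nn_integral_lborel_shear:
  fixes h :: "real^'n \<Rightarrow> ennreal"
  assumes h[measurable]: "h \<in> borel_measurable borel" and mn: "m \<noteq> n"
  shows "(\<integral>\<^sup>+x. h (\<chi> i. if i = m then x $ m + c * x $ n else x $ i) \<partial>lborel) = (\<integral>\<^sup>+x. h x \<partial>lborel)"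
proof -
  interpret product_sigma_finite "\<lambda>_::'n. lborel :: real measure" by standard
  let ?P = "\<Pi>\<^sub>M i\<in>UNIV. (lborel::real measure)"
  have meas: "(\<lambda>f::'n\<Rightarrow>real. (\<chi> i. f i)) \<in> measurable ?P borel"
    by (rule borel_measurable_euclidean_space[THEN iffD2]) (auto simp: Basis_vec_def inner_axis)
  have [measurable]: "(\<lambda>x::real^'n. (\<chi> i. if i = m then x $ m + c * x $ n else x $ i)) \<in> borel_measurable borel"
    by (rule borel_measurable_euclidean_space[THEN iffD2]) (auto simp: Basis_vec_def inner_axis)
  have meas2: "(\<lambda>f::'n\<Rightarrow>real. (\<chi> i. if i = m then f m + c * f n else f i)) \<in> measurable ?P borel"
    by (rule borel_measurable_euclidean_space[THEN iffD2]) (auto simp: Basis_vec_def inner_axis)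
  have U: "insert m (UNIV - {m}) = UNIV" by auto
  have "(\<integral>\<^sup>+x. h (\<chi> i. if i = m then x $ m + c * x $ n else x $ i) \<partial>lborel)
      = (\<integral>\<^sup>+f. h (\<chi> i. if i = m then f m + c * f n else f i) \<partial>?P)"
    by (subst nn_integral_lborel_cartesian) (auto cong: if_cong)
  also have "\<dots> = (\<integral>\<^sup>+f. (\<integral>\<^sup>+y. h (\<chi> i. if i = m then y + c * f n else f i) \<partial>lborel) \<partial>(\<Pi>\<^sub>M i\<in>UNIV - {m}. lborel))"
    using product_nn_integral_insert[of "UNIV - {m}" m "\<lambda>f. h (\<chi> i. if i = m then f m + c * f n else f i)"]
      measurable_compose[OF meas2 h] mn unfolding U by (simp cong: if_cong)
  also have "\<dots> = (\<integral>\<^sup>+f. (\<integral>\<^sup>+y. h (\<chi> i. if i = m then y else f i) \<partial>lborel) \<partial>(\<Pi>\<^sub>M i\<in>UNIV - {m}. lborel))"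
  proof (rule nn_integral_cong)
    fix f :: "'n \<Rightarrow> real"
    have [measurable]: "(\<lambda>y. (\<chi> i. if i = m then y else f i)) \<in> borel_measurable borel"
      by (rule borel_measurable_euclidean_space[THEN iffD2]) (auto simp: Basis_vec_def inner_axis)
    show "(\<integral>\<^sup>+y. h (\<chi> i. if i = m then y + c * f n else f i) \<partial>lborel) = (\<integral>\<^sup>+y. h (\<chi> i. if i = m then y else f i) \<partial>lborel)"
      using nn_integral_real_affine[of "\<lambda>y. h (\<chi> i. if i = m then y else f i)" 1 "c * f n"]
      by (simp add: add.commute cong: if_cong)
  qed
  also have "\<dots> = (\<integral>\<^sup>+f. h (\<chi> i. f i) \<partial>?P)"
    using product_nn_integral_insert[of "UNIV - {m}" m "\<lambda>f. h (\<chi> i. f i)"]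
      measurable_compose[OF meas h] unfolding U by (simp add: fun_upd_def cong: if_cong)
  also have "\<dots> = (\<integral>\<^sup>+x. h x \<partial>lborel)"
    by (rule nn_integral_lborel_cartesian[symmetric]) simp
  finally show ?thesis .
qed

text \<open>The formula is stable under matrix products, because the determinant is multiplicative,
  so elementary matrices suffice: a zero row is excluded by the determinant, a diagonal matrix
  rescales coordinates, a transposition permutes boxes, and the remaining case is a shear.\<close>

lemma nn_integral_lborel_linear:
  fixes A :: "real^'n^'n" and h :: "real^'n \<Rightarrow> ennreal"
  assumes "det A \<noteq> 0" and "h \<in> borel_measurable borel"
  shows "ennreal \<bar>det A\<bar> * (\<integral>\<^sup>+x. h (A *v x) \<partial>lborel) = (\<integral>\<^sup>+x. h x \<partial>lborel)"
proof -
  let ?P = "\<lambda>A::real^'n^'n. det A \<noteq> 0 \<longrightarrow> (\<forall>h::real^'n \<Rightarrow> ennreal. h \<in> borel_measurable borel \<longrightarrow>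
      ennreal \<bar>det A\<bar> * (\<integral>\<^sup>+x. h (A *v x) \<partial>lborel) = (\<integral>\<^sup>+x. h x \<partial>lborel))"
  have mv[measurable]: "(*v) B \<in> borel_measurable borel" for B :: "real^'n^'n"
    by (intro borel_measurable_continuous_onI matrix_vector_mult_linear_continuous_on)
  have "?P A"
  proof (rule induct_matrix_elementary)
    fix A B :: "real^'n^'n" assume A: "?P A" and B: "?P B"
    show "?P (A ** B)"
    proof (intro impI allI)
      fix h :: "real^'n \<Rightarrow> ennreal" assume d: "det (A ** B) \<noteq> 0" and [measurable]: "h \<in> borel_measurable borel"
      have d: "det A \<noteq> 0" "det B \<noteq> 0" using d by (auto simp: det_mul)
      have "ennreal \<bar>det (A ** B)\<bar> * (\<integral>\<^sup>+x. h ((A ** B) *v x) \<partial>lborel)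
          = ennreal \<bar>det A\<bar> * (ennreal \<bar>det B\<bar> * (\<integral>\<^sup>+x. h (A *v (B *v x)) \<partial>lborel))"
        by (simp add: det_mul abs_mult ennreal_mult matrix_vector_mul_assoc mult.assoc)
      also have "ennreal \<bar>det B\<bar> * (\<integral>\<^sup>+x. h (A *v (B *v x)) \<partial>lborel) = (\<integral>\<^sup>+x. h (A *v x) \<partial>lborel)"
        by (rule B[THEN mp, THEN spec[of _ "\<lambda>x. h (A *v x)"], THEN mp]) (use d in measurable)
      also have "ennreal \<bar>det A\<bar> * \<dots> = (\<integral>\<^sup>+x. h x \<partial>lborel)"
        using A d by simp
      finally show "ennreal \<bar>det (A ** B)\<bar> * (\<integral>\<^sup>+x. h ((A ** B) *v x) \<partial>lborel) = (\<integral>\<^sup>+x. h x \<partial>lborel)" .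
    qed
  next
    fix A :: "real^'n^'n" and i assume "row i A = 0"
    then show "?P A" using det_zero_row(2) by blast
  next
    fix A :: "real^'n^'n" assume dg: "\<And>i j. i \<noteq> j \<Longrightarrow> A $ i $ j = 0"
    show "?P A"
    proof (intro impI allI)
      fix h :: "real^'n \<Rightarrow> ennreal" assume d: "det A \<noteq> 0" and h[measurable]: "h \<in> borel_measurable borel"
      have dA: "det A = (\<Prod>i\<in>UNIV. A $ i $ i)" using dg by (rule det_diagonal)
      \<comment> \<open>The affine formula for \<open>lborel\<close> indexes its scaling factors by
        basis vectors; the quadratic form at \<open>axis i 1\<close> recovers the diagonal entry
        \<open>A $ i $ i\<close>.\<close>
      define c where "c = (\<lambda>b::real^'n. b \<bullet> (A *v b))"
      have ca: "c (axis i 1) = A $ i $ i" for i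
        by (simp add: c_def inner_axis' matrix_vector_mul_component row_def inner_axis)
      have c0: "c j \<noteq> 0" if "j \<in> Basis" for j
        using that d dA by (auto simp: Basis_vec_def ca)
      have pc: "(\<Prod>j\<in>Basis. c j) = det A"
        unfolding Basis_vec_def dA
        by (subst prod.UNION_disjoint) (auto simp: axis_eq_axis ca)
      have T: "(0 + (\<Sum>j\<in>Basis. (c j * (x \<bullet> j)) *\<^sub>R j)) = A *v x" for x
      proof -
        have "(\<Sum>j\<in>Basis. (c j * (x \<bullet> j)) *\<^sub>R j) = (\<Sum>i\<in>UNIV. (A $ i $ i * x $ i) *\<^sub>R axis i 1)"
          unfolding Basis_vec_def
          by (subst sum.UNION_disjoint) (auto simp: axis_eq_axis ca inner_axis)
        also have "\<dots> = A *v x"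
        proof (rule vec_eq_iff[THEN iffD2], rule allI)
          fix k
          have "(A *v x) $ k = (\<Sum>j\<in>UNIV. if j = k then A $ k $ k * x $ k else 0)"
            unfolding matrix_vector_mult_def vec_lambda_beta by (intro sum.cong) (auto simp: dg)
          moreover have "(\<Sum>i\<in>UNIV. (A $ i $ i * x $ i) *\<^sub>R axis i 1) $ k = (\<Sum>j\<in>UNIV. if j = k then A $ k $ k * x $ k else 0)"
            unfolding sum_component by (intro sum.cong) (auto simp: axis_def)
          ultimately show "(\<Sum>i\<in>UNIV. (A $ i $ i * x $ i) *\<^sub>R axis i 1) $ k = (A *v x) $ k" by simp
        qed
        finally show ?thesis by simp
      qed
      have L: "lborel = density (distr lborel borel ((*v) A)) (\<lambda>_. (\<Prod>j\<in>Basis. \<bar>c j\<bar>))"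
        using lborel_affine_euclidean[where c = c and t = 0, OF c0] unfolding T by simp
      have "(\<integral>\<^sup>+x. h x \<partial>lborel) = ennreal (\<Prod>j\<in>Basis. \<bar>c j\<bar>) * (\<integral>\<^sup>+x. h (A *v x) \<partial>lborel)"
        by (subst L) (simp add: nn_integral_density nn_integral_distr nn_integral_cmult prod_nonneg)
      then show "ennreal \<bar>det A\<bar> * (\<integral>\<^sup>+x. h (A *v x) \<partial>lborel) = (\<integral>\<^sup>+x. h x \<partial>lborel)"
        by (simp add: abs_prod[symmetric] pc)
    qed
  next
    fix m n :: 'n assume mn: "m \<noteq> n"
    let ?\<tau> = "Transposition.transpose m n"
    let ?A = "(\<chi> i j. mat 1 $ i $ ?\<tau> j) :: real^'n^'n"
    have Av: "?A *v x = (\<chi> i. x $ ?\<tau> i)" for x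
    proof (rule vec_eq_iff[THEN iffD2], rule allI)
      fix i
      have "(?A *v x) $ i = (\<Sum>j\<in>UNIV. if j = ?\<tau> i then x $ j else 0)"
        unfolding matrix_vector_mult_def mat_def vec_lambda_beta
        by (intro sum.cong) (auto simp: transpose_eq_iff)
      then show "(?A *v x) $ i = (\<chi> i. x $ ?\<tau> i) $ i" by simp
    qed
    \<comment> \<open>A transposition has sign -1, which the absolute value removes.\<close>
    have dA: "\<bar>det ?A\<bar> = 1"
      using det_permute_columns[of ?\<tau> "mat 1 :: real^'n^'n"] mn
      by (simp add: permutes_swap_id sign_swap_id det_I)
    have L: "lborel = distr lborel borel (\<lambda>x::real^'n. (\<chi> i. x $ ?\<tau> i))"
    proof (rule lborel_eqI)
      fix l u :: "real^'n" assume lu: "\<And>b. b \<in> Basis \<Longrightarrow> l \<bullet> b \<le> u \<bullet> b"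
      have [measurable]: "(\<lambda>x::real^'n. (\<chi> i. x $ ?\<tau> i)) \<in> borel_measurable borel"
        by (intro borel_measurable_continuous_onI continuous_intros)
      have lu': "l $ i \<le> u $ i" for i
        using lu[of "axis i 1"] by (auto simp: Basis_vec_def inner_axis)
      have P: "(\<Prod>b\<in>Basis. w \<bullet> b) = (\<Prod>i\<in>UNIV. w $ i)" for w :: "real^'n"
        unfolding Basis_vec_def by (subst prod.UNION_disjoint) (auto simp: inner_axis axis_eq_axis)
      have "(\<lambda>x::real^'n. (\<chi> i. x $ ?\<tau> i)) -` box l u \<inter> space lborel = box (\<chi> i. l $ ?\<tau> i) (\<chi> i. u $ ?\<tau> i)"
        by (auto simp: mem_box Basis_vec_def inner_axis) (metis transpose_involutory)+
      then have "emeasure (distr lborel borel (\<lambda>x::real^'n. (\<chi> i. x $ ?\<tau> i))) (box l u)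
          = emeasure lborel (box (\<chi> i. l $ ?\<tau> i) (\<chi> i. u $ ?\<tau> i))"
        by (subst emeasure_distr) auto
      also have "\<dots> = (\<Prod>i\<in>UNIV. (u - l) $ ?\<tau> i)"
      proof (subst emeasure_lborel_box)
        show "ennreal (prod ((\<bullet>) ((\<chi> i. u $ ?\<tau> i) - (\<chi> i. l $ ?\<tau> i))) Basis) = ennreal (\<Prod>i\<in>UNIV. (u - l) $ ?\<tau> i)"
          using P[of "(\<chi> i. u $ ?\<tau> i) - (\<chi> i. l $ ?\<tau> i)"] by simp
      qed (use lu' in \<open>auto simp: Basis_vec_def inner_axis\<close>)
      also have "\<dots> = (\<Prod>i\<in>UNIV. (u - l) $ i)"
        by (subst prod.reindex_bij_betw[of ?\<tau> UNIV UNIV]) auto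
      finally show "emeasure (distr lborel borel (\<lambda>x::real^'n. (\<chi> i. x $ ?\<tau> i))) (box l u) = (\<Prod>b\<in>Basis. (u - l) \<bullet> b)"
        by (simp add: P)
    qed simp
    show "?P ?A"
    proof (intro impI allI)
      fix h :: "real^'n \<Rightarrow> ennreal" assume h[measurable]: "h \<in> borel_measurable borel"
      have [measurable]: "(\<lambda>x::real^'n. (\<chi> i. x $ ?\<tau> i)) \<in> borel_measurable borel"
        by (intro borel_measurable_continuous_onI continuous_intros)
      have "(\<integral>\<^sup>+x. h x \<partial>lborel) = (\<integral>\<^sup>+x. h (\<chi> i. x $ ?\<tau> i) \<partial>lborel)"
        by (subst L) (simp add: nn_integral_distr)
      then show "ennreal \<bar>det ?A\<bar> * (\<integral>\<^sup>+x. h (?A *v x) \<partial>lborel) = (\<integral>\<^sup>+x. h x \<partial>lborel)"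
        unfolding Av dA by simp
    qed
  next
    fix m n :: 'n and c assume mn: "m \<noteq> n"
    let ?A = "(\<chi> i j. if i = m \<and> j = n then c else of_bool (i = j)) :: real^'n^'n"
    have Av: "?A *v x = (\<chi> i. if i = m then x $ m + c * x $ n else x $ i)" for x
    proof (rule vec_eq_iff[THEN iffD2], rule allI)
      fix i
      have "(?A *v x) $ i = (\<Sum>j\<in>UNIV. (if j = i then x $ i else 0) + (if j = n then (if i = m then c * x $ n else 0) else 0))"
        unfolding matrix_vector_mult_def vec_lambda_beta using mn by (intro sum.cong) auto
      then show "(?A *v x) $ i = (\<chi> i. if i = m then x $ m + c * x $ n else x $ i) $ i"
        by (simp add: sum.distrib)
    qed
    have "?A = (\<chi> k. if k = m then row m (mat 1) + c *s row n (mat 1) else row k (mat 1 :: real^'n^'n))"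
      using mn by (auto simp: vec_eq_iff row_def mat_def)
    then have dA: "det ?A = 1"
      using det_row_operation[OF mn, of "mat 1" c] by simp
    show "?P ?A"
      unfolding Av dA using nn_integral_lborel_shear[OF _ mn] by simp
  qed
  then show ?thesis using assms by blast
qed

section \<open>Multivariate normal laws\<close>

lemma matrix_inv_eqI:
  fixes A B :: "real^'n^'n"
  assumes "A ** B = mat 1"
  shows "matrix_inv A = B" and "invertible A"
proof -
  have BA: "B ** A = mat 1" using assms matrix_left_right_inverse by blast
  have "A ** matrix_inv A = mat 1 \<and> matrix_inv A ** A = mat 1"
    unfolding matrix_inv_def by (rule someI[of _ B]) (use assms BA in auto)
  then show "matrix_inv A = B"
    by (metis BA matrix_mul_assoc matrix_mul_lid matrix_mul_rid)
  show "invertible A"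
    using assms BA invertible_def by blast
qed

text \<open>Gram-Schmidt for the inner product given by \<open>J\<close>: the columns of
  \<open>A\<close> are a \<open>J\<close>-orthonormal basis. It plays the part of a square root of
  the inverse of \<open>J\<close> without any spectral theory.\<close>

lemma gram_schmidt_quadratic_form:
  fixes J :: "real^'n^'n"
  assumes sym: "transpose J = J" and pos: "\<And>x. x \<noteq> 0 \<Longrightarrow> 0 < x \<bullet> (J *v x)"
  obtains A :: "real^'n^'n" where "transpose A ** J ** A = mat 1"
proof -
  have symJ: "x \<bullet> (J *v y) = y \<bullet> (J *v x)" for x y
    by (metis dot_lmul_matrix inner_commute sym transpose_matrix_vector)
  \<comment> \<open>The vectors built for \<open>I\<close> are supported in \<open>I\<close>. Hence
    subtracting projections from \<open>axis k 1\<close> with \<open>k\<close> outside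
    \<open>I\<close> leaves coordinate \<open>k\<close> equal to 1, so the new vector is nonzero and
    can be normalized.\<close>
  have "\<exists>b :: 'n \<Rightarrow> real^'n. (\<forall>i\<in>I. \<forall>j\<in>I. b i \<bullet> (J *v b j) = of_bool (i = j)) \<and> (\<forall>i\<in>I. \<forall>k. k \<notin> I \<longrightarrow> b i $ k = 0)"
    if "finite I" for I :: "'n set"
    using that
  proof (induction I)
    case empty then show ?case by simp
  next
    case (insert k I)
    then obtain b :: "'n \<Rightarrow> real^'n" where b: "\<And>i j. i \<in> I \<Longrightarrow> j \<in> I \<Longrightarrow> b i \<bullet> (J *v b j) = of_bool (i = j)"
      and b0: "\<And>i k. i \<in> I \<Longrightarrow> k \<notin> I \<Longrightarrow> b i $ k = 0" by metis
    define v where "v = axis k 1 - (\<Sum>i\<in>I. (axis k 1 \<bullet> (J *v b i)) *\<^sub>R b i)"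
    have vk: "v $ k = 1"
      using insert.hyps b0 by (simp add: v_def)
    then have "v \<noteq> 0" by auto
    then have vp: "0 < v \<bullet> (J *v v)" by (rule pos)
    have vo: "v \<bullet> (J *v b j) = 0" if "j \<in> I" for j
    proof -
      have "(\<Sum>i\<in>I. (axis k 1 \<bullet> (J *v b i)) * (b i \<bullet> (J *v b j))) = (\<Sum>i\<in>I. if i = j then axis k 1 \<bullet> (J *v b j) else 0)"
        by (intro sum.cong) (auto simp: b that)
      then show ?thesis
        using insert.hyps that by (simp add: v_def inner_diff_left inner_sum_left)
    qed
    define w where "w = (1 / sqrt (v \<bullet> (J *v v))) *\<^sub>R v"
    have ww: "w \<bullet> (J *v w) = 1"
      using vp by (simp add: w_def matrix_vector_mult_scaleR divide_simps)
    have wo: "w \<bullet> (J *v b j) = 0" "b j \<bullet> (J *v w) = 0" if "j \<in> I" for j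
      using vo[OF that] symJ[of "b j" w] by (auto simp: w_def)
    have w0: "w $ j = 0" if "j \<notin> insert k I" for j
      using that b0 by (simp add: w_def v_def axis_def)
    show ?case
    proof (intro exI[of _ "b(k := w)"] conjI ballI allI impI)
      fix i j assume "i \<in> insert k I" "j \<in> insert k I"
      then show "(b(k := w)) i \<bullet> (J *v (b(k := w)) j) = of_bool (i = j)"
        using insert.hyps by (auto simp: ww wo b)
    next
      fix i j assume "i \<in> insert k I" "j \<notin> insert k I"
      then show "(b(k := w)) i $ j = 0"
        using b0 w0 by auto
    qed
  qed
  from this[of UNIV] obtain b :: "'n \<Rightarrow> real^'n" where b: "\<And>i j. b i \<bullet> (J *v b j) = of_bool (i = j)" by auto
  let ?B = "transpose (\<chi> i. b i) :: real^'n^'n"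
  have B: "?B *v axis i 1 = b i" for i
    by (simp add: vec_eq_iff column_def transpose_def flip: matrix_vector_mult_basis[unfolded axis_def])
       (simp add: matrix_vector_mult_def axis_def if_distrib cong: if_cong)
  have "(transpose ?B ** J ** ?B) $ i $ j = (mat 1 :: real^'n^'n) $ i $ j" for i j
  proof -
    have "(transpose ?B ** J ** ?B) $ i $ j = axis i 1 \<bullet> ((transpose ?B ** J ** ?B) *v axis j 1)"
      by (simp add: inner_axis' matrix_vector_mult_basis column_def)
    also have "\<dots> = (?B *v axis i 1) \<bullet> (J *v (?B *v axis j 1))"
      by (metis (no_types) dot_lmul_matrix matrix_vector_mul_assoc transpose_matrix_vector transpose_transpose)
    finally show ?thesis unfolding B b by (simp add: mat_def)
  qed
  then have "transpose ?B ** J ** ?B = mat 1" by (simp add: vec_eq_iff)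
  then show ?thesis using that by blast
qed

abbreviation std_mv_normal :: "(real^'n) measure" where
  "std_mv_normal \<equiv> mv_normal 0 (mat 1)"

lemma std_mv_normal_eq:
  "(std_mv_normal :: (real^'n) measure) = density lborel (\<lambda>x. ennreal (\<Prod>i\<in>UNIV. std_normal_density (x $ i)))"
proof -
  have "matrix_inv (mat 1 :: real^'n^'n) = mat 1"
    by (rule matrix_inv_eqI) simp
  moreover have "exp (- (x \<bullet> x) / 2) / sqrt ((2 * pi) ^ CARD('n)) = (\<Prod>i\<in>UNIV. std_normal_density (x $ i))" for x :: "real^'n"
    by (simp add: normal_density_def inner_vec_def prod_dividef power2_eq_square del: power_mult_distrib real_sqrt_mult flip: real_sqrt_power
        exp_sum[symmetric] sum_negf sum_divide_distrib[symmetric] prod.distrib)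
  ultimately show ?thesis
    by (simp add: mv_normal_def)
qed

lemma sets_mv_normal [simp, measurable_cong]: "sets (mv_normal m S) = sets borel"
  and space_mv_normal [simp]: "space (mv_normal m S) = UNIV"
  by (simp_all add: mv_normal_def)

text \<open>Substituting \<open>A *v x\<close> turns the quadratic form of \<open>J\<close> into
  \<open>x \<bullet> x\<close>, and the Jacobian \<open>\<bar>det A\<bar>\<close> is the square root
  of the determinant of the covariance \<open>A ** transpose A\<close>.\<close>

lemma mv_normal_eq_distr:
  fixes J A :: "real^'n^'n"
  assumes A: "transpose A ** J ** A = mat 1"
  shows "mv_normal 0 (matrix_inv J) = distr std_mv_normal borel ((*v) A)"
    and "invertible J" and "matrix_inv J = A ** transpose A"
proof -
  have 1: "A ** (transpose A ** J) = mat 1"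
    using A matrix_left_right_inverse by blast
  have dd: "det A * det J * det A = 1"
    using arg_cong[OF A, of det] by (simp add: det_mul det_I mult.commute)
  show invJ: "invertible J"
    using dd by (auto simp: invertible_det_nz)
  have 2: "(A ** transpose A) ** J = mat 1" using 1 by (simp add: matrix_mul_assoc)
  then have 3: "J ** (A ** transpose A) = mat 1" using matrix_left_right_inverse by blast
  show Ji: "matrix_inv J = A ** transpose A"
    by (rule matrix_inv_eqI[OF 3])
  \<comment> \<open>\<open>mv_normal\<close> inverts its covariance argument, which is itself an
    inverse here, so \<open>J\<close> reappears in the exponent.\<close>
  have JJ: "matrix_inv (matrix_inv J) = J"
    unfolding Ji by (rule matrix_inv_eqI[OF 2])
  have dA: "det A \<noteq> 0" using dd by auto
  have [measurable]: "(*v) B \<in> borel_measurable borel" for B :: "real^'n^'n"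
    by (intro borel_measurable_continuous_onI matrix_vector_mult_linear_continuous_on)
  have detJ: "sqrt ((2*pi) ^ CARD('n) * det (matrix_inv J)) = sqrt ((2*pi) ^ CARD('n)) * \<bar>det A\<bar>"
    by (simp add: Ji det_mul real_sqrt_mult)
  have I1: "matrix_inv (mat 1 :: real^'n^'n) = mat 1"
    by (rule matrix_inv_eqI) simp
  have q: "(A *v x) \<bullet> (J *v (A *v x)) = x \<bullet> x" for x
  proof -
    have "(A *v x) \<bullet> (J *v (A *v x)) = x \<bullet> ((transpose A ** J ** A) *v x)"
      by (metis (no_types) dot_lmul_matrix matrix_vector_mul_assoc transpose_matrix_vector transpose_transpose)
    then show ?thesis by (simp add: A)
  qed
  show "mv_normal 0 (matrix_inv J) = distr std_mv_normal borel ((*v) A)"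
  proof (rule measure_eqI)
    fix X :: "(real^'n) set" assume "X \<in> sets (mv_normal 0 (matrix_inv J))"
    then have [measurable]: "X \<in> sets borel" by simp
    have "emeasure (mv_normal 0 (matrix_inv J)) X
        = (\<integral>\<^sup>+x. ennreal (exp (- (x \<bullet> (J *v x)) / 2) / sqrt ((2 * pi) ^ CARD('n) * det (matrix_inv J))) * indicator X x \<partial>lborel)"
      unfolding mv_normal_def by (subst emeasure_density) (auto simp: JJ)
    also have "\<dots> = ennreal \<bar>det A\<bar> * (\<integral>\<^sup>+x. ennreal (exp (- ((A *v x) \<bullet> (J *v (A *v x))) / 2) / sqrt ((2 * pi) ^ CARD('n) * det (matrix_inv J))) * indicator X (A *v x) \<partial>lborel)"
      by (rule nn_integral_lborel_linear[OF dA, symmetric]) simp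
    also have "\<dots> = (\<integral>\<^sup>+x. ennreal (exp (- (x \<bullet> x) / 2) / sqrt ((2 * pi) ^ CARD('n))) * indicator X (A *v x) \<partial>lborel)"
      unfolding q detJ using dA
      by (subst nn_integral_cmult[symmetric]) (auto simp: mult.assoc[symmetric] ennreal_mult[symmetric] intro!: nn_integral_cong arg_cong2[where f="(*)"])
    also have "\<dots> = (\<integral>\<^sup>+x. indicator X (A *v x) \<partial>std_mv_normal)"
      unfolding mv_normal_def by (subst nn_integral_density) (auto simp: I1)
    also have "\<dots> = emeasure (distr std_mv_normal borel ((*v) A)) X"
      by (simp add: nn_integral_distr flip: nn_integral_indicator)
    finally show "emeasure (mv_normal 0 (matrix_inv J)) X = \<dots>" .
  qed simp
qed

text \<open>This expresses independence of the coordinates, from which total mass 1 and the product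
  form of the characteristic function follow.\<close>

lemma std_mv_normal_eq_distr:
  "(std_mv_normal :: (real^'n) measure) = distr (\<Pi>\<^sub>M i\<in>UNIV. std_normal_distribution) borel (\<lambda>f. (\<chi> i. f i))"
proof (rule measure_eqI)
  have cart[measurable]: "(\<lambda>f::'n\<Rightarrow>real. (\<chi> i. f i)) \<in> measurable (\<Pi>\<^sub>M i\<in>UNIV. std_normal_distribution) borel"
    "(\<lambda>f::'n\<Rightarrow>real. (\<chi> i. f i)) \<in> measurable (\<Pi>\<^sub>M i\<in>UNIV. lborel) borel"
    by (rule borel_measurable_euclidean_space[THEN iffD2]; auto simp: Basis_vec_def inner_axis)+
  have P: "(\<Pi>\<^sub>M i\<in>(UNIV::'n set). std_normal_distribution) = density (\<Pi>\<^sub>M i\<in>UNIV. lborel) (\<lambda>f. ennreal (\<Prod>i\<in>UNIV. std_normal_density (f i)))"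
    using PiM_density[of "UNIV :: 'n set" "\<lambda>x. ennreal (std_normal_density x)" lborel]
    by (simp add: prod_ennreal prob_space_imp_sigma_finite[OF prob_space_normal_density] lborel.sigma_finite_measure_axioms)
  fix X :: "(real^'n) set" assume "X \<in> sets std_mv_normal"
  then have [measurable]: "X \<in> sets borel" by simp
  have "emeasure std_mv_normal X = (\<integral>\<^sup>+x. ennreal (\<Prod>i\<in>UNIV. std_normal_density (x $ i)) * indicator X x \<partial>lborel)"
    unfolding std_mv_normal_eq by (subst emeasure_density) auto
  also have "\<dots> = (\<integral>\<^sup>+f. ennreal (\<Prod>i\<in>UNIV. std_normal_density (f i)) * indicator X (\<chi> i. f i) \<partial>(\<Pi>\<^sub>M i\<in>UNIV. lborel))"
    by (subst nn_integral_lborel_cartesian) auto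
  also have "\<dots> = (\<integral>\<^sup>+f. indicator X (\<chi> i. f i) \<partial>(\<Pi>\<^sub>M i\<in>UNIV. std_normal_distribution))"
    unfolding P
  proof (subst nn_integral_density)
    show "(\<lambda>f. indicator X (vec_lambda f)) \<in> borel_measurable (\<Pi>\<^sub>M i\<in>(UNIV::'n set). (lborel :: real measure))"
      by (rule measurable_compose[OF cart(2)]) measurable
    have "(\<lambda>f. std_normal_density (f i)) \<in> borel_measurable (\<Pi>\<^sub>M i\<in>(UNIV::'n set). (lborel :: real measure))" for i
      by (rule measurable_compose[of "\<lambda>f. f i" _ lborel]) (rule measurable_component_singleton, simp, simp)
    then show "(\<lambda>f. ennreal (\<Prod>i\<in>UNIV. std_normal_density (f i))) \<in> borel_measurable (\<Pi>\<^sub>M i\<in>(UNIV::'n set). (lborel :: real measure))"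
      by (intro measurable_compose[OF _ measurable_ennreal] borel_measurable_prod) auto
  qed simp
  also have "\<dots> = (\<integral>\<^sup>+x. indicator X x \<partial>distr (\<Pi>\<^sub>M i\<in>UNIV. std_normal_distribution) borel (\<lambda>f. (\<chi> i. f i)))"
    by (rule nn_integral_distr[symmetric, OF cart(1)]) measurable
  finally show "emeasure std_mv_normal X = emeasure (distr (\<Pi>\<^sub>M i\<in>UNIV. std_normal_distribution) borel (\<lambda>f. (\<chi> i. f i))) X"
    by simp
qed simp

lemma prob_space_std_mv_normal: "prob_space (std_mv_normal :: (real^'n) measure)"
proof -
  interpret product_prob_space "\<lambda>_::'n. std_normal_distribution" UNIV
    by (rule product_prob_spaceI) (auto intro: prob_space_normal_density)
  have [measurable]: "(\<lambda>f::'n\<Rightarrow>real. (\<chi> i. f i)) \<in> measurable (\<Pi>\<^sub>M i\<in>UNIV. std_normal_distribution) borel"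
    by (rule borel_measurable_euclidean_space[THEN iffD2]; auto simp: Basis_vec_def inner_axis)
  show ?thesis
    unfolding std_mv_normal_eq_distr by (rule prob_space_distr) measurable
qed

lemma measure_std_mv_normal_UNIV [simp]: "measure (std_mv_normal :: (real^'n) measure) UNIV = 1"
  using prob_space.prob_space[OF prob_space_std_mv_normal] by simp

lemma char_std_mv_normal: "(CLINT x|(std_mv_normal :: (real^'n) measure). iexp (t \<bullet> x)) = exp (- (t \<bullet> t) / 2)"
proof -
  interpret product_sigma_finite "\<lambda>_::'n. std_normal_distribution"
    by (rule product_sigma_finite.intro) (rule prob_space_imp_sigma_finite[OF prob_space_normal_density], simp)
  have cart[measurable]: "(\<lambda>f::'n\<Rightarrow>real. (\<chi> i. f i)) \<in> measurable (\<Pi>\<^sub>M i\<in>UNIV. std_normal_distribution) borel"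
    by (rule borel_measurable_euclidean_space[THEN iffD2]; auto simp: Basis_vec_def inner_axis)
  have "(CLINT x|(std_mv_normal :: (real^'n) measure). iexp (t \<bullet> x)) = (CLINT f|(\<Pi>\<^sub>M i\<in>UNIV. std_normal_distribution). iexp (t \<bullet> (\<chi> i. f i)))"
    unfolding std_mv_normal_eq_distr by (rule integral_distr[OF cart]) measurable
  also have "\<dots> = (CLINT f|(\<Pi>\<^sub>M i\<in>UNIV. std_normal_distribution). (\<Prod>i\<in>UNIV. iexp (t $ i * f i)))"
    by (simp add: inner_vec_def sum_distrib_left flip: exp_sum)
  also have "\<dots> = (\<Prod>i\<in>UNIV. CLINT x|std_normal_distribution. iexp (t $ i * x))"
  proof (rule product_integral_prod)
    interpret N: prob_space std_normal_distribution by (rule prob_space_normal_density) simp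
    show "integrable std_normal_distribution (\<lambda>x. iexp (t $ i * x))" for i
      by (rule N.integrable_const_bound[where B=1]) auto
  qed simp
  also have "\<dots> = (\<Prod>i\<in>UNIV. complex_of_real (exp (- (t $ i)\<^sup>2 / 2)))"
    using char_std_normal_distribution by (simp add: char_def fun_eq_iff)
  also have "\<dots> = complex_of_real (\<Prod>i\<in>UNIV. exp (- (t $ i)\<^sup>2 / 2))"
    by simp
  also have "(\<Prod>i\<in>UNIV. exp (- (t $ i)\<^sup>2 / 2)) = exp (- (t \<bullet> t) / 2)"
    by (simp add: inner_vec_def sum_negf sum_divide_distrib power2_eq_square flip: exp_sum)
  finally show ?thesis .
qed

section \<open>Weak convergence from characteristic functions\<close>

text \<open>The Gaussian kernel is the characteristic function of the normal law, so convergence of characteristic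
  functions gives convergence of integrals of Gaussian kernels.\<close>

lemma integral_gaussian_kernel:
  fixes y :: "real^'n"
  assumes "prob_space Q" and [measurable_cong]: "sets Q = sets borel"
  shows "(\<integral>x. exp (- ((c *\<^sub>R (x - y)) \<bullet> (c *\<^sub>R (x - y))) / 2) \<partial>Q)
       = Re (CLINT z|std_mv_normal. iexp (- c * (z \<bullet> y)) * (CLINT x|Q. iexp ((c *\<^sub>R z) \<bullet> x)))"
proof -
  interpret Q: prob_space Q by fact
  interpret N: prob_space "std_mv_normal :: (real^'n) measure" by (rule prob_space_std_mv_normal)
  interpret P: pair_prob_space Q "std_mv_normal :: (real^'n) measure" ..
  \<comment> \<open>The joint integrand has modulus 1 and both measures are probabilities, so the
    two integrations may be exchanged.\<close>
  have int: "integrable (Q \<Otimes>\<^sub>M (std_mv_normal :: (real^'n) measure)) (\<lambda>(x, z). iexp ((c *\<^sub>R (x - y)) \<bullet> z))"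
    by (rule P.integrable_const_bound[where B=1]) auto
  have "complex_of_real (\<integral>x. exp (- ((c *\<^sub>R (x - y)) \<bullet> (c *\<^sub>R (x - y))) / 2) \<partial>Q)
      = (CLINT x|Q. exp (- ((c *\<^sub>R (x - y)) \<bullet> (c *\<^sub>R (x - y))) / 2))"
    by simp
  also have "\<dots> = (CLINT x|Q. CLINT z|std_mv_normal. iexp ((c *\<^sub>R (x - y)) \<bullet> z))"
    unfolding char_std_mv_normal ..
  also have "\<dots> = (CLINT z|std_mv_normal. CLINT x|Q. iexp ((c *\<^sub>R (x - y)) \<bullet> z))"
    using P.Fubini_integral[OF int] by simp
  also have "\<dots> = (CLINT z|std_mv_normal. iexp (- c * (z \<bullet> y)) * (CLINT x|Q. iexp ((c *\<^sub>R z) \<bullet> x)))"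
    by (subst integral_mult_right_zero[symmetric])
       (simp add: inner_diff_left inner_commute algebra_simps flip: exp_add)
  finally show ?thesis
    by (metis Re_complex_of_real)
qed

lemma gaussian_kernel_tendsto:
  fixes Q :: "nat \<Rightarrow> (real^'n) measure"
  assumes Q: "\<And>n. prob_space (Q n)" "\<And>n. sets (Q n) = sets borel"
    and L: "prob_space L" "sets L = sets borel"
    and char: "\<And>t. (\<lambda>n. CLINT x|Q n. iexp (t \<bullet> x)) \<longlonglongrightarrow> (CLINT x|L. iexp (t \<bullet> x))"
  shows "(\<lambda>n. \<integral>x. exp (- ((c *\<^sub>R (x - y)) \<bullet> (c *\<^sub>R (x - y))) / 2) \<partial>Q n)
     \<longlonglongrightarrow> (\<integral>x. exp (- ((c *\<^sub>R (x - y)) \<bullet> (c *\<^sub>R (x - y))) / 2) \<partial>L)"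
  unfolding integral_gaussian_kernel[OF Q] integral_gaussian_kernel[OF L]
proof (rule tendsto_Re, rule integral_dominated_convergence[where w="\<lambda>_. 1"])
  interpret N: prob_space "std_mv_normal :: (real^'n) measure" by (rule prob_space_std_mv_normal)
  have M: "(\<lambda>z. iexp (- c * (z \<bullet> y)) * (CLINT x|R. iexp ((c *\<^sub>R z) \<bullet> x))) \<in> borel_measurable std_mv_normal"
    if "prob_space R" "sets R = sets borel" for R :: "(real^'n) measure"
  proof -
    interpret R: prob_space R by fact
    note that(2)[measurable_cong]
    show ?thesis by measurable
  qed
  show "(\<lambda>z. iexp (- c * (z \<bullet> y)) * (CLINT x|L. iexp ((c *\<^sub>R z) \<bullet> x))) \<in> borel_measurable std_mv_normal"
    "\<And>n. (\<lambda>z. iexp (- c * (z \<bullet> y)) * (CLINT x|Q n. iexp ((c *\<^sub>R z) \<bullet> x))) \<in> borel_measurable std_mv_normal"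
    using M Q L by auto
  show "AE z in std_mv_normal. (\<lambda>n. iexp (- c * (z \<bullet> y)) * (CLINT x|Q n. iexp ((c *\<^sub>R z) \<bullet> x)))
      \<longlonglongrightarrow> iexp (- c * (z \<bullet> y)) * (CLINT x|L. iexp ((c *\<^sub>R z) \<bullet> x))"
    by (intro AE_I2 tendsto_mult tendsto_const char)
  show "AE z in std_mv_normal. norm (iexp (- c * (z \<bullet> y)) * (CLINT x|Q n. iexp ((c *\<^sub>R z) \<bullet> x))) \<le> 1" for n
  proof (rule AE_I2)
    fix z
    interpret Qn: prob_space "Q n" by (rule Q)
    have "norm (CLINT x|Q n. iexp ((c *\<^sub>R z) \<bullet> x)) \<le> (\<integral>x. norm (iexp ((c *\<^sub>R z) \<bullet> x)) \<partial>Q n)"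
      by (rule integral_norm_bound)
    also have "\<dots> = 1" by (simp add: Qn.prob_space)
    finally show "norm (iexp (- c * (z \<bullet> y)) * (CLINT x|Q n. iexp ((c *\<^sub>R z) \<bullet> x))) \<le> 1"
      by (simp add: norm_mult)
  qed
  show "integrable (std_mv_normal :: (real^'n) measure) (\<lambda>_. 1 :: real)" by simp
qed

text \<open>Averaging over a Gaussian shift of small scale: uniform continuity controls small
  shifts, the Gaussian tail the large ones. The bound is uniform in \<open>x\<close>, hence valid
  under every law at once.\<close>

lemma compact_support_smoothing:
  fixes F :: "real^'n \<Rightarrow> real"
  assumes F: "continuous_on UNIV F" and supp: "\<And>x. R < norm x \<Longrightarrow> F x = 0" and "0 < \<epsilon>"
  obtains s where "0 < s" "\<And>x. \<bar>F x - (\<integral>u. F (x + s *\<^sub>R u) \<partial>std_mv_normal)\<bar> \<le> \<epsilon>"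
proof -
  interpret N: prob_space "std_mv_normal :: (real^'n) measure" by (rule prob_space_std_mv_normal)
  have Fm[measurable]: "F \<in> borel_measurable borel" using F by (rule borel_measurable_continuous_onI)
  have "bounded (F ` cball 0 R)"
    by (intro compact_imp_bounded compact_continuous_image continuous_on_subset[OF F]) auto
  then obtain B0 where "\<forall>x\<in>cball 0 R. \<bar>F x\<bar> \<le> B0" unfolding bounded_iff by auto
  then have B: "\<bar>F x\<bar> \<le> max B0 1" for x
    using supp[of x] by (cases "norm x \<le> R") (auto simp: le_max_iff_disj)
  define B where "B = max B0 1"
  have B: "\<bar>F x\<bar> \<le> B" "B > 0" for x using B by (auto simp: B_def)
  \<comment> \<open>Shifts will be shorter than 1. A point of norm at most \<open>R + 1\<close> then
    stays in the ball of radius \<open>R + 2\<close>, and a point farther out keeps norm above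
    \<open>R\<close>, where \<open>F\<close> is zero before and after the shift.\<close>
  have "uniformly_continuous_on (cball 0 (R + 2)) F"
    by (intro compact_uniformly_continuous continuous_on_subset[OF F]) auto
  then obtain d where d: "d > 0" "\<And>x y. x \<in> cball 0 (R + 2) \<Longrightarrow> y \<in> cball 0 (R + 2) \<Longrightarrow> dist x y < d \<Longrightarrow> dist (F x) (F y) < \<epsilon> / 2"
    unfolding uniformly_continuous_on_def using \<open>0 < \<epsilon>\<close> by (metis half_gt_zero)
  define d' where "d' = min d 1"
  have d': "d' > 0" using d by (simp add: d'_def)
  have uc: "\<bar>F x - F (x + v)\<bar> \<le> \<epsilon> / 2" if "norm v < d'" for x v
  proof (cases "norm x \<le> R + 1")
    case True
    moreover have "norm (x + v) \<le> norm x + norm v" by (rule norm_triangle_ineq)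
    ultimately have "x \<in> cball 0 (R + 2)" "x + v \<in> cball 0 (R + 2)"
      using that by (auto simp only: mem_cball_0 d'_def)
    then show ?thesis
      using d(2)[of x "x + v"] that by (auto simp: d'_def dist_norm)
  next
    case False
    moreover have "norm x \<le> norm (x + v) + norm v"
      using norm_triangle_ineq4[of "x + v" v] by simp
    ultimately have "R < norm x" "R < norm (x + v)" using that by (auto simp: d'_def)
    then show ?thesis using supp \<open>0 < \<epsilon>\<close> by simp
  qed
  have "(\<lambda>k. \<integral>u. indicator {u :: real^'n. norm u \<ge> real k} u \<partial>std_mv_normal) \<longlonglongrightarrow> (\<integral>u. (0::real) \<partial>(std_mv_normal :: (real^'n) measure))"
  proof (rule integral_dominated_convergence[where w="\<lambda>_. 1 :: real"])
    show "AE u in (std_mv_normal :: (real^'n) measure). (\<lambda>k. indicator {u. norm u \<ge> real k} u :: real) \<longlonglongrightarrow> 0"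
    proof (rule AE_I2)
      fix u :: "real^'n"
      have "\<forall>\<^sub>F k in sequentially. indicator {u. norm u \<ge> real k} u = (0 :: real)"
        using eventually_gt_at_top[of "nat \<lceil>norm u\<rceil>"] by eventually_elim (auto simp: indicator_def, linarith)
      then show "(\<lambda>k. indicator {u. norm u \<ge> real k} u :: real) \<longlonglongrightarrow> 0"
        by (rule tendsto_eventually)
    qed
  qed (auto simp: indicator_def)
  then have "\<forall>\<^sub>F k in sequentially. (\<integral>u. indicator {u :: real^'n. norm u \<ge> real k} u \<partial>std_mv_normal) < \<epsilon> / (4 * B)"
    using \<open>0 < \<epsilon>\<close> B(2) by (intro order_tendstoD(2)) auto
  then have "\<forall>\<^sub>F k in sequentially. (\<integral>u. indicator {u :: real^'n. norm u \<ge> real k} u \<partial>std_mv_normal) < \<epsilon> / (4 * B) \<and> k > 0"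
    using eventually_gt_at_top[of 0] by eventually_elim auto
  from eventually_happens'[OF _ this] obtain k where k: "(\<integral>u. indicator {u :: real^'n. norm u \<ge> real k} u \<partial>std_mv_normal) < \<epsilon> / (4 * B)" "k > 0"
    by auto
  \<comment> \<open>With this scale \<open>norm u < k\<close> gives a shift shorter than
    \<open>d'\<close>. The remaining \<open>u\<close> have probability below
    \<open>\<epsilon> / (4 * B)\<close> and cost at most \<open>2 * B\<close> each, that is
    \<open>\<epsilon> / 2\<close> in total.\<close>
  define s where "s = d' / real k"
  have s: "s > 0" using d' k by (simp add: s_def)
  show ?thesis
  proof (rule that[OF s])
    fix x
    have i1: "integrable std_mv_normal (\<lambda>u. F (x + s *\<^sub>R u))"
      by (rule N.integrable_const_bound[where B=B]) (auto simp: B)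
    have "F x - (\<integral>u. F (x + s *\<^sub>R u) \<partial>std_mv_normal) = (\<integral>u. F x - F (x + s *\<^sub>R u) \<partial>std_mv_normal)"
      using i1 by (simp add: N.prob_space)
    then have "\<bar>F x - (\<integral>u. F (x + s *\<^sub>R u) \<partial>std_mv_normal)\<bar> \<le> (\<integral>u. \<bar>F x - F (x + s *\<^sub>R u)\<bar> \<partial>std_mv_normal)"
      by (simp only: integral_abs_bound)
    also have "\<dots> \<le> (\<integral>u. \<epsilon> / 2 + 2 * B * indicator {u :: real^'n. norm u \<ge> real k} u \<partial>std_mv_normal)"
    proof (rule integral_mono)
      show "integrable std_mv_normal (\<lambda>u. \<bar>F x - F (x + s *\<^sub>R u)\<bar>)" using i1 by simp
      show "integrable std_mv_normal (\<lambda>u :: real^'n. \<epsilon> / 2 + 2 * B * indicator {u. norm u \<ge> real k} u)"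
        by (rule N.integrable_const_bound[where B="\<epsilon> / 2 + 2 * B"]) (use B(2) \<open>0 < \<epsilon>\<close> in \<open>auto simp: indicator_def\<close>)
      fix u
      show "\<bar>F x - F (x + s *\<^sub>R u)\<bar> \<le> \<epsilon> / 2 + 2 * B * indicator {u. norm u \<ge> real k} u"
      proof (cases "norm u \<ge> real k")
        case True
        then show ?thesis using B(1)[of x] B(1)[of "x + s *\<^sub>R u"] \<open>0 < \<epsilon>\<close> by (simp add: indicator_def)
      next
        case False
        then have "norm (s *\<^sub>R u) < d'" using s k d' by (simp add: s_def field_simps)
        then show ?thesis using uc[of "s *\<^sub>R u" x] False by (simp add: indicator_def)
      qed
    qed
    also have "\<dots> = \<epsilon> / 2 + 2 * B * (\<integral>u. indicator {u :: real^'n. norm u \<ge> real k} u \<partial>std_mv_normal)"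
    proof -
      have "integrable std_mv_normal (\<lambda>u :: real^'n. indicator {u. norm u \<ge> real k} u :: real)"
        by (intro N.integrable_const_bound[where B=1]) (auto simp: indicator_def)
      then show ?thesis by (subst Bochner_Integration.integral_add) (auto simp: N.prob_space)
    qed
    also have "\<dots> \<le> \<epsilon> / 2 + 2 * B * (\<epsilon> / (4 * B))"
      using k B(2) by (intro add_left_mono mult_left_mono) auto
    also have "\<dots> = \<epsilon>" using B(2) by simp
    finally show "\<bar>F x - (\<integral>u. F (x + s *\<^sub>R u) \<partial>std_mv_normal)\<bar> \<le> \<epsilon>" .
  qed
qed

lemma integrable_compact_support:
  fixes F :: "real^'n \<Rightarrow> real"
  assumes F: "continuous_on UNIV F" and supp: "\<And>x. R < norm x \<Longrightarrow> F x = 0"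
  shows "integrable lborel F"
proof -
  have "integrable lborel (\<lambda>x. indicator (cball 0 R) x *\<^sub>R F x)"
    by (intro borel_integrable_compact continuous_on_subset[OF F]) auto
  moreover have "(\<lambda>x. indicator (cball 0 R) x *\<^sub>R F x) = F"
    using supp by (auto simp: fun_eq_iff indicator_def not_le)
  ultimately show ?thesis by simp
qed

text \<open>The substitution \<open>y = x + s *\<^sub>R u\<close> moves the Gaussian shift out of
  \<open>F\<close> and into a kernel, and Fubini then integrates the kernel against \<open>Q\<close>
  first. The smoothed integral thus depends on \<open>Q\<close> only through integrals of Gaussian
  kernels.\<close>

lemma integral_smoothing:
  fixes F :: "real^'n \<Rightarrow> real"
  assumes F: "continuous_on UNIV F" and supp: "\<And>x. R < norm x \<Longrightarrow> F x = 0" and s: "0 < s"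
    and Q: "prob_space Q" and [measurable_cong]: "sets Q = sets borel"
  defines "K \<equiv> \<lambda>x y. exp (- (((1/s) *\<^sub>R (x - y)) \<bullet> ((1/s) *\<^sub>R (x - y))) / 2)"
  shows "(\<integral>x. (\<integral>u. F (x + s *\<^sub>R u) \<partial>std_mv_normal) \<partial>Q)
    = (\<integral>y. F y * (\<integral>x. K x y \<partial>Q) \<partial>lborel) / (s ^ CARD('n) * sqrt ((2 * pi) ^ CARD('n)))"
proof -
  interpret Q: prob_space Q by fact
  interpret P: pair_sigma_finite Q "lborel :: (real^'n) measure" ..
  have [measurable]: "F \<in> borel_measurable borel" using F by (rule borel_measurable_continuous_onI)
  have Fi: "integrable lborel F" using integrable_compact_support[OF F supp] .
  have Km[measurable]: "(\<lambda>p. K (fst p) (snd p)) \<in> borel_measurable (borel \<Otimes>\<^sub>M borel)"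
    unfolding K_def by measurable
  have [measurable]: "K x \<in> borel_measurable borel" for x
    unfolding K_def by measurable
  have Kb: "0 \<le> K x y" "K x y \<le> 1" for x y
    by (auto simp: K_def)
  have Fk: "integrable lborel (\<lambda>y. F y * K x y)" for x
  proof (rule Bochner_Integration.integrable_bound[OF Fi])
    show "AE y in lborel. norm (F y * K x y) \<le> norm (F y)"
      using Kb by (intro AE_I2) (simp add: abs_mult mult_left_le)
  qed measurable
  let ?C = "sqrt ((2 * pi) ^ CARD('n))"
  have I1: "matrix_inv (mat 1 :: real^'n^'n) = mat 1"
    by (rule matrix_inv_eqI) simp
  have inner: "(\<integral>u. F (x + s *\<^sub>R u) \<partial>std_mv_normal) = (\<integral>y. F y * K x y \<partial>lborel) / (s ^ CARD('n) * ?C)" for x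
  proof -
    have "(\<integral>u. F (x + s *\<^sub>R u) \<partial>std_mv_normal) = (\<integral>u. exp (- (u \<bullet> u) / 2) / ?C * F (x + s *\<^sub>R u) \<partial>lborel)"
      unfolding mv_normal_def by (subst integral_density) (auto simp: I1)
    moreover have "(\<integral>y. F y * K x y \<partial>lborel) = s ^ CARD('n) * (\<integral>u. F (x + s *\<^sub>R u) * K x (x + s *\<^sub>R u) \<partial>lborel)"
      using s by (subst lborel_affine[of s x]) (auto simp: integral_density integral_distr)
    moreover have "K x (x + s *\<^sub>R u) = exp (- (u \<bullet> u) / 2)" for u
      using s by (simp add: K_def)
    ultimately show ?thesis using s by (simp add: mult_ac)
  qed
  \<comment> \<open>The kernel is bounded by 1 and \<open>F\<close> is Lebesgue integrable, which
    gives a bound uniform in \<open>x\<close>.\<close>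
  have "integrable (Q \<Otimes>\<^sub>M lborel) (\<lambda>(x, y). F y * K x y)"
  proof (rule P.Fubini_integrable)
    have "(\<integral>y. norm (F y * K x y) \<partial>lborel) \<le> (\<integral>y. norm (F y) \<partial>lborel)" for x
      by (intro integral_mono integrable_norm Fk Fi) (auto simp: abs_mult mult_left_le Kb)
    then show "integrable Q (\<lambda>x. \<integral>y. norm (case (x, y) of (x, y) \<Rightarrow> F y * K x y) \<partial>lborel)"
      by (intro Q.integrable_const_bound[where B="\<integral>y. norm (F y) \<partial>lborel"]) (auto simp: abs_of_nonneg)
  qed (use Fk in auto)
  then have "(\<integral>x. (\<integral>y. F y * K x y \<partial>lborel) \<partial>Q) = (\<integral>y. (\<integral>x. F y * K x y \<partial>Q) \<partial>lborel)"
    using P.Fubini_integral by fastforce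
  then show ?thesis unfolding inner by simp
qed

text \<open>For compactly supported test functions, smoothing reduces the claim to Gaussian kernels.
  Tightness is not assumed: since \<open>L\<close> has mass 1, a compactly supported cutoff retains
  almost all of it, and by the first case it retains almost all of \<open>Q n\<close> for large
  \<open>n\<close>.\<close>

theorem mv_levy_continuity:
  fixes Q :: "nat \<Rightarrow> (real^'n) measure"
  assumes Q: "\<And>n. prob_space (Q n)" "\<And>n. sets (Q n) = sets borel"
    and L: "prob_space L" "sets L = sets borel"
    and char: "\<And>t. (\<lambda>n. CLINT x|Q n. iexp (t \<bullet> x)) \<longlonglongrightarrow> (CLINT x|L. iexp (t \<bullet> x))"
  shows "weakly_converges Q L"
proof -
  note Q(2)[measurable_cong] L(2)[measurable_cong]
  interpret Q: prob_space "Q n" for n by (rule Q)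
  interpret L: prob_space L by (rule L)
  interpret N: prob_space "std_mv_normal :: (real^'n) measure" by (rule prob_space_std_mv_normal)
  have Cc: "(\<lambda>n. \<integral>x. F x \<partial>Q n) \<longlonglongrightarrow> (\<integral>x. F x \<partial>L)"
    if F: "continuous_on UNIV F" and supp: "\<And>x. R < norm x \<Longrightarrow> F x = 0" and B: "\<And>x. \<bar>F x\<bar> \<le> B" for F :: "real^'n \<Rightarrow> real" and R B
  proof (rule LIMSEQ_I)
    fix e :: real assume "e > 0"
    then have "0 < e / 3" by simp
    have [measurable]: "F \<in> borel_measurable borel" using F by (rule borel_measurable_continuous_onI)
    obtain s where s: "0 < s" "\<And>x. \<bar>F x - (\<integral>u. F (x + s *\<^sub>R u) \<partial>std_mv_normal)\<bar> \<le> e/3"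
      using compact_support_smoothing[OF F supp \<open>0 < e/3\<close>] by metis
    let ?S = "\<lambda>x. \<integral>u. F (x + s *\<^sub>R u) \<partial>std_mv_normal"
    have B0: "0 \<le> B" using B[of 0] by simp
    have SB: "\<bar>?S x\<bar> \<le> B" for x
    proof -
      have "norm (?S x) \<le> (\<integral>u. norm (F (x + s *\<^sub>R u)) \<partial>std_mv_normal)" by (rule integral_norm_bound)
      also have "\<dots> \<le> (\<integral>u. B \<partial>(std_mv_normal :: (real^'n) measure))"
        by (intro integral_mono N.integrable_const_bound[where B=B]) (auto simp: B B0)
      finally show ?thesis using N.prob_space by simp
    qed
    have close: "\<bar>(\<integral>x. F x \<partial>M) - (\<integral>x. ?S x \<partial>M)\<bar> \<le> e/3"
      if M: "prob_space M" "sets M = sets borel" for M :: "(real^'n) measure"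
    proof -
      interpret M: prob_space M by (rule M)
      note M(2)[measurable_cong]
      have i1: "integrable M F"
        by (rule M.integrable_const_bound[where B=B]) (simp_all add: B)
      have i2: "integrable M ?S"
      proof (rule M.integrable_const_bound[where B=B])
        show "?S \<in> borel_measurable M" by measurable
      qed (simp add: SB)
      have "(\<integral>x. F x \<partial>M) - (\<integral>x. ?S x \<partial>M) = (\<integral>x. F x - ?S x \<partial>M)"
        by (rule Bochner_Integration.integral_diff[symmetric, OF i1 i2])
      then have "\<bar>(\<integral>x. F x \<partial>M) - (\<integral>x. ?S x \<partial>M)\<bar> \<le> (\<integral>x. \<bar>F x - ?S x\<bar> \<partial>M)"
        by (simp only: integral_abs_bound)
      also have "\<dots> \<le> (\<integral>x. e/3 \<partial>M)"
        using s by (intro integral_mono integrable_abs Bochner_Integration.integrable_diff i1 i2) auto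
      finally show ?thesis by (simp add: M.prob_space)
    qed
    have smooth: "(\<integral>x. ?S x \<partial>M) = (\<integral>y. F y * (\<integral>x. exp (- (((1/s) *\<^sub>R (x - y)) \<bullet> ((1/s) *\<^sub>R (x - y))) / 2) \<partial>M) \<partial>lborel) / (s ^ CARD('n) * sqrt ((2 * pi) ^ CARD('n)))"
      if "prob_space M" "sets M = sets borel" for M :: "(real^'n) measure"
      using supp by (rule integral_smoothing[OF F _ s(1) that])
    let ?K = "\<lambda>M y. \<integral>x. exp (- (((1/s) *\<^sub>R (x - y)) \<bullet> ((1/s) *\<^sub>R (x - y))) / 2) \<partial>M"
    have "(\<lambda>n. \<integral>x. ?S x \<partial>Q n) \<longlonglongrightarrow> (\<integral>x. ?S x \<partial>L)"
      unfolding smooth[OF Q] smooth[OF L]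
    proof (rule tendsto_divide, rule integral_dominated_convergence[where w="\<lambda>y. \<bar>F y\<bar>"])
      show "integrable lborel (\<lambda>y. \<bar>F y\<bar>)" using integrable_compact_support[OF F supp] by simp
      show "AE y in lborel. (\<lambda>n. F y * ?K (Q n) y) \<longlonglongrightarrow> F y * ?K L y"
        by (intro AE_I2 tendsto_mult tendsto_const gaussian_kernel_tendsto Q L char)
      show "AE y in lborel. norm (F y * ?K (Q n) y) \<le> \<bar>F y\<bar>" for n
      proof (rule AE_I2)
        fix y
        have "?K (Q n) y \<le> (\<integral>x. 1 \<partial>Q n)"
          by (intro integral_mono Q.integrable_const_bound[where B=1]) auto
        moreover have "0 \<le> ?K (Q n) y" by (rule integral_nonneg_AE) simp
        ultimately show "norm (F y * ?K (Q n) y) \<le> \<bar>F y\<bar>"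
          by (simp add: abs_mult mult_left_le Q.prob_space)
      qed
    qed (use s in auto)
    then obtain n0 where n0: "\<And>n. n \<ge> n0 \<Longrightarrow> norm ((\<integral>x. ?S x \<partial>Q n) - (\<integral>x. ?S x \<partial>L)) < e/3"
      using LIMSEQ_D \<open>0 < e/3\<close> by blast
    show "\<exists>n0. \<forall>n\<ge>n0. norm ((\<integral>x. F x \<partial>Q n) - (\<integral>x. F x \<partial>L)) < e"
    proof (intro exI allI impI)
      fix n assume "n0 \<le> n"
      from n0[OF this] close[OF Q, of n] close[OF L]
      show "norm ((\<integral>x. F x \<partial>Q n) - (\<integral>x. F x \<partial>L)) < e" unfolding real_norm_def by linarith
    qed
  qed
  show ?thesis
    unfolding weakly_converges_def
  proof (intro allI impI)
    fix f :: "real^'n \<Rightarrow> real" assume f: "continuous_on UNIV f" and "bounded (range f)"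
    then obtain B0 where B0: "\<And>x. \<bar>f x\<bar> \<le> B0" unfolding bounded_iff by auto
    define B where "B = max B0 1"
    have B: "\<bar>f x\<bar> \<le> B" "B > 0" for x using B0[of x] by (auto simp: B_def)
    have [measurable]: "f \<in> borel_measurable borel" using f by (rule borel_measurable_continuous_onI)
    \<comment> \<open>A continuous cutoff, equal to 1 on the ball of radius \<open>k\<close> and to
      0 beyond radius \<open>k + 1\<close>.\<close>
    define c where "c = (\<lambda>k (x::real^'n). max 0 (min 1 (real k + 1 - norm x)))"
    have c: "0 \<le> c k x" "c k x \<le> 1" for k x by (auto simp: c_def)
    have ccont: "continuous_on UNIV (c k)" for k unfolding c_def by (intro continuous_intros)
    have [measurable]: "c k \<in> borel_measurable borel" for k using ccont by (rule borel_measurable_continuous_onI)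
    have csupp: "c k x = 0" if "real k + 1 < norm x" for k x using that by (simp add: c_def)
    have "(\<lambda>k. \<integral>x. c k x \<partial>L) \<longlonglongrightarrow> (\<integral>x. 1 \<partial>L)"
    proof (rule integral_dominated_convergence[where w="\<lambda>_. 1 :: real"])
      show "AE x in L. (\<lambda>k. c k x) \<longlonglongrightarrow> 1"
      proof (rule AE_I2)
        fix x
        have "\<forall>\<^sub>F k in sequentially. c k x = 1"
          using eventually_gt_at_top[of "nat \<lceil>norm x\<rceil>"] by eventually_elim (auto simp: c_def min_def max_def, linarith+)
        then show "(\<lambda>k. c k x) \<longlonglongrightarrow> 1" by (rule tendsto_eventually)
      qed
    qed (use c in auto)
    then have clim: "(\<lambda>k. \<integral>x. c k x \<partial>L) \<longlonglongrightarrow> 1" by (simp add: L.prob_space)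
    show "(\<lambda>n. \<integral>x. f x \<partial>Q n) \<longlonglongrightarrow> (\<integral>x. f x \<partial>L)"
    proof (rule LIMSEQ_I)
      fix e :: real assume "e > 0"
      \<comment> \<open>Cutting off costs at most \<open>B * d = e / 4\<close> under
        \<open>Q n\<close> and under \<open>L\<close>; the remaining \<open>e / 2\<close> is for the
        convergence of the cut-off integrals.\<close>
      define d where "d = e / (4 * B)"
      have d: "d > 0" using \<open>e > 0\<close> B by (simp add: d_def)
      obtain k where k: "(\<integral>x. c k x \<partial>L) > 1 - d"
        using order_tendstoD(1)[OF clim, of "1 - d"] d by (auto simp: eventually_sequentially)
      have fc: "(\<lambda>n. \<integral>x. f x * c k x \<partial>Q n) \<longlonglongrightarrow> (\<integral>x. f x * c k x \<partial>L)"
      proof (rule Cc[of _ "real k + 1" B])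
        show "continuous_on UNIV (\<lambda>x. f x * c k x)" by (intro continuous_intros f ccont)
        show "\<bar>f x * c k x\<bar> \<le> B" for x
          using mult_mono[of "\<bar>f x\<bar>" B "c k x" 1] B(1)[of x] c[of k x] by (simp add: abs_mult)
      qed (simp add: csupp)
      have cc: "(\<lambda>n. \<integral>x. c k x \<partial>Q n) \<longlonglongrightarrow> (\<integral>x. c k x \<partial>L)"
        by (rule Cc[of _ "real k + 1" 1]) (use c csupp ccont in auto)
      have close: "\<bar>(\<integral>x. f x \<partial>M) - (\<integral>x. f x * c k x \<partial>M)\<bar> \<le> B * (1 - (\<integral>x. c k x \<partial>M))"
        if M: "prob_space M" "sets M = sets borel" for M :: "(real^'n) measure"
      proof -
        interpret M: prob_space M by (rule M)
        note M(2)[measurable_cong]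
        have bb: "\<bar>f x * c k x\<bar> \<le> B" for x
          using mult_mono[of "\<bar>f x\<bar>" B "c k x" 1] B(1)[of x] c[of k x] by (simp add: abs_mult)
        have i1: "integrable M f"
          by (rule M.integrable_const_bound[where B=B]) (simp_all add: B)
        have i2: "integrable M (\<lambda>x. f x * c k x)"
          by (rule M.integrable_const_bound[where B=B]) (simp_all add: bb)
        have i3: "integrable M (c k)"
          by (rule M.integrable_const_bound[where B=1]) (simp_all add: c)
        note i = i1 i2 i3
        have "(\<integral>x. f x \<partial>M) - (\<integral>x. f x * c k x \<partial>M) = (\<integral>x. f x - f x * c k x \<partial>M)"
          by (rule Bochner_Integration.integral_diff[symmetric, OF i1 i2])
        then have "\<bar>(\<integral>x. f x \<partial>M) - (\<integral>x. f x * c k x \<partial>M)\<bar> \<le> (\<integral>x. \<bar>f x - f x * c k x\<bar> \<partial>M)"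
          by (simp only: integral_abs_bound)
        also have "\<dots> \<le> (\<integral>x. B * (1 - c k x) \<partial>M)"
        proof (rule integral_mono)
          fix x
          have "\<bar>f x - f x * c k x\<bar> = \<bar>f x\<bar> * (1 - c k x)"
            using c[of k x] by (metis abs_mult abs_of_nonneg diff_ge_0_iff_ge mult.right_neutral right_diff_distrib)
          also have "\<dots> \<le> B * (1 - c k x)" using c[of k x] B(1)[of x] by (intro mult_right_mono) auto
          finally show "\<bar>f x - f x * c k x\<bar> \<le> B * (1 - c k x)" .
        qed (use i in auto)
        also have "\<dots> = B * (1 - (\<integral>x. c k x \<partial>M))" using i by (simp add: M.prob_space)
        finally show ?thesis .
      qed
      have "\<forall>\<^sub>F n in sequentially. (\<integral>x. c k x \<partial>Q n) > 1 - d"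
        using order_tendstoD(1)[OF cc k] .
      moreover have "\<forall>\<^sub>F n in sequentially. \<bar>(\<integral>x. f x * c k x \<partial>Q n) - (\<integral>x. f x * c k x \<partial>L)\<bar> < e / 2"
        using tendstoD[OF fc, of "e/2"] \<open>e > 0\<close> by (simp add: dist_real_def)
      ultimately have "\<forall>\<^sub>F n in sequentially. norm ((\<integral>x. f x \<partial>Q n) - (\<integral>x. f x \<partial>L)) < e"
      proof eventually_elim
        case (elim n)
        have "B * (1 - (\<integral>x. c k x \<partial>Q n)) < B * d" "B * (1 - (\<integral>x. c k x \<partial>L)) < B * d"
          using elim(1) k B(2) by (intro mult_strict_left_mono; simp)+
        moreover have "B * d = e / 4" using B(2) by (simp add: d_def)
        ultimately show ?case
          using close[OF Q, of n] close[OF L] elim(2) unfolding real_norm_def by linarith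
      qed
      then show "\<exists>n0. \<forall>n\<ge>n0. norm ((\<integral>x. f x \<partial>Q n) - (\<integral>x. f x \<partial>L)) < e"
        by (simp add: eventually_sequentially)
    qed
  qed
qed

section \<open>Mean square convergence\<close>

lemma L2D: assumes "f \<in> L2 M" shows "f \<in> borel_measurable M" "integrable M (\<lambda>x. (f x)\<^sup>2)"
  using assms by (auto simp: L2_def)

lemma L2_integrable_mult:
  assumes "f \<in> L2 M" "g \<in> L2 M"
  shows "integrable M (\<lambda>x. f x * g x)"
proof (rule Bochner_Integration.integrable_bound)
  show "integrable M (\<lambda>x. (f x)\<^sup>2 + (g x)\<^sup>2)" using assms by (auto dest: L2D)
  show "(\<lambda>x. f x * g x) \<in> borel_measurable M"
    using L2D(1)[OF assms(1)] L2D(1)[OF assms(2)] by measurable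
  have "\<bar>a * b\<bar> \<le> a\<^sup>2 + b\<^sup>2" for a b :: real
    using sum_squares_bound[of a b] sum_squares_bound[of a "- b"] zero_le_power2[of a] zero_le_power2[of b]
    by (simp add: abs_le_iff)
  then show "AE x in M. norm (f x * g x) \<le> norm ((f x)\<^sup>2 + (g x)\<^sup>2)" by (intro AE_I2) simp
qed

lemma L2_add: assumes "f \<in> L2 M" "g \<in> L2 M" shows "(\<lambda>x. f x + g x) \<in> L2 M"
  using L2D[OF assms(1)] L2D[OF assms(2)] L2_integrable_mult[OF assms]
  by (simp add: L2_def power2_sum mult.assoc)

lemma L2_cmult: assumes "f \<in> L2 M" shows "(\<lambda>x. c * f x) \<in> L2 M"
  using L2D[OF assms] by (simp add: L2_def power_mult_distrib)

lemma L2_diff: assumes "f \<in> L2 M" "g \<in> L2 M" shows "(\<lambda>x. f x - g x) \<in> L2 M"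
  using L2_add[OF assms(1) L2_cmult[OF assms(2), of "-1"]] by simp

lemma L2_zero: "(\<lambda>x. 0) \<in> L2 M"
  by (simp add: L2_def)

lemma L2_sum: assumes "\<And>i. i \<in> I \<Longrightarrow> f i \<in> L2 M" shows "(\<lambda>x. \<Sum>i\<in>I. f i x) \<in> L2 M"
  using assms by (induction I rule: infinite_finite_induct) (auto intro: L2_add L2_zero)

text \<open>The integral of the square of \<open>t * f + g\<close> is a nonnegative quadratic
  polynomial in \<open>t\<close>; evaluating it at its minimum gives the discriminant
  inequality.\<close>

lemma L2_Cauchy_Schwarz:
  assumes "f \<in> L2 M" "g \<in> L2 M"
  shows "(\<integral>x. f x * g x \<partial>M)\<^sup>2 \<le> (\<integral>x. (f x)\<^sup>2 \<partial>M) * (\<integral>x. (g x)\<^sup>2 \<partial>M)"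
proof -
  let ?a = "\<integral>x. (f x)\<^sup>2 \<partial>M" and ?b = "\<integral>x. f x * g x \<partial>M" and ?c = "\<integral>x. (g x)\<^sup>2 \<partial>M"
  have q: "0 \<le> ?a * t\<^sup>2 + 2 * ?b * t + ?c" for t
  proof -
    have "0 \<le> (\<integral>x. (t * f x + g x)\<^sup>2 \<partial>M)" by simp
    also have "(\<integral>x. (t * f x + g x)\<^sup>2 \<partial>M) = (\<integral>x. t\<^sup>2 * (f x)\<^sup>2 + (2 * t) * (f x * g x) + (g x)\<^sup>2 \<partial>M)"
      by (simp add: power2_eq_square algebra_simps)
    also have "\<dots> = ?a * t\<^sup>2 + 2 * ?b * t + ?c"
      using L2D[OF assms(1)] L2D[OF assms(2)] L2_integrable_mult[OF assms] by simp
    finally show ?thesis .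
  qed
  show ?thesis
  proof (cases "?a = 0")
    case True
    have "?b = 0"
    proof (rule ccontr)
      \<comment> \<open>Without the quadratic term the polynomial is affine in \<open>t\<close>; the
        chosen \<open>t\<close> makes its value -1.\<close>
      assume b: "?b \<noteq> 0"
      have "2 * ?b * (- (?c + 1) / (2 * ?b)) = - (?c + 1)" using b by (simp add: field_simps)
      with q[of "- (?c + 1) / (2 * ?b)"] show False unfolding True by simp
    qed
    then show ?thesis by simp
  next
    case False
    then have a: "?a > 0" by (smt (verit) integral_nonneg_AE AE_I2 zero_le_power2)
    have "?a * (?a * (- ?b / ?a)\<^sup>2 + 2 * ?b * (- ?b / ?a) + ?c) \<ge> 0"
      using a by (intro mult_nonneg_nonneg q) simp
    also have "?a * (?a * (- ?b / ?a)\<^sup>2 + 2 * ?b * (- ?b / ?a) + ?c) = ?a * ?c - ?b\<^sup>2"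
      using a by (simp add: field_simps power2_eq_square)
    finally show ?thesis by simp
  qed
qed

text \<open>Membership in \<open>L2\<close> belongs to the notion: the Bochner integral of a
  non-integrable function is 0, so the limit alone would say nothing for such functions.\<close>

definition L2_lim :: "'a measure \<Rightarrow> (nat \<Rightarrow> 'a \<Rightarrow> real) \<Rightarrow> ('a \<Rightarrow> real) \<Rightarrow> bool" where
  "L2_lim M f g \<longleftrightarrow> (\<forall>n. f n \<in> L2 M) \<and> g \<in> L2 M \<and> (\<lambda>n. \<integral>x. (f n x - g x)\<^sup>2 \<partial>M) \<longlonglongrightarrow> 0"

lemma L2_limD:
  assumes "L2_lim M f g"
  shows "\<And>n. f n \<in> L2 M" "g \<in> L2 M" "(\<lambda>n. \<integral>x. (f n x - g x)\<^sup>2 \<partial>M) \<longlonglongrightarrow> 0"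
  using assms by (auto simp: L2_lim_def)

lemma L2_lim_const: "g \<in> L2 M \<Longrightarrow> L2_lim M (\<lambda>n. g) g"
  by (simp add: L2_lim_def)

lemma L2_limI_bound:
  assumes "\<And>n. f n \<in> L2 M" "g \<in> L2 M" "B \<longlonglongrightarrow> 0"
    and "\<And>n. (\<integral>x. (f n x - g x)\<^sup>2 \<partial>M) \<le> B n"
  shows "L2_lim M f g"
  unfolding L2_lim_def
proof (intro conjI allI assms(1,2))
  show "(\<lambda>n. \<integral>x. (f n x - g x)\<^sup>2 \<partial>M) \<longlonglongrightarrow> 0"
    by (rule tendsto_sandwich[OF _ _ tendsto_const assms(3)]) (use assms(4) in auto)
qed

lemma integral_square_add_le:
  assumes "f \<in> L2 M" "g \<in> L2 M"
  shows "(\<integral>x. (f x + g x)\<^sup>2 \<partial>M) \<le> 2 * (\<integral>x. (f x)\<^sup>2 \<partial>M) + 2 * (\<integral>x. (g x)\<^sup>2 \<partial>M)"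
proof -
  have "(\<integral>x. (f x + g x)\<^sup>2 \<partial>M) \<le> (\<integral>x. 2 * (f x)\<^sup>2 + 2 * (g x)\<^sup>2 \<partial>M)"
  proof (rule integral_mono)
    show "(f x + g x)\<^sup>2 \<le> 2 * (f x)\<^sup>2 + 2 * (g x)\<^sup>2" for x
      using sum_squares_bound[of "f x" "g x"] by (simp add: power2_sum)
  qed (use L2D[OF assms(1)] L2D[OF assms(2)] L2D[OF L2_add[OF assms]] in auto)
  also have "\<dots> = 2 * (\<integral>x. (f x)\<^sup>2 \<partial>M) + 2 * (\<integral>x. (g x)\<^sup>2 \<partial>M)"
    using L2D[OF assms(1)] L2D[OF assms(2)] by simp
  finally show ?thesis .
qed

lemma L2_lim_add:
  assumes "L2_lim M f g" "L2_lim M f' g'"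
  shows "L2_lim M (\<lambda>n x. f n x + f' n x) (\<lambda>x. g x + g' x)"
proof (rule L2_limI_bound)
  note 1 = L2_limD[OF assms(1)] and 2 = L2_limD[OF assms(2)]
  show "(\<lambda>n. 2 * (\<integral>x. (f n x - g x)\<^sup>2 \<partial>M) + 2 * (\<integral>x. (f' n x - g' x)\<^sup>2 \<partial>M)) \<longlonglongrightarrow> 0"
    using 1 2 by (auto intro!: tendsto_eq_intros)
  show "(\<integral>x. (f n x + f' n x - (g x + g' x))\<^sup>2 \<partial>M) \<le> 2 * (\<integral>x. (f n x - g x)\<^sup>2 \<partial>M) + 2 * (\<integral>x. (f' n x - g' x)\<^sup>2 \<partial>M)" for n
    using integral_square_add_le[OF L2_diff[OF 1(1)[of n] 1(2)] L2_diff[OF 2(1)[of n] 2(2)]]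
    by (simp add: algebra_simps)
qed (use assms in \<open>auto intro!: L2_add dest: L2_limD\<close>)

lemma L2_lim_cmult:
  assumes "L2_lim M f g" "c \<longlonglongrightarrow> d"
  shows "L2_lim M (\<lambda>n x. c n * f n x) (\<lambda>x. d * g x)"
proof (rule L2_limI_bound)
  note 1 = L2_limD[OF assms(1)]
  show "(\<lambda>n. 2 * ((c n)\<^sup>2 * (\<integral>x. (f n x - g x)\<^sup>2 \<partial>M)) + 2 * ((c n - d)\<^sup>2 * (\<integral>x. (g x)\<^sup>2 \<partial>M))) \<longlonglongrightarrow> 0"
    using 1 assms(2) by (auto intro!: tendsto_eq_intros)
  show "(\<integral>x. (c n * f n x - d * g x)\<^sup>2 \<partial>M) \<le> 2 * ((c n)\<^sup>2 * (\<integral>x. (f n x - g x)\<^sup>2 \<partial>M)) + 2 * ((c n - d)\<^sup>2 * (\<integral>x. (g x)\<^sup>2 \<partial>M))" for n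
  proof -
    have "c n * (f n x - g x) + (c n - d) * g x = c n * f n x - d * g x" for x by (simp add: algebra_simps)
    then show ?thesis
      using integral_square_add_le[OF L2_cmult[OF L2_diff[OF 1(1)[of n] 1(2)], of "c n"] L2_cmult[OF 1(2), of "c n - d"]]
      by (simp add: power_mult_distrib)
  qed
qed (use assms in \<open>auto intro!: L2_cmult dest: L2_limD\<close>)

lemma L2_lim_diff:
  assumes "L2_lim M f g" "L2_lim M f' g'"
  shows "L2_lim M (\<lambda>n x. f n x - f' n x) (\<lambda>x. g x - g' x)"
  using L2_lim_add[OF assms(1) L2_lim_cmult[OF assms(2) tendsto_const[of "-1"]]] by simp

lemma L2_lim_sum:
  assumes "\<And>i. i \<in> I \<Longrightarrow> L2_lim M (f i) (g i)"
  shows "L2_lim M (\<lambda>n x. \<Sum>i\<in>I. f i n x) (\<lambda>x. \<Sum>i\<in>I. g i x)"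
  using assms
  by (induction I rule: infinite_finite_induct) (auto intro: L2_lim_add L2_lim_const L2_zero)

lemma L2_lim_integral_mult:
  assumes "L2_lim M f g" "L2_lim M f' g'"
  shows "(\<lambda>n. \<integral>x. f n x * f' n x \<partial>M) \<longlonglongrightarrow> (\<integral>x. g x * g' x \<partial>M)"
proof -
  note 1 = L2_limD[OF assms(1)] and 2 = L2_limD[OF assms(2)]
  \<comment> \<open>Stated with limits \<open>A\<close> and \<open>B\<close> of the squared norms,
    so that the same bound serves error times error and error times a fixed factor.\<close>
  have CS: "(\<lambda>n. \<integral>x. a n x * b n x \<partial>M) \<longlonglongrightarrow> 0"
    if a: "\<And>n. a n \<in> L2 M" "(\<lambda>n. \<integral>x. (a n x)\<^sup>2 \<partial>M) \<longlonglongrightarrow> A" and b: "\<And>n. b n \<in> L2 M" "(\<lambda>n. \<integral>x. (b n x)\<^sup>2 \<partial>M) \<longlonglongrightarrow> B"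
      and "A * B = 0" for a b :: "nat \<Rightarrow> 'a \<Rightarrow> real" and A B
  proof -
    have "(\<lambda>n. (\<integral>x. a n x * b n x \<partial>M)\<^sup>2) \<longlonglongrightarrow> 0"
    proof (rule tendsto_sandwich[OF _ _ tendsto_const])
      show "\<forall>\<^sub>F n in sequentially. (\<integral>x. a n x * b n x \<partial>M)\<^sup>2 \<le> (\<integral>x. (a n x)\<^sup>2 \<partial>M) * (\<integral>x. (b n x)\<^sup>2 \<partial>M)"
        using L2_Cauchy_Schwarz a b by (intro always_eventually) blast
      show "(\<lambda>n. (\<integral>x. (a n x)\<^sup>2 \<partial>M) * (\<integral>x. (b n x)\<^sup>2 \<partial>M)) \<longlonglongrightarrow> 0"
        using tendsto_mult[OF a(2) b(2)] that by simp
    qed simp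
    then have "(\<lambda>n. sqrt ((\<integral>x. a n x * b n x \<partial>M)\<^sup>2)) \<longlonglongrightarrow> sqrt 0" by (rule tendsto_real_sqrt)
    then show ?thesis by (simp add: tendsto_rabs_zero_iff)
  qed
  have "(\<lambda>n. (\<integral>x. (f n x - g x) * (f' n x - g' x) \<partial>M) + (\<integral>x. (f n x - g x) * g' x \<partial>M) + (\<integral>x. g x * (f' n x - g' x) \<partial>M) + (\<integral>x. g x * g' x \<partial>M)) \<longlonglongrightarrow> 0 + 0 + 0 + (\<integral>x. g x * g' x \<partial>M)"
    by (intro tendsto_add tendsto_const CS[of "\<lambda>n x. f n x - g x" 0 "\<lambda>n x. f' n x - g' x" 0] CS[of "\<lambda>n x. f n x - g x" 0 "\<lambda>n. g'" "\<integral>x. (g' x)\<^sup>2 \<partial>M"]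
        CS[of "\<lambda>n. g" "\<integral>x. (g x)\<^sup>2 \<partial>M" "\<lambda>n x. f' n x - g' x" 0])
      (use 1 2 in \<open>auto intro: L2_diff\<close>)
  moreover have "(\<integral>x. (f n x - g x) * (f' n x - g' x) \<partial>M) + (\<integral>x. (f n x - g x) * g' x \<partial>M) + (\<integral>x. g x * (f' n x - g' x) \<partial>M) + (\<integral>x. g x * g' x \<partial>M) = (\<integral>x. f n x * f' n x \<partial>M)" for n
  proof -
    have "integrable M (\<lambda>x. (f n x - g x) * (f' n x - g' x))" "integrable M (\<lambda>x. (f n x - g x) * g' x)"
      "integrable M (\<lambda>x. g x * (f' n x - g' x))" "integrable M (\<lambda>x. g x * g' x)"
      using 1 2 by (auto intro!: L2_integrable_mult L2_diff)
    then show ?thesis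
      by (simp flip: Bochner_Integration.integral_add) (simp add: algebra_simps)
  qed
  ultimately show ?thesis by simp
qed

lemma L2_lim_integral_square:
  assumes "L2_lim M f g"
  shows "(\<lambda>n. \<integral>x. (f n x)\<^sup>2 \<partial>M) \<longlonglongrightarrow> (\<integral>x. (g x)\<^sup>2 \<partial>M)"
  using L2_lim_integral_mult[OF assms assms] by (simp add: power2_eq_square)

lemma integrable_weighted_square:
  assumes "f \<in> L2 M" "h \<in> borel_measurable M" "\<And>x. 0 \<le> h x" "\<And>x. h x \<le> (1::real)"
  shows "integrable M (\<lambda>x. h x * (f x)\<^sup>2)"
proof (rule Bochner_Integration.integrable_bound)
  show "integrable M (\<lambda>x. (f x)\<^sup>2)" using assms by (auto dest: L2D)
  show "AE x in M. norm (h x * (f x)\<^sup>2) \<le> norm ((f x)\<^sup>2)"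
    using assms by (intro AE_I2) (simp add: abs_mult mult_left_le_one_le)
qed (use assms L2D[OF assms(1)] in measurable)

text \<open>For weights in the unit interval, replacing \<open>f n\<close> by its limit changes the
  weighted square integral by no more than the vanishing distance. Smallness on moving sets can thus
  be carried from a sequence to its fixed limit and back to another sequence.\<close>

lemma L2_lim_weighted_iff:
  assumes fg: "L2_lim M f g" and h: "\<And>n. h n \<in> borel_measurable M" "\<And>n x. 0 \<le> h n x" "\<And>n x. h n x \<le> (1::real)"
  shows "((\<lambda>n. \<integral>x. h n x * (f n x)\<^sup>2 \<partial>M) \<longlonglongrightarrow> 0) \<longleftrightarrow> ((\<lambda>n. \<integral>x. h n x * (g x)\<^sup>2 \<partial>M) \<longlonglongrightarrow> 0)"
proof -
  note 1 = L2_limD[OF fg]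
  have gen: "(\<lambda>n. \<integral>x. h n x * (b n x)\<^sup>2 \<partial>M) \<longlonglongrightarrow> 0"
    if a: "(\<lambda>n. \<integral>x. h n x * (a n x)\<^sup>2 \<partial>M) \<longlonglongrightarrow> 0" and ab: "\<And>n. a n \<in> L2 M" "\<And>n. b n \<in> L2 M" "(\<lambda>n. \<integral>x. (b n x - a n x)\<^sup>2 \<partial>M) \<longlonglongrightarrow> 0"
    for a b :: "nat \<Rightarrow> 'a \<Rightarrow> real"
  proof (rule tendsto_sandwich[OF _ _ tendsto_const])
    show "(\<lambda>n. 2 * (\<integral>x. h n x * (a n x)\<^sup>2 \<partial>M) + 2 * (\<integral>x. (b n x - a n x)\<^sup>2 \<partial>M)) \<longlonglongrightarrow> 0"
      using a ab by (auto intro!: tendsto_eq_intros)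
    have "(\<integral>x. h n x * (b n x)\<^sup>2 \<partial>M) \<le> (\<integral>x. 2 * (h n x * (a n x)\<^sup>2) + 2 * (b n x - a n x)\<^sup>2 \<partial>M)" for n
    proof (rule integral_mono)
      show "h n x * (b n x)\<^sup>2 \<le> 2 * (h n x * (a n x)\<^sup>2) + 2 * (b n x - a n x)\<^sup>2" for x
      proof -
        have "(b n x)\<^sup>2 \<le> 2 * (a n x)\<^sup>2 + 2 * (b n x - a n x)\<^sup>2"
          using sum_squares_bound[of "a n x" "b n x - a n x"] power2_sum[of "a n x" "b n x - a n x"] by simp
        then have "h n x * (b n x)\<^sup>2 \<le> h n x * (2 * (a n x)\<^sup>2 + 2 * (b n x - a n x)\<^sup>2)"
          using h by (intro mult_left_mono) auto
        also have "\<dots> = 2 * (h n x * (a n x)\<^sup>2) + h n x * (2 * (b n x - a n x)\<^sup>2)" by (simp add: algebra_simps)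
        also have "h n x * (2 * (b n x - a n x)\<^sup>2) \<le> 1 * (2 * (b n x - a n x)\<^sup>2)"
          using h by (intro mult_right_mono) auto
        finally show ?thesis by simp
      qed
    qed (use integrable_weighted_square[OF ab(1)] integrable_weighted_square[OF ab(2)] h L2D[OF L2_diff[OF ab(2) ab(1)]] in auto)
    also have "\<dots> n = 2 * (\<integral>x. h n x * (a n x)\<^sup>2 \<partial>M) + 2 * (\<integral>x. (b n x - a n x)\<^sup>2 \<partial>M)" for n
      using integrable_weighted_square[OF ab(1)] h L2D[OF L2_diff[OF ab(2) ab(1)]] by simp
    finally show "\<forall>\<^sub>F n in sequentially. (\<integral>x. h n x * (b n x)\<^sup>2 \<partial>M) \<le> 2 * (\<integral>x. h n x * (a n x)\<^sup>2 \<partial>M) + 2 * (\<integral>x. (b n x - a n x)\<^sup>2 \<partial>M)"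
      by simp
    show "\<forall>\<^sub>F n in sequentially. 0 \<le> (\<integral>x. h n x * (b n x)\<^sup>2 \<partial>M)"
      using h by (intro always_eventually allI integral_nonneg_AE AE_I2) auto
  qed
  show ?thesis
    using gen[of f "\<lambda>_. g"] gen[of "\<lambda>_. g" f] 1 by (auto simp: power2_commute)
qed

text \<open>An absolute continuity argument. Where \<open>w\<close> squared is at most
  \<open>k\<close> the integral is at most \<open>k\<close> times one that vanishes; the rest is
  bounded by the tail of the integrable function \<open>(w x * u x)\<^sup>2\<close>, small for large
  \<open>k\<close> whatever the weights are.\<close>

lemma weighted_integral_tendsto_0:
  assumes u: "u \<in> L2 M" and wu: "(\<lambda>x. w x * u x) \<in> L2 M" and w[measurable]: "w \<in> borel_measurable M"
    and h: "\<And>n. h n \<in> borel_measurable M" "\<And>n x. 0 \<le> h n x" "\<And>n x. h n x \<le> (1::real)"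
    and lim: "(\<lambda>n. \<integral>x. h n x * (u x)\<^sup>2 \<partial>M) \<longlonglongrightarrow> 0"
  shows "(\<lambda>n. \<integral>x. h n x * (w x * u x)\<^sup>2 \<partial>M) \<longlonglongrightarrow> 0"
proof (rule LIMSEQ_I)
  fix e :: real assume e: "e > 0"
  note [measurable] = h(1) L2D(1)[OF u]
  let ?T = "\<lambda>k x. if (w x)\<^sup>2 > real k then (w x * u x)\<^sup>2 else 0"
  have Ti: "integrable M (?T k)" for k
    by (rule Bochner_Integration.integrable_bound[OF L2D(2)[OF wu]]) auto
  have "(\<lambda>k. \<integral>x. ?T k x \<partial>M) \<longlonglongrightarrow> (\<integral>x. 0 \<partial>M)"
  proof (rule integral_dominated_convergence[where w="\<lambda>x. (w x * u x)\<^sup>2"])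
    show "AE x in M. (\<lambda>k. ?T k x) \<longlonglongrightarrow> 0"
    proof (rule AE_I2)
      fix x
      have "\<forall>\<^sub>F k in sequentially. ?T k x = 0"
        using eventually_gt_at_top[of "nat \<lceil>(w x)\<^sup>2\<rceil>"] by eventually_elim (auto, linarith)
      then show "(\<lambda>k. ?T k x) \<longlonglongrightarrow> 0" by (rule tendsto_eventually)
    qed
  qed (use L2D[OF wu] in auto)
  then have "(\<lambda>k. \<integral>x. ?T k x \<partial>M) \<longlonglongrightarrow> 0" by simp
  from order_tendstoD(2)[OF this, of "e/2"] e obtain k where k: "(\<integral>x. ?T k x \<partial>M) < e/2"
    by (auto simp: eventually_sequentially)
  have "(\<lambda>n. real k * (\<integral>x. h n x * (u x)\<^sup>2 \<partial>M)) \<longlonglongrightarrow> 0"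
    using tendsto_mult[OF tendsto_const[of "real k"] lim] by simp
  from order_tendstoD(2)[OF this, of "e/2"] e
  have "\<forall>\<^sub>F n in sequentially. real k * (\<integral>x. h n x * (u x)\<^sup>2 \<partial>M) < e/2" by simp
  then have "\<forall>\<^sub>F n in sequentially. norm ((\<integral>x. h n x * (w x * u x)\<^sup>2 \<partial>M) - 0) < e"
  proof eventually_elim
    case (elim n)
    have "(\<integral>x. h n x * (w x * u x)\<^sup>2 \<partial>M) \<le> (\<integral>x. real k * (h n x * (u x)\<^sup>2) + ?T k x \<partial>M)"
    proof (rule integral_mono)
      show "h n x * (w x * u x)\<^sup>2 \<le> real k * (h n x * (u x)\<^sup>2) + ?T k x" for x
      proof (cases "(w x)\<^sup>2 > real k")
        case True
        have "h n x * (w x * u x)\<^sup>2 \<le> 1 * (w x * u x)\<^sup>2" using h by (intro mult_right_mono) auto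
        moreover have "0 \<le> real k * (h n x * (u x)\<^sup>2)" using h by simp
        ultimately show ?thesis using True by simp
      next
        case False
        then have "(w x)\<^sup>2 * (h n x * (u x)\<^sup>2) \<le> real k * (h n x * (u x)\<^sup>2)"
          using h by (intro mult_right_mono) auto
        then show ?thesis using False by (simp add: power_mult_distrib mult_ac)
      qed
    qed (use integrable_weighted_square[OF wu h] integrable_weighted_square[OF u h] Ti in auto)
    also have "\<dots> = real k * (\<integral>x. h n x * (u x)\<^sup>2 \<partial>M) + (\<integral>x. ?T k x \<partial>M)"
      using integrable_weighted_square[OF u h] Ti by simp
    finally have "(\<integral>x. h n x * (w x * u x)\<^sup>2 \<partial>M) < e" using elim k by linarith
    moreover have "0 \<le> (\<integral>x. h n x * (w x * u x)\<^sup>2 \<partial>M)"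
      using h by (intro integral_nonneg_AE AE_I2) auto
    ultimately show ?case by simp
  qed
  then show "\<exists>N. \<forall>n\<ge>N. norm ((\<integral>x. h n x * (w x * u x)\<^sup>2 \<partial>M) - 0) < e"
    by (simp add: eventually_sequentially)
qed

section \<open>Characteristic functions of triangular arrays\<close>

text \<open>Each Taylor remainder is bounded both by the order of its last retained power and by the
  next order. Taking the better of the two leaves the usual power times
  \<open>min 1 \<bar>x\<bar>\<close>: square integrability suffices for the power, and the factor
  makes the term vanish.\<close>

lemma iexp_remainders:
  fixes x :: real
  defines "h \<equiv> min 1 \<bar>x\<bar>"
  shows "cmod (iexp x - 1) \<le> 2 * h"
    and "cmod (iexp x - 1 - \<i> * x) \<le> 2 * h * \<bar>x\<bar>"
    and "cmod (iexp x - 1 - \<i> * x + x\<^sup>2 / 2) \<le> h * x\<^sup>2"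
proof -
  have sums: "(\<Sum>k\<le>(0::nat). (\<i> * x)^k / fact k) = 1" "(\<Sum>k\<le>(1::nat). (\<i> * x)^k / fact k) = 1 + \<i> * x"
    "(\<Sum>k\<le>(2::nat). (\<i> * x)^k / fact k) = 1 + \<i> * x - x\<^sup>2 / 2"
    using power_mult_distrib[of \<i> "complex_of_real x" 2] by (simp_all add: numeral_2_eq_2)
  note a = iexp_approx1[of x 0] iexp_approx1[of x 1] iexp_approx1[of x 2]
  note b = iexp_approx2[of x 0] iexp_approx2[of x 1] iexp_approx2[of x 2]
  show "cmod (iexp x - 1) \<le> 2 * h"
    using a(1) b(1) unfolding sums h_def by (auto simp: min_def)
  have "cmod (iexp x - 1 - \<i> * x) \<le> 2 * \<bar>x\<bar>" "cmod (iexp x - 1 - \<i> * x) * 2 \<le> \<bar>x\<bar> * \<bar>x\<bar>"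
    using a(2) b(2) unfolding sums by (auto simp: diff_diff_eq power2_eq_square numeral_2_eq_2)
  moreover from this(2) have "cmod (iexp x - 1 - \<i> * x) \<le> \<bar>x\<bar> * \<bar>x\<bar>"
    using norm_ge_zero[of "iexp x - 1 - \<i> * x"] by linarith
  moreover have "x * x \<le> 2 * \<bar>x\<bar> * \<bar>x\<bar>" by (simp add: mult.assoc)
  ultimately show "cmod (iexp x - 1 - \<i> * x) \<le> 2 * h * \<bar>x\<bar>"
    unfolding h_def by (auto simp: min_def)
  let ?r = "cmod (iexp x - 1 - \<i> * x + x\<^sup>2 / 2)"
  have "?r \<le> x\<^sup>2" "?r \<le> \<bar>x\<bar> ^ 3 / 6"
    using a(3) b(3) unfolding sums by (simp_all add: fact_numeral algebra_simps)
  moreover have "\<bar>x\<bar> ^ 3 = \<bar>x\<bar> * x\<^sup>2" "0 \<le> \<bar>x\<bar> * x\<^sup>2" by (simp_all add: power3_eq_cube power2_eq_square)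
  ultimately have "?r \<le> x\<^sup>2" "?r \<le> \<bar>x\<bar> * x\<^sup>2" by linarith+
  then show "?r \<le> h * x\<^sup>2"
    unfolding h_def by (auto simp: min_def)
qed

text \<open>In the unit disc the n-th powers of two numbers differ by at most \<open>n\<close> times
  their distance. Comparing with \<open>exp (L / n)\<close> is possible because
  \<open>Re L \<le> 0\<close> keeps it in the disc.\<close>

lemma complex_power_tendsto_exp:
  fixes z :: "nat \<Rightarrow> complex"
  assumes z: "\<And>n. cmod (z n) \<le> 1" and lim: "(\<lambda>n. n * (z n - 1)) \<longlonglongrightarrow> L" and L: "Re L \<le> 0"
  shows "(\<lambda>n. z n ^ n) \<longlonglongrightarrow> exp L"
proof -
  have el: "(\<lambda>n. of_nat n * (exp (L / of_nat n) - 1)) \<longlonglongrightarrow> L"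
  proof (cases "L = 0")
    case False
    have "((\<lambda>h. (exp h - 1) / h) \<longlongrightarrow> (1::complex)) (at 0)"
      using DERIV_exp[of "0::complex"] by (simp add: DERIV_def)
    moreover have "filterlim (\<lambda>n. L / of_nat n) (at 0) sequentially"
      unfolding filterlim_at using False
      by (auto intro: tendsto_divide_0 tendsto_of_nat eventually_mono[OF eventually_gt_at_top[of 0]])
    ultimately have "(\<lambda>n. (exp (L / of_nat n) - 1) / (L / of_nat n)) \<longlonglongrightarrow> 1"
      by (rule filterlim_compose)
    from tendsto_mult[OF tendsto_const[of L] this] show ?thesis
      using False by (simp add: mult.commute)
  qed simp
  have "(\<lambda>n. of_nat n * (z n - 1) - of_nat n * (exp (L / of_nat n) - 1)) \<longlonglongrightarrow> L - L"
    by (intro tendsto_diff el lim)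
  then have d0: "(\<lambda>n. cmod (of_nat n * (z n - 1) - of_nat n * (exp (L / of_nat n) - 1))) \<longlonglongrightarrow> 0"
    by (simp add: tendsto_norm_zero)
  have "(\<lambda>n. z n ^ n - exp (L / of_nat n) ^ n) \<longlonglongrightarrow> 0"
  proof (rule Lim_null_comparison[OF always_eventually d0], rule allI)
    fix n
    have "cmod (exp (L / of_nat n)) \<le> 1" using L by (simp add: divide_nonpos_nonneg)
    then have "cmod (z n ^ n - exp (L / of_nat n) ^ n) \<le> n * cmod (z n - exp (L / of_nat n))"
      by (intro norm_power_diff z)
    also have "\<dots> = cmod (of_nat n * (z n - 1) - of_nat n * (exp (L / of_nat n) - 1))"
      by (simp add: norm_mult flip: right_diff_distrib)
    finally show "cmod (z n ^ n - exp (L / of_nat n) ^ n) \<le> \<dots>" .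
  qed
  moreover have "\<forall>\<^sub>F n in sequentially. z n ^ n - exp (L / of_nat n) ^ n = z n ^ n - exp L"
    using eventually_gt_at_top[of 0] by eventually_elim (simp flip: exp_of_nat_mult)
  ultimately have "(\<lambda>n. z n ^ n - exp L) \<longlonglongrightarrow> 0" by (simp add: tendsto_cong)
  then show ?thesis by (simp add: LIM_zero_iff)
qed

text \<open>Write \<open>s = v + d / sqrt n\<close> and expand the square. The part with
  \<open>v\<close> squared carries a factor \<open>n\<close> and takes the exponential to second
  order, the mixed part carries \<open>sqrt n\<close> and takes it to first order, and the part with
  \<open>d\<close> squared takes it to order zero. All three remainders then have size
  \<open>h\<close> times a square.\<close>

lemma char_increment_pointwise:
  fixes a v s :: real and n :: nat
  assumes n: "n > 0"
  defines "d \<equiv> sqrt n * (s - v)" and "h \<equiv> min 1 (\<bar>a\<bar> / sqrt n)"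
  shows "cmod (n * ((iexp (a / sqrt n) - 1) * s\<^sup>2) - (\<i> * (sqrt n * (a * v\<^sup>2)) - (a * v)\<^sup>2 / 2 + \<i> * (2 * (a * v * d))))
     \<le> 3 * (h * (a * v)\<^sup>2) + 4 * (h * d\<^sup>2)"
proof -
  define x where "x = a / sqrt n"
  define e where "e = iexp x - 1"
  have sn: "sqrt n > 0" using n by simp
  have a: "a = sqrt n * x" and s: "s = v + d / sqrt n" using sn by (simp_all add: x_def d_def)
  have nn: "complex_of_real (real n) = complex_of_real (sqrt n) * complex_of_real (sqrt n)"
    using n by (simp flip: of_real_mult)
  have h: "h = min 1 \<bar>x\<bar>" "0 \<le> h" using n by (auto simp: h_def x_def)
  note R = iexp_remainders[of x, folded h(1)]
  \<comment> \<open>An identity in \<open>r = sqrt n\<close> and in an arbitrary value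
    \<open>e\<close> of the exponential increment, so that estimation starts only after the
    algebra.\<close>
  have alg: "r * r * (e * (V + D / r)\<^sup>2) - (\<i> * (r * (r * X * V\<^sup>2)) - (r * X * V)\<^sup>2 / 2 + \<i> * (2 * (r * X * V * D)))
     = (e - \<i> * X + X\<^sup>2 / 2) * (r * r * V\<^sup>2) + (e - \<i> * X) * (2 * r * V * D) + e * D\<^sup>2"
    if "r \<noteq> 0" for r X V D :: complex
    using that by (simp add: field_simps power2_eq_square)
  have eq: "n * (e * s\<^sup>2) - (\<i> * (sqrt n * (a * v\<^sup>2)) - (a * v)\<^sup>2 / 2 + \<i> * (2 * (a * v * d)))
     = (e - \<i> * x + x\<^sup>2 / 2) * (n * v\<^sup>2) + (e - \<i> * x) * (2 * sqrt n * v * d) + e * d\<^sup>2"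
    using alg[of "complex_of_real (sqrt n)" v d x] sn nn by (simp add: s a)
  have "cmod ((e - \<i> * x + x\<^sup>2 / 2) * (n * v\<^sup>2)) \<le> (h * x\<^sup>2) * (n * v\<^sup>2)"
    using mult_right_mono[OF R(3), of "n * v\<^sup>2"] by (simp add: norm_mult norm_power e_def)
  also have "\<dots> = h * (a * v)\<^sup>2" using n by (simp add: a power_mult_distrib mult_ac)
  finally have 1: "cmod ((e - \<i> * x + x\<^sup>2 / 2) * (n * v\<^sup>2)) \<le> h * (a * v)\<^sup>2" .
  have "cmod ((e - \<i> * x) * (2 * sqrt n * v * d)) \<le> (2 * h * \<bar>x\<bar>) * \<bar>2 * sqrt n * v * d\<bar>"
    using mult_right_mono[OF R(2), of "\<bar>2 * sqrt n * v * d\<bar>"] by (simp add: norm_mult abs_mult e_def)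
  also have "\<dots> = 2 * h * (2 * \<bar>a * v\<bar> * \<bar>d\<bar>)" by (simp add: a abs_mult mult_ac)
  also have "\<dots> \<le> 2 * h * ((a * v)\<^sup>2 + d\<^sup>2)"
    using sum_squares_bound[of "\<bar>a * v\<bar>" "\<bar>d\<bar>"] h by (intro mult_left_mono) auto
  finally have 2: "cmod ((e - \<i> * x) * (2 * sqrt n * v * d)) \<le> 2 * h * ((a * v)\<^sup>2 + d\<^sup>2)" .
  have 3: "cmod (e * d\<^sup>2) \<le> 2 * h * d\<^sup>2"
    using mult_right_mono[OF R(1), of "d\<^sup>2"] by (simp add: norm_mult norm_power e_def)
  \<comment> \<open>The constants: 1 + 2 for the square of \<open>a * v\<close> and 2 + 2 for that
    of \<open>d\<close>, the mixed term being split evenly.\<close>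
  have "cmod (n * (e * s\<^sup>2) - (\<i> * (sqrt n * (a * v\<^sup>2)) - (a * v)\<^sup>2 / 2 + \<i> * (2 * (a * v * d))))
     \<le> h * (a * v)\<^sup>2 + 2 * h * ((a * v)\<^sup>2 + d\<^sup>2) + 2 * h * d\<^sup>2"
    unfolding eq using 1 2 3 by (meson add_mono norm_triangle_ineq norm_triangle_le order_trans)
  then show ?thesis unfolding e_def x_def by (simp add: algebra_simps)
qed

text \<open>The one diverging term, \<open>sqrt n\<close> times the integral of \<open>a n\<close>
  under the density \<open>v n\<close> squared, is zero by centring. The mixed term gives the drift
  and the square the variance. No centring or integrability of \<open>a n\<close> under the density
  \<open>s n\<close> squared is required.\<close>

lemma char_increment_tendsto:
  fixes v s a :: "nat \<Rightarrow> 'a \<Rightarrow> real"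
  assumes v: "L2_lim M v u" and s: "\<And>n. s n \<in> L2 M"
    and d: "L2_lim M (\<lambda>n x. sqrt n * (s n x - v n x)) (\<lambda>x. w x * u x)" and w: "w \<in> borel_measurable M"
    and a: "\<And>n. a n \<in> borel_measurable M" "b \<in> borel_measurable M"
    and av: "L2_lim M (\<lambda>n x. a n x * v n x) (\<lambda>x. b x * u x)"
    and centred: "\<And>n. (\<integral>x. a n x * (v n x)\<^sup>2 \<partial>M) = 0"
  shows "(\<lambda>n. n * (CLINT x|M. (iexp (a n x / sqrt n) - 1) * (s n x)\<^sup>2))
    \<longlonglongrightarrow> \<i> * complex_of_real (2 * (\<integral>x. (b x * u x) * (w x * u x) \<partial>M)) - complex_of_real ((\<integral>x. (b x * u x)\<^sup>2 \<partial>M) / 2)"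
proof -
  let ?d = "\<lambda>n x. sqrt n * (s n x - v n x)"
  define h where "h = (\<lambda>n x. min 1 (\<bar>a n x\<bar> / sqrt n))"
  note [measurable] = a w L2D(1)[OF s] L2D(1)[OF L2_limD(1)[OF v]] L2D(1)[OF L2_limD(2)[OF v]]
  have hm[measurable]: "h n \<in> borel_measurable M" for n unfolding h_def by measurable
  have h: "0 \<le> h n x" "h n x \<le> 1" for n x by (auto simp: h_def)
  note V = L2_limD[OF v] and D = L2_limD[OF d] and A = L2_limD[OF av]
  \<comment> \<open>The Cauchy-Schwarz inequality bounds this by a constant over
    \<open>sqrt n\<close>, since \<open>h\<close> is at most
    \<open>\<bar>a\<bar> / sqrt n\<close>.\<close>
  have "(\<lambda>n. \<integral>x. h n x * (v n x)\<^sup>2 \<partial>M) \<longlonglongrightarrow> 0"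
  proof (rule Lim_null_comparison)
    have "norm (\<integral>x. h n x * (v n x)\<^sup>2 \<partial>M) \<le> (sqrt ((\<integral>x. (v n x)\<^sup>2 \<partial>M) * (\<integral>x. (a n x * v n x)\<^sup>2 \<partial>M))) / sqrt n" for n
    proof -
      have "(\<integral>x. h n x * (v n x)\<^sup>2 \<partial>M) \<le> (\<integral>x. \<bar>v n x\<bar> * \<bar>a n x * v n x\<bar> / sqrt n \<partial>M)"
      proof (rule integral_mono)
        have "integrable M (\<lambda>x. \<bar>v n x * (a n x * v n x)\<bar>)"
          by (intro integrable_abs L2_integrable_mult V A)
        then show "integrable M (\<lambda>x. \<bar>v n x\<bar> * \<bar>a n x * v n x\<bar> / sqrt n)" by (simp add: abs_mult)
        show "h n x * (v n x)\<^sup>2 \<le> \<bar>v n x\<bar> * \<bar>a n x * v n x\<bar> / sqrt n" for x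
        proof -
          have "h n x * (v n x)\<^sup>2 \<le> (\<bar>a n x\<bar> / sqrt n) * (v n x)\<^sup>2"
            by (intro mult_right_mono) (auto simp: h_def)
          then show ?thesis by (simp add: abs_mult power2_eq_square mult_ac)
        qed
      qed (rule integrable_weighted_square[OF V(1) hm h])
      also have "\<dots> = (\<integral>x. \<bar>v n x\<bar> * \<bar>a n x * v n x\<bar> \<partial>M) / sqrt n" by simp
      also have "\<dots> \<le> (sqrt ((\<integral>x. (v n x)\<^sup>2 \<partial>M) * (\<integral>x. (a n x * v n x)\<^sup>2 \<partial>M))) / sqrt n"
      proof (intro divide_right_mono real_le_rsqrt)
        have "(\<lambda>x. \<bar>v n x\<bar>) \<in> L2 M" "(\<lambda>x. \<bar>a n x * v n x\<bar>) \<in> L2 M"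
          using V(1)[of n] A(1)[of n] by (auto simp: L2_def)
        from L2_Cauchy_Schwarz[OF this]
        show "(\<integral>x. \<bar>v n x\<bar> * \<bar>a n x * v n x\<bar> \<partial>M)\<^sup>2 \<le> (\<integral>x. (v n x)\<^sup>2 \<partial>M) * (\<integral>x. (a n x * v n x)\<^sup>2 \<partial>M)"
          by simp
      qed simp
      finally show ?thesis using h by (simp add: integral_nonneg_AE)
    qed
    then show "\<forall>\<^sub>F n in sequentially. norm (\<integral>x. h n x * (v n x)\<^sup>2 \<partial>M) \<le> (sqrt ((\<integral>x. (v n x)\<^sup>2 \<partial>M) * (\<integral>x. (a n x * v n x)\<^sup>2 \<partial>M))) / sqrt n"
      by simp
    have "filterlim (\<lambda>n. sqrt (real n)) at_top sequentially"
      by (rule filterlim_compose[OF sqrt_at_top filterlim_real_sequentially])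
    then show "(\<lambda>n. (sqrt ((\<integral>x. (v n x)\<^sup>2 \<partial>M) * (\<integral>x. (a n x * v n x)\<^sup>2 \<partial>M))) / sqrt n) \<longlonglongrightarrow> 0"
      by (intro real_tendsto_divide_at_top[OF tendsto_real_sqrt[OF tendsto_mult[OF L2_lim_integral_square[OF v] L2_lim_integral_square[OF av]]]])
  qed
  \<comment> \<open>From \<open>v n\<close> the smallness passes to its limit \<open>u\<close>, from
    \<open>u\<close> to the limits \<open>b * u\<close> and \<open>w * u\<close>, and from these
    back to the sequences whose squares bound the remainder.\<close>
  then have hu: "(\<lambda>n. \<integral>x. h n x * (u x)\<^sup>2 \<partial>M) \<longlonglongrightarrow> 0"
    using L2_lim_weighted_iff[OF v, of h, OF hm h] by blast
  have hav: "(\<lambda>n. \<integral>x. h n x * (a n x * v n x)\<^sup>2 \<partial>M) \<longlonglongrightarrow> 0"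
    using L2_lim_weighted_iff[OF av, of h, OF hm h] weighted_integral_tendsto_0[OF V(2) A(2) a(2), of h, OF hm h hu] by blast
  have hd: "(\<lambda>n. \<integral>x. h n x * (?d n x)\<^sup>2 \<partial>M) \<longlonglongrightarrow> 0"
    using L2_lim_weighted_iff[OF d, of h, OF hm h] weighted_integral_tendsto_0[OF V(2) D(2) w, of h, OF hm h hu] by blast
  let ?main = "\<lambda>n x. \<i> * (sqrt n * (a n x * (v n x)\<^sup>2)) - (a n x * v n x)\<^sup>2 / 2 + \<i> * (2 * (a n x * v n x * ?d n x))"
  let ?inc = "\<lambda>n x. n * ((iexp (a n x / sqrt n) - 1) * (s n x)\<^sup>2)"
  have i1: "integrable M (\<lambda>x. a n x * (v n x)\<^sup>2)" for n
    using L2_integrable_mult[OF A(1)[of n] V(1)[of n]] by (simp add: power2_eq_square mult.assoc)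
  have i2: "integrable M (\<lambda>x. a n x * v n x * ?d n x)" for n
    by (rule L2_integrable_mult[OF A(1)[of n] D(1)[of n]])
  have i3: "integrable M (\<lambda>x. (a n x * v n x)\<^sup>2)" for n
    using L2D(2)[OF A(1)[of n]] .
  have im: "integrable M (?main n)" for n
    using i1[of n] i2[of n] i3[of n] by (intro Bochner_Integration.integrable_add Bochner_Integration.integrable_diff integrable_mult_right integrable_of_real integrable_divide)
  have ii: "integrable M (?inc n)" for n
  proof (rule Bochner_Integration.integrable_bound)
    show "integrable M (\<lambda>x. real n * 2 * (s n x)\<^sup>2)" using L2D(2)[OF s] by simp
    show "AE x in M. norm (?inc n x) \<le> norm (real n * 2 * (s n x)\<^sup>2)"
    proof (rule AE_I2)
      fix x
      have "cmod (iexp (a n x / sqrt n) - 1) \<le> 2" using norm_triangle_ineq4[of "iexp (a n x / sqrt n)" 1] by simp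
      then have "n * (cmod (iexp (a n x / sqrt n) - 1) * (s n x)\<^sup>2) \<le> n * (2 * (s n x)\<^sup>2)"
        by (intro mult_left_mono mult_right_mono) auto
      then show "norm (?inc n x) \<le> norm (real n * 2 * (s n x)\<^sup>2)"
        by (simp add: norm_mult norm_power abs_mult)
    qed
  qed measurable
  have diff0: "(\<lambda>n. (CLINT x|M. ?inc n x) - (CLINT x|M. ?main n x)) \<longlonglongrightarrow> 0"
  proof (rule Lim_null_comparison)
    show "(\<lambda>n. 3 * (\<integral>x. h n x * (a n x * v n x)\<^sup>2 \<partial>M) + 4 * (\<integral>x. h n x * (?d n x)\<^sup>2 \<partial>M)) \<longlonglongrightarrow> 0"
      using hav hd by (auto intro!: tendsto_eq_intros)
    show "\<forall>\<^sub>F n in sequentially. norm ((CLINT x|M. ?inc n x) - (CLINT x|M. ?main n x))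
        \<le> 3 * (\<integral>x. h n x * (a n x * v n x)\<^sup>2 \<partial>M) + 4 * (\<integral>x. h n x * (?d n x)\<^sup>2 \<partial>M)"
      using eventually_gt_at_top[of 0]
    proof eventually_elim
      case (elim n)
      have w1: "integrable M (\<lambda>x. h n x * (a n x * v n x)\<^sup>2)" "integrable M (\<lambda>x. h n x * (?d n x)\<^sup>2)"
        by (rule integrable_weighted_square[OF A(1) hm h], rule integrable_weighted_square[OF D(1) hm h])
      have "norm ((CLINT x|M. ?inc n x) - (CLINT x|M. ?main n x)) = norm (CLINT x|M. ?inc n x - ?main n x)"
        by (subst Bochner_Integration.integral_diff[OF ii im]) (rule refl)
      also have "\<dots> \<le> (\<integral>x. norm (?inc n x - ?main n x) \<partial>M)" by (rule integral_norm_bound)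
      also have "\<dots> \<le> (\<integral>x. 3 * (h n x * (a n x * v n x)\<^sup>2) + 4 * (h n x * (?d n x)\<^sup>2) \<partial>M)"
        using char_increment_pointwise[OF elim] w1
        by (intro integral_mono integrable_norm Bochner_Integration.integrable_diff[OF ii im] Bochner_Integration.integrable_add integrable_mult_right)
           (auto simp: h_def)
      also have "\<dots> = 3 * (\<integral>x. h n x * (a n x * v n x)\<^sup>2 \<partial>M) + 4 * (\<integral>x. h n x * (?d n x)\<^sup>2 \<partial>M)"
        using w1 by simp
      finally show ?case .
    qed
  qed
  have main_eq: "(CLINT x|M. ?main n x) = \<i> * complex_of_real (2 * (\<integral>x. (a n x * v n x) * ?d n x \<partial>M)) - complex_of_real ((\<integral>x. (a n x * v n x)\<^sup>2 \<partial>M) / 2)" for n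
  proof -
    have "(CLINT x|M. ?main n x) = \<i> * (sqrt n * (\<integral>x. a n x * (v n x)\<^sup>2 \<partial>M)) - (\<integral>x. (a n x * v n x)\<^sup>2 \<partial>M) / 2 + \<i> * (2 * (\<integral>x. (a n x * v n x) * ?d n x \<partial>M))"
      using i1[of n] i2[of n] i3[of n]
      by (simp only: Bochner_Integration.integral_add Bochner_Integration.integral_diff integrable_mult_right integrable_of_real integrable_divide
         Bochner_Integration.integrable_diff integral_mult_right_zero integral_divide_zero integral_complex_of_real)
    then show ?thesis by (simp add: centred)
  qed
  have "(\<lambda>n. CLINT x|M. ?main n x) \<longlonglongrightarrow> \<i> * complex_of_real (2 * (\<integral>x. (b x * u x) * (w x * u x) \<partial>M)) - complex_of_real ((\<integral>x. (b x * u x)\<^sup>2 \<partial>M) / 2)"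
    unfolding main_eq by (intro tendsto_intros tendsto_of_real L2_lim_integral_mult[OF av d] L2_lim_integral_square[OF av]) simp
  from tendsto_add[OF diff0 this] show ?thesis by simp
qed

section \<open>Product laws and contiguity\<close>

lemma is_densityD:
  assumes "is_density M f"
  shows "f \<in> borel_measurable M" "\<And>x. x \<in> space M \<Longrightarrow> 0 \<le> f x" "prob_space (law M f)"
    "integrable M f" "(\<integral>x. f x \<partial>M) = 1" "(\<lambda>x. sqrt (f x)) \<in> L2 M"
proof -
  show m[measurable]: "f \<in> borel_measurable M" and nn: "\<And>x. x \<in> space M \<Longrightarrow> 0 \<le> f x"
    using assms by (auto simp: is_density_def)
  have 1: "(\<integral>\<^sup>+x. f x \<partial>M) = 1" using assms by (auto simp: is_density_def)
  show "prob_space (law M f)"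
    by (rule prob_spaceI) (simp add: law_def emeasure_density 1 cong: nn_integral_cong_simp)
  show i: "integrable M f"
    by (rule integrableI_nonneg) (use nn 1 in auto)
  show "(\<integral>x. f x \<partial>M) = 1"
    using nn_integral_eq_integral[OF i] nn 1 by (simp add: AE_I2)
  show "(\<lambda>x. sqrt (f x)) \<in> L2 M"
    unfolding L2_def using i nn by (auto cong: Bochner_Integration.integrable_cong)
qed

lemma sets_law [simp, measurable_cong]: "sets (law M f) = sets M"
  and space_law [simp]: "space (law M f) = space M"
  by (simp_all add: law_def)

lemma sets_product_law_law [simp, measurable_cong]: "sets (product_law n (law M f)) = sets (\<Pi>\<^sub>M i\<in>{..<n}. M)"
  unfolding product_law_def by (intro sets_PiM_cong) auto

lemma space_product_law_law [simp]: "space (product_law n (law M f)) = space (\<Pi>\<^sub>M i\<in>{..<n}. M)"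
  using sets_eq_imp_space_eq[OF sets_product_law_law] .

lemma prob_space_product_law: "prob_space P \<Longrightarrow> prob_space (product_law n P)"
  unfolding product_law_def by (rule prob_space_PiM)

lemma integral_law:
  fixes f :: "'a \<Rightarrow> 'b::{banach, second_countable_topology}"
  assumes "is_density M p" "f \<in> borel_measurable M"
  shows "(\<integral>x. f x \<partial>law M p) = (\<integral>x. p x *\<^sub>R f x \<partial>M)"
  unfolding law_def using is_densityD[OF assms(1)] assms(2)
  by (intro integral_density) (auto intro: AE_I2)

lemma integrable_law:
  fixes f :: "'a \<Rightarrow> 'b::{banach, second_countable_topology}"
  assumes "is_density M p" "f \<in> borel_measurable M"
  shows "integrable (law M p) f \<longleftrightarrow> integrable M (\<lambda>x. p x *\<^sub>R f x)"
  unfolding law_def using is_densityD[OF assms(1)] assms(2)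
  by (intro integrable_density) (auto intro: AE_I2)

text \<open>Multiplication by the root density embeds the square integrable functions of each law
  isometrically into one space, where functions belonging to different laws can be compared.\<close>

lemma L2_law_iff:
  assumes p: "is_density M p" and f: "f \<in> borel_measurable M"
  shows "f \<in> L2 (law M p) \<longleftrightarrow> (\<lambda>x. f x * sqrt (p x)) \<in> L2 M"
proof -
  have "integrable (law M p) (\<lambda>x. (f x)\<^sup>2) \<longleftrightarrow> integrable M (\<lambda>x. p x *\<^sub>R (f x)\<^sup>2)"
    using f by (intro integrable_law[OF p]) measurable
  also have "\<dots> \<longleftrightarrow> integrable M (\<lambda>x. (f x * sqrt (p x))\<^sup>2)"
    using is_densityD(2)[OF p] by (intro Bochner_Integration.integrable_cong) (auto simp: power_mult_distrib)
  finally show ?thesis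
    using f is_densityD(1)[OF p] by (simp add: L2_def law_def)
qed

lemma integral_law_mult:
  assumes p: "is_density M p" and f: "f \<in> borel_measurable M" "g \<in> borel_measurable M"
  shows "(\<integral>x. f x * g x \<partial>law M p) = (\<integral>x. (f x * sqrt (p x)) * (g x * sqrt (p x)) \<partial>M)"
proof -
  have "(\<integral>x. f x * g x \<partial>law M p) = (\<integral>x. p x *\<^sub>R (f x * g x) \<partial>M)"
    using f by (intro integral_law[OF p]) measurable
  also have "\<dots> = (\<integral>x. (f x * sqrt (p x)) * (g x * sqrt (p x)) \<partial>M)"
    using is_densityD(2)[OF p] by (intro Bochner_Integration.integral_cong) (auto simp: mult_ac)
  finally show ?thesis .
qed

lemma char_product_law:
  assumes "prob_space P" and [measurable]: "f \<in> borel_measurable P"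
  shows "(CLINT x|product_law n P. iexp (\<Sum>i<n. f (x i))) = (CLINT x|P. iexp (f x)) ^ n"
proof -
  interpret P: prob_space P by fact
  interpret product_sigma_finite "\<lambda>_. P" by (rule product_sigma_finite.intro) (rule P.sigma_finite_measure_axioms)
  have "(CLINT x|product_law n P. iexp (\<Sum>i<n. f (x i))) = (CLINT x|product_law n P. (\<Prod>i<n. iexp (f (x i))))"
    by (simp add: exp_sum sum_distrib_left)
  also have "\<dots> = (\<Prod>i<n. CLINT x|P. iexp (f x))"
    unfolding product_law_def
    by (rule product_integral_prod) (auto intro!: P.integrable_const_bound[where B=1])
  finally show ?thesis by simp
qed

text \<open>The characteristic function is the n-th power of the one-observation value
  \<open>?z n\<close>, so the limit of \<open>n * (?z n - 1)\<close> decides. The drift comes from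
  the distance between the roots of \<open>p n\<close> and \<open>q n\<close>, as \<open>a n\<close>
  is centred under \<open>q n\<close>. The real part of the limit, minus half a variance, is
  nonpositive as the power limit requires.\<close>

theorem char_product_law_tendsto:
  fixes p q a :: "nat \<Rightarrow> 'a \<Rightarrow> real"
  assumes p: "\<And>n. is_density M (p n)" and q: "\<And>n. is_density M (q n)" and p0: "is_density M p0"
    and qlim: "L2_lim M (\<lambda>n x. sqrt (q n x)) (\<lambda>x. sqrt (p0 x))"
    and d: "L2_lim M (\<lambda>n x. sqrt n * (sqrt (p n x) - sqrt (q n x))) (\<lambda>x. w x * sqrt (p0 x))" and w[measurable]: "w \<in> borel_measurable M"
    and a[measurable]: "\<And>n. a n \<in> borel_measurable M" "b \<in> borel_measurable M"
    and aq: "L2_lim M (\<lambda>n x. a n x * sqrt (q n x)) (\<lambda>x. b x * sqrt (p0 x))"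
    and centred: "\<And>n. (\<integral>x. a n x \<partial>law M (q n)) = 0"
  shows "(\<lambda>n. CLINT x|product_law n (law M (p n)). iexp (normalized_sum n (a n) x))
    \<longlonglongrightarrow> exp (\<i> * complex_of_real (2 * (\<integral>x. b x * w x \<partial>law M p0)) - complex_of_real ((\<integral>x. (b x)\<^sup>2 \<partial>law M p0) / 2))"
proof -
  note [measurable] = is_densityD(1)[OF p] is_densityD(1)[OF q] is_densityD(1)[OF p0]
  let ?z = "\<lambda>n. CLINT x|law M (p n). iexp (a n x / sqrt n)"
  have "(\<integral>x. a n x * (sqrt (q n x))\<^sup>2 \<partial>M) = (\<integral>x. a n x \<partial>law M (q n))" for n
    unfolding integral_law[OF q a(1)] using is_densityD(2)[OF q]
    by (intro Bochner_Integration.integral_cong) auto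
  then have c0: "(\<integral>x. a n x * (sqrt (q n x))\<^sup>2 \<partial>M) = 0" for n by (simp add: centred)
  have e1: "(\<integral>x. (b x * sqrt (p0 x)) * (w x * sqrt (p0 x)) \<partial>M) = (\<integral>x. b x * w x \<partial>law M p0)"
    by (rule integral_law_mult[OF p0 a(2) w, symmetric])
  have e2: "(\<integral>x. (b x * sqrt (p0 x))\<^sup>2 \<partial>M) = (\<integral>x. (b x)\<^sup>2 \<partial>law M p0)"
    unfolding power2_eq_square by (rule integral_law_mult[OF p0 a(2) a(2), symmetric])
  have lim: "(\<lambda>n. n * (CLINT x|M. (iexp (a n x / sqrt n) - 1) * (sqrt (p n x))\<^sup>2))
     \<longlonglongrightarrow> \<i> * complex_of_real (2 * (\<integral>x. b x * w x \<partial>law M p0)) - complex_of_real ((\<integral>x. (b x)\<^sup>2 \<partial>law M p0) / 2)"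
    using char_increment_tendsto[OF qlim is_densityD(6)[OF p] d w a aq c0] unfolding e1 e2 by (simp only: of_real_power)
  have eq: "(CLINT x|M. (iexp (a n x / sqrt n) - 1) * (sqrt (p n x))\<^sup>2) = ?z n - 1" for n
  proof -
    interpret Pn: prob_space "law M (p n)" by (rule is_densityD[OF p])
    have i: "integrable (law M (p n)) (\<lambda>x. iexp (a n x / sqrt n))"
      by (rule Pn.integrable_const_bound[where B=1]) auto
    have "(CLINT x|M. (iexp (a n x / sqrt n) - 1) * (sqrt (p n x))\<^sup>2) = (CLINT x|M. p n x *\<^sub>R (iexp (a n x / sqrt n) - 1))"
      using is_densityD(2)[OF p] by (intro Bochner_Integration.integral_cong) (auto simp: scaleR_conv_of_real simp flip: of_real_power)
    also have "\<dots> = (CLINT x|law M (p n). iexp (a n x / sqrt n) - 1)"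
      by (rule integral_law[OF p, symmetric]) measurable
    also have "\<dots> = ?z n - 1" using i Pn.prob_space by simp
    finally show ?thesis .
  qed
  have le1: "cmod (?z n) \<le> 1" for n
  proof -
    interpret Pn: prob_space "law M (p n)" by (rule is_densityD[OF p])
    have "cmod (?z n) \<le> (\<integral>x. cmod (iexp (a n x / sqrt n)) \<partial>law M (p n))" by (rule integral_norm_bound)
    then show ?thesis using Pn.prob_space by simp
  qed
  have "(\<lambda>n. ?z n ^ n) \<longlonglongrightarrow> exp (\<i> * complex_of_real (2 * (\<integral>x. b x * w x \<partial>law M p0)) - complex_of_real ((\<integral>x. (b x)\<^sup>2 \<partial>law M p0) / 2))"
    by (rule complex_power_tendsto_exp[OF le1 lim[unfolded eq]]) simp
  moreover have "(CLINT x|product_law n (law M (p n)). iexp (normalized_sum n (a n) x)) = ?z n ^ n" for n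
    using char_product_law[OF is_densityD(3)[OF p], of "\<lambda>x. a n x / sqrt n"]
    by (simp add: normalized_sum_def sum_divide_distrib)
  ultimately show ?thesis by simp
qed

lemma product_law_law_eq_density:
  assumes "sigma_finite_measure M" and p: "is_density M p"
  shows "product_law n (law M p) = density (\<Pi>\<^sub>M i\<in>{..<n}. M) (\<lambda>x. \<Prod>i<n. ennreal (p (x i)))"
  unfolding product_law_def law_def
  by (rule PiM_density)
    (use assms is_densityD[OF p] in \<open>auto simp: law_def intro: prob_space_imp_sigma_finite\<close>)

text \<open>The likelihood ratio need not be square integrable, so it is cut off where
  \<open>p > 4 * q\<close>. A union bound controls the event that some observation falls there.
  Elsewhere the second moment of the ratio under \<open>q\<close> is 1 plus a multiple of the
  squared Hellinger distance, so its n-th power stays bounded when that distance is of order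
  \<open>1 / n\<close>.\<close>

lemma contiguity_bound:
  assumes M: "sigma_finite_measure M" and p: "is_density M p" and q: "is_density M q"
    and B[measurable]: "B \<in> sets (\<Pi>\<^sub>M i\<in>{..<n}. M)"
  shows "measure (product_law n (law M p)) B
    \<le> n * measure (law M p) {x \<in> space M. p x > 4 * q x}
      + sqrt (measure (product_law n (law M q)) B * exp (9 * (n * (\<integral>x. (sqrt (p x) - sqrt (q x))\<^sup>2 \<partial>M))))"
proof -
  note [measurable] = is_densityD(1)[OF p] is_densityD(1)[OF q]
  interpret P: prob_space "law M p" by (rule is_densityD[OF p])
  interpret Q: prob_space "law M q" by (rule is_densityD[OF q])
  interpret Pn: prob_space "product_law n (law M p)" by (rule prob_space_product_law[OF P.prob_space_axioms])
  interpret Qn: prob_space "product_law n (law M q)" by (rule prob_space_product_law[OF Q.prob_space_axioms])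
  interpret QQ: product_sigma_finite "\<lambda>_::nat. law M q" by (rule product_sigma_finite.intro) (rule Q.sigma_finite_measure_axioms)
  let ?S = "{x \<in> space M. p x > 4 * q x}" and ?N = "\<Pi>\<^sub>M i\<in>{..<n}. M"
  have Sm: "?S \<in> sets M" by measurable
  \<comment> \<open>Off the cut-off set, \<open>q x = 0\<close> forces \<open>p x = 0\<close>, so
    that the quotient 0 / 0 = 0 still satisfies \<open>\<rho> x * q x = p x\<close>.\<close>
  define \<rho> where "\<rho> = (\<lambda>x. if p x > 4 * q x then 0 else p x / q x)"
  have \<rho>m[measurable]: "\<rho> \<in> borel_measurable M" unfolding \<rho>_def by measurable
  have \<rho>b: "0 \<le> \<rho> x" "\<rho> x \<le> 4" if "x \<in> space M" for x
    using is_densityD(2)[OF p that] is_densityD(2)[OF q that]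
    by (auto simp: \<rho>_def divide_le_eq not_less)
  have \<rho>2: "(\<rho> x)\<^sup>2 \<le> 16" if "x \<in> space M" for x
    using power_mono[OF \<rho>b(2)[OF that] \<rho>b(1)[OF that], of 2] by simp
  have \<rho>q: "\<rho> x * q x = p x" if "x \<in> space M" "\<not> p x > 4 * q x" for x
    using is_densityD(2)[OF p that(1)] is_densityD(2)[OF q that(1)] that(2) by (auto simp: \<rho>_def)
  define C where "C = {x \<in> space ?N. \<exists>i<n. p (x i) > 4 * q (x i)}"
  have Cm[measurable]: "C \<in> sets ?N" unfolding C_def by measurable
  have "measure (product_law n (law M p)) C \<le> n * measure (law M p) ?S"
  proof -
    have C: "C = (\<Union>i<n. {x \<in> space ?N. p (x i) > 4 * q (x i)})" by (auto simp: C_def)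
    have "measure (product_law n (law M p)) C \<le> (\<Sum>i<n. measure (product_law n (law M p)) {x \<in> space ?N. p (x i) > 4 * q (x i)})"
      unfolding C by (rule Pn.finite_measure_subadditive_finite) auto
    also have "\<dots> = (\<Sum>i<n. measure (law M p) ?S)"
    proof (intro sum.cong refl)
      fix i assume i: "i \<in> {..<n}"
      have cm: "(\<lambda>x. x i) \<in> measurable (product_law n (law M p)) (law M p)"
        unfolding product_law_def using i by (rule measurable_component_singleton)
      have "distr (product_law n (law M p)) (law M p) (\<lambda>x. x i) = law M p"
        unfolding product_law_def using i P.prob_space_axioms by (intro distr_PiM_component) auto
      then have "measure (law M p) ?S = measure (distr (product_law n (law M p)) (law M p) (\<lambda>x. x i)) ?S" by (simp only:)
      also have "\<dots> = measure (product_law n (law M p)) ((\<lambda>x. x i) -` ?S \<inter> space (product_law n (law M p)))"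
        by (rule measure_distr[OF cm]) (simp only: sets_law Sm)
      also have "(\<lambda>x. x i) -` ?S \<inter> space (product_law n (law M p)) = {x \<in> space ?N. p (x i) > 4 * q (x i)}"
        using measurable_space[OF cm] unfolding space_product_law_law space_law by blast
      finally show "measure (product_law n (law M p)) {x \<in> space ?N. p (x i) > 4 * q (x i)} = measure (law M p) ?S" ..
    qed
    finally show ?thesis by simp
  qed
  moreover have "measure (product_law n (law M p)) (B - C)
      \<le> sqrt (measure (product_law n (law M q)) B * exp (9 * (n * (\<integral>x. (sqrt (p x) - sqrt (q x))\<^sup>2 \<partial>M))))"
  proof -
    let ?R = "\<lambda>x. \<Prod>i<n. \<rho> (x i)"
    have Rm[measurable]: "?R \<in> borel_measurable ?N" by measurable
    have Rb: "0 \<le> ?R x" "?R x \<le> 4 ^ n" if "x \<in> space ?N" for x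
    proof -
      have "x i \<in> space M" if "i < n" for i using \<open>x \<in> space ?N\<close> that by (auto simp: space_PiM PiE_iff)
      then show "0 \<le> ?R x" "?R x \<le> 4 ^ n"
        using prod_mono[of "{..<n}" "\<lambda>i. \<rho> (x i)" "\<lambda>_. 4"] \<rho>b by (auto intro!: prod_nonneg)
    qed
    have r1: "(\<integral>x. (\<rho> x)\<^sup>2 \<partial>law M q) \<le> 1 + 9 * (\<integral>x. (sqrt (p x) - sqrt (q x))\<^sup>2 \<partial>M)"
    proof -
      have i: "integrable M (\<lambda>x. (sqrt (p x) - sqrt (q x))\<^sup>2)" "integrable M p" "integrable M q"
        using L2D(2)[OF L2_diff[OF is_densityD(6)[OF p] is_densityD(6)[OF q]]] is_densityD[OF p] is_densityD[OF q] by auto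
      have ir: "integrable (law M q) (\<lambda>x. (\<rho> x)\<^sup>2)"
        by (intro Q.integrable_const_bound[where B=16]) (auto intro!: AE_I2 simp: \<rho>2)
      have "(\<integral>x. (\<rho> x)\<^sup>2 \<partial>law M q) = (\<integral>x. q x *\<^sub>R (\<rho> x)\<^sup>2 \<partial>M)"
        by (rule integral_law[OF q]) measurable
      \<comment> \<open>From the identity p^2/q = 2p - q + (p - q)^2/q. The linear part integrates
        to 1. Where \<open>p \<le> 4 * q\<close> the roots add up to at most 3 times the root of
        \<open>q\<close>, hence the constant 9.\<close>
      also have "\<dots> \<le> (\<integral>x. 2 * p x - q x + 9 * (sqrt (p x) - sqrt (q x))\<^sup>2 \<partial>M)"
      proof (rule integral_mono)
        show "integrable M (\<lambda>x. q x *\<^sub>R (\<rho> x)\<^sup>2)"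
          using ir by (subst (asm) integrable_law[OF q]) auto
        show "integrable M (\<lambda>x. 2 * p x - q x + 9 * (sqrt (p x) - sqrt (q x))\<^sup>2)" using i by simp
        fix x assume x: "x \<in> space M"
        define s v where "s = sqrt (p x)" and "v = sqrt (q x)"
        have sv: "0 \<le> s" "0 \<le> v" "p x = s\<^sup>2" "q x = v\<^sup>2"
          using is_densityD(2)[OF p x] is_densityD(2)[OF q x] by (auto simp: s_def v_def)
        show "q x *\<^sub>R (\<rho> x)\<^sup>2 \<le> 2 * p x - q x + 9 * (sqrt (p x) - sqrt (q x))\<^sup>2"
        proof (cases "p x > 4 * q x")
          case True
          then show ?thesis using is_densityD(2)[OF q x] by (simp add: \<rho>_def)
        next
          case False
          then have "s\<^sup>2 \<le> (2 * v)\<^sup>2" by (simp add: sv power_mult_distrib)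
          then have s2v: "s \<le> 2 * v" by (rule power2_le_imp_le) (use sv in simp)
          show ?thesis
          proof (cases "v = 0")
            case True then show ?thesis using s2v sv by (simp add: \<rho>_def)
          next
            case False
            then have "v > 0" using sv by simp
            have "((s - v) * (s + v))\<^sup>2 \<le> ((s - v) * (3 * v))\<^sup>2"
              unfolding power_mult_distrib[of "s - v"] using s2v sv by (intro mult_left_mono power_mono) auto
            also have "((s - v) * (3 * v))\<^sup>2 = (9 * (s - v)\<^sup>2) * v\<^sup>2"
              unfolding power_mult_distrib by simp
            finally have "((s - v) * (s + v))\<^sup>2 / v\<^sup>2 \<le> 9 * (s - v)\<^sup>2"
              using \<open>v > 0\<close> by (subst pos_divide_le_eq) auto
            moreover have "q x *\<^sub>R (\<rho> x)\<^sup>2 = 2 * s\<^sup>2 - v\<^sup>2 + ((s - v) * (s + v))\<^sup>2 / v\<^sup>2"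
              using \<open>v > 0\<close> \<open>\<not> p x > 4 * q x\<close> by (simp add: \<rho>_def sv field_simps power2_eq_square)
            ultimately show ?thesis by (simp add: sv flip: s_def v_def)
          qed
        qed
      qed
      also have "\<dots> = 1 + 9 * (\<integral>x. (sqrt (p x) - sqrt (q x))\<^sup>2 \<partial>M)"
        using i is_densityD(5)[OF p] is_densityD(5)[OF q] by simp
      finally show ?thesis .
    qed
    have "emeasure (product_law n (law M p)) (B - C) = (\<integral>\<^sup>+x. (\<Prod>i<n. ennreal (p (x i))) * indicator (B - C) x \<partial>?N)"
      unfolding product_law_law_eq_density[OF M p] by (rule emeasure_density) auto
    also have "\<dots> \<le> (\<integral>\<^sup>+x. (\<Prod>i<n. ennreal (q (x i))) * ennreal (indicator B x * ?R x) \<partial>?N)"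
    proof (rule nn_integral_mono)
      fix x assume x: "x \<in> space ?N"
      have xi: "x i \<in> space M" if "i < n" for i using x that by (auto simp: space_PiM PiE_iff)
      show "(\<Prod>i<n. ennreal (p (x i))) * indicator (B - C) x \<le> (\<Prod>i<n. ennreal (q (x i))) * ennreal (indicator B x * ?R x)"
      proof (cases "x \<in> B - C")
        case True
        then have "\<not> p (x i) > 4 * q (x i)" if "i < n" for i using x that by (auto simp: C_def)
        then have "(\<Prod>i<n. ennreal (p (x i))) = (\<Prod>i<n. ennreal (\<rho> (x i) * q (x i)))"
          using xi \<rho>q by (intro prod.cong) auto
        also have "\<dots> = (\<Prod>i<n. ennreal (q (x i))) * ennreal (?R x)"
        proof -
          have "(\<Prod>i<n. ennreal (\<rho> (x i))) = ennreal (?R x)"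
            using xi \<rho>b by (intro prod_ennreal) auto
          moreover have "(\<Prod>i<n. ennreal (\<rho> (x i) * q (x i))) = (\<Prod>i<n. ennreal (\<rho> (x i)) * ennreal (q (x i)))"
            using xi \<rho>b is_densityD(2)[OF q] by (intro prod.cong ennreal_mult) auto
          ultimately show ?thesis by (simp add: prod.distrib mult.commute)
        qed
        finally show ?thesis using True by simp
      qed simp
    qed
    also have "\<dots> = (\<integral>\<^sup>+x. ennreal (indicator B x * ?R x) \<partial>product_law n (law M q))"
      unfolding product_law_law_eq_density[OF M q] by (rule nn_integral_density[symmetric]) auto
    also have "\<dots> = ennreal (\<integral>x. indicator B x * ?R x \<partial>product_law n (law M q))"
      by (intro nn_integral_eq_integral Qn.integrable_const_bound[where B="4^n"])
        (use Rb in \<open>auto simp: indicator_def\<close>)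
    finally have "measure (product_law n (law M p)) (B - C) \<le> (\<integral>x. indicator B x * ?R x \<partial>product_law n (law M q))"
      unfolding Pn.emeasure_eq_measure by (subst (asm) ennreal_le_iff) (use Rb in \<open>auto intro!: integral_nonneg_AE\<close>)
    \<comment> \<open>The Cauchy-Schwarz inequality separates the probability of \<open>B\<close>
      under \<open>q\<close> from the second moment of the truncated product.\<close>
    also have "\<dots> \<le> sqrt ((\<integral>x. (indicator B x)\<^sup>2 \<partial>product_law n (law M q)) * (\<integral>x. (?R x)\<^sup>2 \<partial>product_law n (law M q)))"
    proof (intro real_le_rsqrt L2_Cauchy_Schwarz)
      show "indicator B \<in> L2 (product_law n (law M q))"
        unfolding L2_def using B by (auto intro!: Qn.integrable_const_bound[where B=1] simp: indicator_def)
      show "?R \<in> L2 (product_law n (law M q))"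
        unfolding L2_def using Rb by (auto intro!: Qn.integrable_const_bound[where B="(4^n)\<^sup>2"] power_mono)
    qed
    also have "(\<integral>x. (indicator B x)\<^sup>2 \<partial>product_law n (law M q)) = measure (product_law n (law M q)) B"
    proof -
      have "(\<integral>x. (indicator B x :: real)\<^sup>2 \<partial>product_law n (law M q)) = (\<integral>x. indicator B x \<partial>product_law n (law M q))"
        by (intro Bochner_Integration.integral_cong) (auto simp: indicator_def)
      then show ?thesis by (simp add: Int_absorb1 sets.sets_into_space[OF B])
    qed
    also have "(\<integral>x. (?R x)\<^sup>2 \<partial>product_law n (law M q)) = (\<integral>x. (\<Prod>i<n. (\<rho> (x i))\<^sup>2) \<partial>product_law n (law M q))"
      by (simp add: prod_power_distrib)
    also have "\<dots> = (\<integral>x. (\<rho> x)\<^sup>2 \<partial>law M q) ^ n"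
      unfolding product_law_def
      by (subst QQ.product_integral_prod) (auto intro!: Q.integrable_const_bound[where B=16] AE_I2 simp: \<rho>2)
    also have "\<dots> \<le> exp (9 * (\<integral>x. (sqrt (p x) - sqrt (q x))\<^sup>2 \<partial>M)) ^ n"
    proof (rule power_mono)
      show "(\<integral>x. (\<rho> x)\<^sup>2 \<partial>law M q) \<le> exp (9 * (\<integral>x. (sqrt (p x) - sqrt (q x))\<^sup>2 \<partial>M))"
        using r1 exp_ge_add_one_self[of "9 * (\<integral>x. (sqrt (p x) - sqrt (q x))\<^sup>2 \<partial>M)"] by linarith
    qed simp
    also have "exp (9 * (\<integral>x. (sqrt (p x) - sqrt (q x))\<^sup>2 \<partial>M)) ^ n = exp (9 * (n * (\<integral>x. (sqrt (p x) - sqrt (q x))\<^sup>2 \<partial>M)))"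
      by (simp add: mult_ac flip: exp_of_nat_mult)
    finally show ?thesis by (simp add: mult_left_mono)
  qed
  moreover have "measure (product_law n (law M p)) B \<le> measure (product_law n (law M p)) C + measure (product_law n (law M p)) (B - C)"
  proof -
    have "measure (product_law n (law M p)) B \<le> measure (product_law n (law M p)) (C \<union> (B - C))"
      by (rule Pn.finite_measure_mono) auto
    also have "\<dots> \<le> measure (product_law n (law M p)) C + measure (product_law n (law M p)) (B - C)"
      by (rule measure_Un_le) auto
    finally show ?thesis .
  qed
  ultimately show ?thesis by linarith
qed

text \<open>It remains to see that \<open>n\<close> times the probability of
  \<open>p n > 4 * q n\<close> vanishes. There the root of \<open>p n\<close> is at most twice the
  difference of the roots, so this quantity is at most 4 times the integral of the square of
  \<open>?d n\<close> over the set. Since \<open>?d n\<close> converges in mean square to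
  \<open>w\<close> times the root of \<open>p0\<close>, it puts no mass in the limit on sets whose
  \<open>p0\<close>-probability vanishes.\<close>

theorem contiguity:
  fixes p q :: "nat \<Rightarrow> 'a \<Rightarrow> real"
  assumes M: "sigma_finite_measure M" and p: "\<And>n. is_density M (p n)" and q: "\<And>n. is_density M (q n)" and p0: "is_density M p0"
    and plim: "L2_lim M (\<lambda>n x. sqrt (p n x)) (\<lambda>x. sqrt (p0 x))"
    and d: "L2_lim M (\<lambda>n x. sqrt n * (sqrt (p n x) - sqrt (q n x))) (\<lambda>x. w x * sqrt (p0 x))" and w: "w \<in> borel_measurable M"
    and B: "\<And>n. B n \<in> sets (\<Pi>\<^sub>M i\<in>{..<n}. M)"
    and lim: "(\<lambda>n. measure (product_law n (law M (q n))) (B n)) \<longlonglongrightarrow> 0"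
  shows "(\<lambda>n. measure (product_law n (law M (p n))) (B n)) \<longlonglongrightarrow> 0"
proof -
  note [measurable] = is_densityD(1)[OF p] is_densityD(1)[OF q] is_densityD(1)[OF p0] w
  let ?d = "\<lambda>n x. sqrt n * (sqrt (p n x) - sqrt (q n x))"
  let ?H = "\<lambda>n. \<integral>x. (?d n x)\<^sup>2 \<partial>M"
  let ?S = "\<lambda>n. {x \<in> space M. p n x > 4 * q n x}"
  define h where "h = (\<lambda>n x. indicator (?S n) x :: real)"
  have hm[measurable]: "h n \<in> borel_measurable M" for n unfolding h_def by measurable
  have h: "0 \<le> h n x" "h n x \<le> 1" for n x by (auto simp: h_def indicator_def)
  have Hlim: "?H \<longlonglongrightarrow> (\<integral>x. (w x * sqrt (p0 x))\<^sup>2 \<partial>M)" by (rule L2_lim_integral_square[OF d])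
  have pt: "n * (h n x * (sqrt (p n x))\<^sup>2) \<le> 4 * (h n x * (?d n x)\<^sup>2)" if "x \<in> space M" for n x
  proof (cases "x \<in> ?S n")
    case True
    then have "4 * q n x \<le> p n x" by simp
    then have "sqrt (4 * q n x) \<le> sqrt (p n x)" by (rule real_sqrt_le_mono)
    then have "2 * sqrt (q n x) \<le> sqrt (p n x)" by (simp add: real_sqrt_mult)
    then have "sqrt (p n x) \<le> 2 * (sqrt (p n x) - sqrt (q n x))" by simp
    then have "(sqrt (p n x))\<^sup>2 \<le> (2 * (sqrt (p n x) - sqrt (q n x)))\<^sup>2"
      using is_densityD(2)[OF p that] by (intro power_mono) auto
    then have "n * (sqrt (p n x))\<^sup>2 \<le> n * (2 * (sqrt (p n x) - sqrt (q n x)))\<^sup>2"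
      by (intro mult_left_mono) auto
    moreover have "h n x = 1" using True by (simp add: h_def)
    ultimately show ?thesis unfolding power_mult_distrib by simp
  qed (simp add: h_def)
  have pt_int: "n * (\<integral>x. h n x * (sqrt (p n x))\<^sup>2 \<partial>M) \<le> 4 * (\<integral>x. h n x * (?d n x)\<^sup>2 \<partial>M)" for n
  proof -
    have i: "integrable M (\<lambda>x. h n x * (sqrt (p n x))\<^sup>2)" "integrable M (\<lambda>x. h n x * (?d n x)\<^sup>2)"
      by (rule integrable_weighted_square[OF L2_limD(1)[OF plim] hm h], rule integrable_weighted_square[OF L2_limD(1)[OF d] hm h])
    have "(\<integral>x. n * (h n x * (sqrt (p n x))\<^sup>2) \<partial>M) \<le> (\<integral>x. 4 * (h n x * (?d n x)\<^sup>2) \<partial>M)"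
      using i by (intro integral_mono pt integrable_mult_right) auto
    then show ?thesis by simp
  qed
  \<comment> \<open>A bootstrap: the crude bound of order \<open>1 / n\<close> shows that the sets
    become small under \<open>p n\<close> and then under \<open>p0\<close>; this in turn makes the
    integral of the square of \<open>?d n\<close> over them vanish, which improves the bound by a
    factor tending to 0.\<close>
  have "(\<lambda>n. \<integral>x. h n x * (sqrt (p n x))\<^sup>2 \<partial>M) \<longlonglongrightarrow> 0"
  proof (rule tendsto_sandwich[OF _ _ tendsto_const])
    show "\<forall>\<^sub>F n in sequentially. 0 \<le> (\<integral>x. h n x * (sqrt (p n x))\<^sup>2 \<partial>M)"
      using h by (intro always_eventually allI integral_nonneg_AE AE_I2) auto
    show "\<forall>\<^sub>F n in sequentially. (\<integral>x. h n x * (sqrt (p n x))\<^sup>2 \<partial>M) \<le> 4 * ?H n / n"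
      using eventually_gt_at_top[of 0]
    proof eventually_elim
      case (elim n)
      have "(\<integral>x. h n x * (?d n x)\<^sup>2 \<partial>M) \<le> ?H n"
        using integrable_weighted_square[OF L2_limD(1)[OF d, of n] hm h] L2D(2)[OF L2_limD(1)[OF d, of n]] h
        by (intro integral_mono) (auto intro: mult_left_le_one_le)
      with pt_int[of n] have "n * (\<integral>x. h n x * (sqrt (p n x))\<^sup>2 \<partial>M) \<le> 4 * ?H n" by linarith
      then show ?case using elim by (simp add: field_simps)
    qed
    show "(\<lambda>n. 4 * ?H n / n) \<longlonglongrightarrow> 0"
      by (rule real_tendsto_divide_at_top[OF tendsto_mult[OF tendsto_const Hlim] filterlim_real_sequentially])
  qed
  then have hu: "(\<lambda>n. \<integral>x. h n x * (sqrt (p0 x))\<^sup>2 \<partial>M) \<longlonglongrightarrow> 0"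
    using L2_lim_weighted_iff[OF plim, of h, OF hm h] by blast
  have hd: "(\<lambda>n. \<integral>x. h n x * (?d n x)\<^sup>2 \<partial>M) \<longlonglongrightarrow> 0"
    using L2_lim_weighted_iff[OF d, of h, OF hm h] weighted_integral_tendsto_0[OF L2_limD(2)[OF plim] L2_limD(2)[OF d] w, of h, OF hm h hu] by blast
  have "(\<lambda>n. n * measure (law M (p n)) (?S n)) \<longlonglongrightarrow> 0"
  proof (rule tendsto_sandwich[OF _ _ tendsto_const])
    show "(\<lambda>n. 4 * (\<integral>x. h n x * (?d n x)\<^sup>2 \<partial>M)) \<longlonglongrightarrow> 0"
      using tendsto_mult[OF tendsto_const[of 4] hd] by simp
    have "measure (law M (p n)) (?S n) = (\<integral>x. h n x * (sqrt (p n x))\<^sup>2 \<partial>M)" for n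
    proof -
      have "measure (law M (p n)) (?S n) = (\<integral>x. h n x \<partial>law M (p n))"
        unfolding h_def by (subst Bochner_Integration.integral_indicator) (auto intro!: arg_cong[where f="measure _"])
      also have "\<dots> = (\<integral>x. p n x *\<^sub>R h n x \<partial>M)" by (rule integral_law[OF p hm])
      also have "\<dots> = (\<integral>x. h n x * (sqrt (p n x))\<^sup>2 \<partial>M)"
        using is_densityD(2)[OF p] by (intro Bochner_Integration.integral_cong) (auto simp: mult_ac)
      finally show ?thesis .
    qed
    then show "\<forall>\<^sub>F n in sequentially. n * measure (law M (p n)) (?S n) \<le> 4 * (\<integral>x. h n x * (?d n x)\<^sup>2 \<partial>M)"
      using pt_int by simp
  qed simp
  moreover have "(\<lambda>n. sqrt (measure (product_law n (law M (q n))) (B n) * exp (9 * ?H n))) \<longlonglongrightarrow> sqrt (0 * exp (9 * (\<integral>x. (w x * sqrt (p0 x))\<^sup>2 \<partial>M)))"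
    by (intro tendsto_intros lim Hlim)
  ultimately have bound: "(\<lambda>n. n * measure (law M (p n)) (?S n) + sqrt (measure (product_law n (law M (q n))) (B n) * exp (9 * ?H n))) \<longlonglongrightarrow> 0"
    using tendsto_add by fastforce
  show ?thesis
  proof (rule tendsto_sandwich[OF _ _ tendsto_const bound])
    have "?H n = n * (\<integral>x. (sqrt (p n x) - sqrt (q n x))\<^sup>2 \<partial>M)" for n
      by (simp add: power_mult_distrib)
    then show "\<forall>\<^sub>F n in sequentially. measure (product_law n (law M (p n))) (B n)
        \<le> n * measure (law M (p n)) (?S n) + sqrt (measure (product_law n (law M (q n))) (B n) * exp (9 * ?H n))"
      using contiguity_bound[OF M p q B] by simp
  qed simp
qed

section \<open>From local asymptotic normality to quadratic mean differentiability\<close>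

text \<open>The difference vanishes at 0 and has derivative y^2/(1 + y), at most 2x^2 between
  \<open>- \<bar>x\<bar>\<close> and \<open>\<bar>x\<bar>\<close>.\<close>

lemma ln_one_plus_third_order:
  fixes x :: real
  assumes x: "\<bar>x\<bar> \<le> 1/2"
  shows "\<bar>ln (1 + x) - x + x\<^sup>2 / 2\<bar> \<le> 2 * \<bar>x\<bar> ^ 3"
proof -
  let ?f = "\<lambda>y::real. ln (1 + y) - y + y\<^sup>2 / 2"
  have D: "(?f has_real_derivative y\<^sup>2 / (1 + y)) (at y within {- \<bar>x\<bar>..\<bar>x\<bar>})" if "y \<in> {- \<bar>x\<bar>..\<bar>x\<bar>}" for y
  proof -
    have y: "1 + y > 0" using that x by auto
    show ?thesis using y by (auto intro!: derivative_eq_intros simp: field_simps power2_eq_square)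
  qed
  have "norm (?f x - ?f 0) \<le> (2 * \<bar>x\<bar>\<^sup>2) * norm (x - 0)"
  proof (rule field_differentiable_bound[of "{- \<bar>x\<bar>..\<bar>x\<bar>}" ?f "\<lambda>y. y\<^sup>2 / (1 + y)"])
    fix y assume y: "y \<in> {- \<bar>x\<bar>..\<bar>x\<bar>}"
    then have y1: "1 + y \<ge> 1/2" "\<bar>y\<bar> \<le> \<bar>x\<bar>" using x by auto
    have "y\<^sup>2 / (1 + y) \<le> \<bar>x\<bar>\<^sup>2 / (1/2)"
      using y1 by (intro frac_le) (auto simp: abs_le_square_iff)
    then show "norm (y\<^sup>2 / (1 + y)) \<le> 2 * \<bar>x\<bar>\<^sup>2" using y1 by simp
  qed (use D in auto)
  then show ?thesis by (simp add: power3_eq_cube power2_eq_square mult_ac)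
qed

text \<open>With \<open>y = sqrt (1 + x)\<close> the error is exactly -(y - 1)^2/2, whereas x^2 = (y
  - 1)^2 (y + 1)^2 with \<open>y + 1 \<ge> 1\<close>. No lower bound on \<open>x\<close> away from
  -1 is needed.\<close>

lemma sqrt_one_plus_second_order:
  fixes x :: real
  assumes x: "-1 \<le> x"
  shows "\<bar>sqrt (1 + x) - 1 - x / 2\<bar> \<le> x\<^sup>2 / 2"
proof -
  define y where "y = sqrt (1 + x)"
  have y: "0 \<le> y" "x = y\<^sup>2 - 1" using x by (auto simp: y_def)
  have "sqrt (1 + x) - 1 - x / 2 = - ((y - 1)\<^sup>2 / 2)"
    unfolding y_def[symmetric] y(2) using y(1) by (simp add: power2_eq_square field_simps)
  moreover have "(y - 1)\<^sup>2 * 1 \<le> (y - 1)\<^sup>2 * (y + 1)\<^sup>2"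
    using y(1) by (intro mult_left_mono) (auto simp: one_le_power)
  moreover have "(y - 1)\<^sup>2 * (y + 1)\<^sup>2 = x\<^sup>2"
    unfolding y(2) power_mult_distrib[symmetric] by (simp add: power2_eq_square algebra_simps)
  ultimately show ?thesis by simp
qed

lemma L2_integrable:
  assumes "finite_measure M" "f \<in> L2 M" shows "integrable M (f :: 'a \<Rightarrow> real)"
proof -
  interpret finite_measure M by fact
  have "(\<lambda>x. 1) \<in> L2 M" by (simp add: L2_def)
  from L2_integrable_mult[OF assms(2) this] show ?thesis by simp
qed

text \<open>Cutting \<open>g\<close> off at \<open>K n\<close> destroys centring, so the mean
  \<open>c n\<close> of the truncated function is subtracted; it is at most \<open>K n\<close> in
  modulus, hence the bound \<open>2 * K n\<close>. A variance never exceeds the second moment, which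
  keeps the second moments below that of \<open>g\<close>.\<close>

lemma truncation:
  assumes "prob_space P" and g: "g \<in> L2 P" and g0: "(\<integral>x. g x \<partial>P) = 0"
    and K: "filterlim K at_top sequentially" "\<And>n::nat. (0::real) \<le> K n"
  obtains G where "\<And>n. G n \<in> borel_measurable P" "\<And>n x. \<bar>G n x\<bar> \<le> 2 * K n"
    "\<And>n. (\<integral>x. G n x \<partial>P) = 0" "\<And>n. (\<integral>x. (G n x)\<^sup>2 \<partial>P) \<le> (\<integral>x. (g x)\<^sup>2 \<partial>P)" "L2_lim P G g"
proof -
  interpret P: prob_space P by fact
  note [measurable] = L2D(1)[OF g]
  note gi = L2D(2)[OF g]
  define t where "t n x = (if \<bar>g x\<bar> \<le> K n then g x else 0)" for n x
  define r where "r n x = (if \<bar>g x\<bar> \<le> K n then 0 else g x)" for n x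
  have tm[measurable]: "t n \<in> borel_measurable P" and rm[measurable]: "r n \<in> borel_measurable P" for n
    unfolding t_def r_def by measurable
  have tb: "\<bar>t n x\<bar> \<le> K n" for n x using K(2) by (simp add: t_def)
  have ti: "integrable P (t n)" for n by (rule P.integrable_const_bound[where B="K n"]) (simp_all add: tb)
  have t2: "integrable P (\<lambda>x. (t n x)\<^sup>2)" for n
    by (rule Bochner_Integration.integrable_bound[OF gi]) (auto simp: t_def)
  have r2: "integrable P (\<lambda>x. (r n x)\<^sup>2)" for n
    by (rule Bochner_Integration.integrable_bound[OF gi]) (auto simp: r_def)
  have gI: "integrable P g" by (rule L2_integrable[OF P.finite_measure_axioms g])
  have rI: "integrable P (r n)" for n
    by (rule Bochner_Integration.integrable_bound[OF gI]) (auto simp: r_def)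
  define c where "c n = (\<integral>x. t n x \<partial>P)" for n
  have cb: "\<bar>c n\<bar> \<le> K n" for n
  proof -
    have "\<bar>c n\<bar> \<le> (\<integral>x. \<bar>t n x\<bar> \<partial>P)" unfolding c_def by (rule integral_abs_bound)
    also have "\<dots> \<le> (\<integral>x. K n \<partial>P)" using ti by (intro integral_mono) (auto simp: tb)
    finally show ?thesis by (simp add: P.prob_space)
  qed
  have cr: "(\<integral>x. r n x \<partial>P) = - c n" for n
  proof -
    have "(\<integral>x. t n x + r n x \<partial>P) = (\<integral>x. g x \<partial>P)" by (intro Bochner_Integration.integral_cong) (auto simp: t_def r_def)
    then show ?thesis using ti rI g0 by (simp add: c_def)
  qed
  have var: "(\<integral>x. (f x - (\<integral>x. f x \<partial>P))\<^sup>2 \<partial>P) \<le> (\<integral>x. (f x)\<^sup>2 \<partial>P)"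
    if "integrable P f" "integrable P (\<lambda>x. (f x)\<^sup>2)" for f :: "_ \<Rightarrow> real"
    using P.variance_eq[OF that] by simp
  let ?G = "\<lambda>n x. t n x - c n"
  show ?thesis
  proof (rule that[of ?G])
    show "?G n \<in> borel_measurable P" for n by measurable
    show "\<bar>?G n x\<bar> \<le> 2 * K n" for n x using tb[of n x] cb[of n] by linarith
    show "(\<integral>x. ?G n x \<partial>P) = 0" for n using ti by (simp add: P.prob_space c_def)
    show "(\<integral>x. (?G n x)\<^sup>2 \<partial>P) \<le> (\<integral>x. (g x)\<^sup>2 \<partial>P)" for n
    proof -
      have "(\<integral>x. (?G n x)\<^sup>2 \<partial>P) \<le> (\<integral>x. (t n x)\<^sup>2 \<partial>P)" unfolding c_def by (rule var[OF ti t2])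
      also have "\<dots> \<le> (\<integral>x. (g x)\<^sup>2 \<partial>P)" by (intro integral_mono t2 gi) (auto simp: t_def)
      finally show ?thesis .
    qed
    show "L2_lim P ?G g"
    proof (rule L2_limI_bound[OF _ g])
      show "?G n \<in> L2 P" for n
      proof -
        have "(?G n x)\<^sup>2 \<le> (2 * K n)\<^sup>2" for x
          using power_mono[of "\<bar>?G n x\<bar>" "2 * K n" 2] tb[of n x] cb[of n] by simp
        then have "integrable P (\<lambda>x. (?G n x)\<^sup>2)"
          by (intro P.integrable_const_bound[where B="(2 * K n)\<^sup>2"]) auto
        then show ?thesis by (simp add: L2_def)
      qed
      have "(\<lambda>n. \<integral>x. (r n x)\<^sup>2 \<partial>P) \<longlonglongrightarrow> (\<integral>x. 0 \<partial>P)"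
      proof (rule integral_dominated_convergence[where w="\<lambda>x. (g x)\<^sup>2"])
        show "AE x in P. (\<lambda>n. (r n x)\<^sup>2) \<longlonglongrightarrow> 0"
        proof (rule AE_I2)
          fix x
          have "\<forall>\<^sub>F n in sequentially. \<bar>g x\<bar> \<le> K n" using K(1) by (simp add: filterlim_at_top)
          then have "\<forall>\<^sub>F n in sequentially. (r n x)\<^sup>2 = 0" by eventually_elim (simp add: r_def)
          then show "(\<lambda>n. (r n x)\<^sup>2) \<longlonglongrightarrow> 0" by (rule tendsto_eventually)
        qed
      qed (use gi in \<open>auto simp: r_def\<close>)
      then show "(\<lambda>n. \<integral>x. (r n x)\<^sup>2 \<partial>P) \<longlonglongrightarrow> 0" by simp
      \<comment> \<open>Up to sign, the error is the discarded tail \<open>r n\<close> minus its own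
        mean, because \<open>g\<close> has mean 0.\<close>
      show "(\<integral>x. (?G n x - g x)\<^sup>2 \<partial>P) \<le> (\<integral>x. (r n x)\<^sup>2 \<partial>P)" for n
      proof -
        have "(?G n x - g x)\<^sup>2 = (r n x - (\<integral>x. r n x \<partial>P))\<^sup>2" for x
          unfolding cr by (simp add: t_def r_def power2_eq_square algebra_simps)
        then show ?thesis using var[OF rI r2] by simp
      qed
    qed
  qed
qed

text \<open>Centred independent terms are orthogonal, so only the \<open>n\<close> diagonal terms of
  the squared sum survive.\<close>

lemma product_law_second_moment:
  fixes f :: "'a \<Rightarrow> real"
  assumes "prob_space P" and f: "f \<in> L2 P" and f0: "(\<integral>x. f x \<partial>P) = 0"
  shows "integrable (product_law n P) (\<lambda>x. (\<Sum>i<n. f (x i))\<^sup>2)"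
    and "(\<integral>x. (\<Sum>i<n. f (x i))\<^sup>2 \<partial>product_law n P) = n * (\<integral>x. (f x)\<^sup>2 \<partial>P)"
proof -
  interpret P: prob_space P by fact
  interpret product_sigma_finite "\<lambda>_::nat. P" by (rule product_sigma_finite.intro) (rule P.sigma_finite_measure_axioms)
  \<comment> \<open>Writes \<open>f (x i) * f (x j)\<close> as a product over all coordinates, with
    factor 1 where nothing happens; for \<open>i = j\<close> both conditions hit the same coordinate
    and produce the square.\<close>
  define \<phi> where "\<phi> i j k y = (if k = i then f y else 1) * (if k = j then f y else 1)" for i j k :: nat and y
  have fI: "integrable P f" by (rule L2_integrable[OF P.finite_measure_axioms f])
  have \<phi>i: "integrable P (\<phi> i j k)" for i j k
    using fI L2D(2)[OF f] by (cases "k = i"; cases "k = j") (simp_all add: \<phi>_def[abs_def] power2_eq_square)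
  have \<phi>p: "(\<Prod>k<n. \<phi> i j k (x k)) = f (x i) * f (x j)" if "i < n" "j < n" for i j and x :: "nat \<Rightarrow> 'a"
    using that by (simp add: \<phi>_def prod.distrib prod.delta)
  have pi: "integrable (product_law n P) (\<lambda>x. f (x i) * f (x j))" if "i < n" "j < n" for i j
    using product_integrable_prod[of "{..<n}" "\<phi> i j"] \<phi>i \<phi>p[OF that] by (simp add: product_law_def)
  have pv: "(\<integral>x. f (x i) * f (x j) \<partial>product_law n P) = (if i = j then \<integral>x. (f x)\<^sup>2 \<partial>P else 0)" if "i < n" "j < n" for i j
  proof -
    have "(\<integral>x. f (x i) * f (x j) \<partial>product_law n P) = (\<Prod>k<n. \<integral>x. \<phi> i j k x \<partial>P)"
      using product_integral_prod[of "{..<n}" "\<phi> i j"] \<phi>i \<phi>p[OF that] by (simp add: product_law_def)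
    also have "\<dots> = (if i = j then \<integral>x. (f x)\<^sup>2 \<partial>P else 0)"
    proof (cases "i = j")
      case True
      have "(\<integral>x. \<phi> i j k x \<partial>P) = (if k = i then \<integral>x. (f x)\<^sup>2 \<partial>P else 1)" for k
        using True by (simp add: \<phi>_def power2_eq_square P.prob_space)
      then show ?thesis using True that by (simp add: prod.delta)
    next
      case False
      have "(\<integral>x. \<phi> i j i x \<partial>P) = 0" using False f0 by (simp add: \<phi>_def)
      then show ?thesis using False that by (auto intro!: prod_zero)
    qed
    finally show ?thesis .
  qed
  have sq: "(\<Sum>i<n. f (x i))\<^sup>2 = (\<Sum>i<n. \<Sum>j<n. f (x i) * f (x j))" for x :: "nat \<Rightarrow> 'a"
    by (simp add: power2_eq_square sum_product)
  show "integrable (product_law n P) (\<lambda>x. (\<Sum>i<n. f (x i))\<^sup>2)"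
    unfolding sq by (intro Bochner_Integration.integrable_sum pi) auto
  have "(\<integral>x. (\<Sum>i<n. f (x i))\<^sup>2 \<partial>product_law n P) = (\<Sum>i<n. \<integral>x. (\<Sum>j<n. f (x i) * f (x j)) \<partial>product_law n P)"
    unfolding sq by (rule Bochner_Integration.integral_sum) (auto intro!: Bochner_Integration.integrable_sum pi)
  also have "\<dots> = (\<Sum>i<n. \<Sum>j<n. \<integral>x. f (x i) * f (x j) \<partial>product_law n P)"
    by (intro sum.cong refl Bochner_Integration.integral_sum) (auto intro!: pi)
  also have "\<dots> = (\<Sum>i<n. \<Sum>j<n. (if i = j then \<integral>x. (f x)\<^sup>2 \<partial>P else 0))"
    by (intro sum.cong refl pv) auto
  also have "\<dots> = n * (\<integral>x. (f x)\<^sup>2 \<partial>P)" by simp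
  finally show "(\<integral>x. (\<Sum>i<n. f (x i))\<^sup>2 \<partial>product_law n P) = n * (\<integral>x. (f x)\<^sup>2 \<partial>P)" .
qed

text \<open>The Chebyshev inequality for a triangular array: the summand and its normalization may
  both vary with \<open>n\<close>.\<close>

lemma product_law_weak_law:
  fixes f :: "nat \<Rightarrow> 'a \<Rightarrow> real" and c :: "nat \<Rightarrow> real"
  assumes P: "prob_space P" and f: "\<And>n. f n \<in> L2 P" and f0: "\<And>n. (\<integral>x. f n x \<partial>P) = 0"
    and lim: "(\<lambda>n. n * (c n)\<^sup>2 * (\<integral>x. (f n x)\<^sup>2 \<partial>P)) \<longlonglongrightarrow> 0" and \<epsilon>: "(0::real) < \<epsilon>"
  shows "(\<lambda>n. measure (product_law n P) {x \<in> space (product_law n P). \<bar>c n * (\<Sum>i<n. f n (x i))\<bar> > \<epsilon>}) \<longlonglongrightarrow> 0"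
proof (rule tendsto_sandwich[OF _ _ tendsto_const])
  show "(\<lambda>n. n * (c n)\<^sup>2 * (\<integral>x. (f n x)\<^sup>2 \<partial>P) / \<epsilon>\<^sup>2) \<longlonglongrightarrow> 0"
    using tendsto_divide[OF lim tendsto_const[of "\<epsilon>\<^sup>2"]] \<epsilon> by simp
  show "\<forall>\<^sub>F n in sequentially. measure (product_law n P) {x \<in> space (product_law n P). \<bar>c n * (\<Sum>i<n. f n (x i))\<bar> > \<epsilon>}
      \<le> n * (c n)\<^sup>2 * (\<integral>x. (f n x)\<^sup>2 \<partial>P) / \<epsilon>\<^sup>2"
  proof (rule always_eventually, rule allI)
    fix n
    interpret Pn: prob_space "product_law n P" by (rule prob_space_product_law[OF P])
    note [measurable] = L2D(1)[OF f]
    have m[measurable]: "(\<lambda>x. \<Sum>i<n. f n (x i)) \<in> borel_measurable (product_law n P)"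
      unfolding product_law_def by measurable
    have "measure (product_law n P) {x \<in> space (product_law n P). \<bar>c n * (\<Sum>i<n. f n (x i))\<bar> > \<epsilon>}
        \<le> measure (product_law n P) {x \<in> space (product_law n P). \<bar>c n * (\<Sum>i<n. f n (x i))\<bar> \<ge> \<epsilon>}"
      by (intro Pn.finite_measure_mono) (auto simp: less_imp_le)
    also have "\<dots> \<le> (\<integral>x. (c n * (\<Sum>i<n. f n (x i)))\<^sup>2 \<partial>product_law n P) / \<epsilon>\<^sup>2"
      by (rule Pn.second_moment_method) (use \<epsilon> product_law_second_moment(1)[OF P f f0] in \<open>auto simp: power_mult_distrib\<close>)
    also have "\<dots> = n * (c n)\<^sup>2 * (\<integral>x. (f n x)\<^sup>2 \<partial>P) / \<epsilon>\<^sup>2"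
      by (simp add: power_mult_distrib product_law_second_moment(2)[OF P f f0])
    finally show "measure (product_law n P) {x \<in> space (product_law n P). \<bar>c n * (\<Sum>i<n. f n (x i))\<bar> > \<epsilon>}
      \<le> n * (c n)\<^sup>2 * (\<integral>x. (f n x)\<^sup>2 \<partial>P) / \<epsilon>\<^sup>2" .
  qed
qed auto

text \<open>The likelihood ratio of the reference density \<open>(1 + X) p0\<close> is bounded in \<open>L\<^sub>2\<close> under the
  product law of \<open>p0\<close>, so that its mass 1 is not lost on an event \<open>B\<close> of small probability; off \<open>B\<close> it is
  dominated by the likelihood ratio of \<open>q\<close> up to the factor \<open>exp (2 * \<delta>)\<close>. This keeps the product
  affinity away from 0, and close to 1 when \<open>B\<close> and \<open>\<delta>\<close> are small.\<close>

lemma affinity_power_ge: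
  fixes X :: "'a \<Rightarrow> real"
  assumes p0: "is_density M p0" and q: "is_density M q"
    and X[measurable]: "X \<in> borel_measurable M" and Xb: "\<And>x. \<bar>X x\<bar> \<le> 1/2" and X0: "(\<integral>x. X x \<partial>law M p0) = 0"
    and B[measurable]: "B \<in> sets (\<Pi>\<^sub>M i\<in>{..<n}. M)"
    and off: "\<And>x. x \<in> space (\<Pi>\<^sub>M i\<in>{..<n}. M) \<Longrightarrow> x \<notin> B \<Longrightarrow>
       exp (- (2 * \<delta>)) * (\<Prod>i<n. 1 + X (x i)) \<le> (\<Prod>i<n. q (x i) / p0 (x i))"
  shows "exp (- \<delta>) * (1 - sqrt (measure (product_law n (law M p0)) B * exp (n * (\<integral>x. (X x)\<^sup>2 \<partial>law M p0))))
    \<le> (\<integral>x. sqrt (q x) * sqrt ((1 + X x) * p0 x) \<partial>M) ^ n"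
proof -
  note [measurable] = is_densityD(1)[OF p0] is_densityD(1)[OF q]
  interpret P: prob_space "law M p0" by (rule is_densityD[OF p0])
  interpret Pn: prob_space "product_law n (law M p0)" by (rule prob_space_product_law[OF P.prob_space_axioms])
  interpret PP: product_sigma_finite "\<lambda>_::nat. law M p0" by (rule product_sigma_finite.intro) (rule P.sigma_finite_measure_axioms)
  have P1: "measure (law M p0) (space M) = 1" using P.prob_space by simp
  let ?N = "\<Pi>\<^sub>M i\<in>{..<n}. M" and ?Pn = "product_law n (law M p0)"
  have X1: "1/2 \<le> 1 + X x" "1 + X x \<le> 3/2" for x using Xb[of x] by (auto simp: abs_le_iff)
  let ?R = "\<lambda>x. \<Prod>i<n. 1 + X (x i)"
  have Rm[measurable]: "?R \<in> borel_measurable ?N" by measurable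
  have R0: "0 < ?R x" for x using X1 by (intro prod_pos) (smt (verit) half_gt_zero_iff)
  \<comment> \<open>The integral of \<open>\<phi>\<close> under \<open>p0\<close> is the affinity of
    \<open>q\<close> with \<open>(1 + X) * p0\<close>. A part of \<open>q\<close> living where
    \<open>p0\<close> vanishes contributes nothing, because the second density vanishes there
    too.\<close>
  define \<phi> where "\<phi> x = sqrt (q x / p0 x * (1 + X x))" for x
  have \<phi>m[measurable]: "\<phi> \<in> borel_measurable M" unfolding \<phi>_def by measurable
  have \<phi>eq: "p0 x *\<^sub>R \<phi> x = sqrt (q x) * sqrt ((1 + X x) * p0 x)" if "x \<in> space M" for x
  proof (cases "p0 x = 0")
    case False
    then have "p0 x > 0" using is_densityD(2)[OF p0 that] by simp
    then have "p0 x *\<^sub>R \<phi> x = sqrt ((p0 x)\<^sup>2 * (q x / p0 x * (1 + X x)))"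
      unfolding \<phi>_def real_sqrt_mult by simp
    also have "(p0 x)\<^sup>2 * (q x / p0 x * (1 + X x)) = q x * ((1 + X x) * p0 x)"
      using False by (simp add: power2_eq_square)
    finally show ?thesis unfolding real_sqrt_mult .
  qed simp
  have XI: "integrable (law M p0) X" by (rule P.integrable_const_bound[where B="1/2"]) (use Xb in auto)
  have X2b: "(X x)\<^sup>2 \<le> 1" for x using power_mono[of "\<bar>X x\<bar>" "1" 2] Xb[of x] by simp
  have X2I: "integrable (law M p0) (\<lambda>x. (X x)\<^sup>2)" by (rule P.integrable_const_bound[where B="1"]) (use X2b in auto)
  have X1I: "integrable (law M p0) (\<lambda>x. 1 + X x)" using XI by simp
  have rI: "integrable M (\<lambda>x. (1 + X x) * p0 x)"
    using X1I by (subst (asm) integrable_law[OF p0]) (auto simp: mult.commute)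
  have rL2: "(\<lambda>x. sqrt ((1 + X x) * p0 x)) \<in> L2 M"
  proof -
    have "integrable M (\<lambda>x. (sqrt ((1 + X x) * p0 x))\<^sup>2) \<longleftrightarrow> integrable M (\<lambda>x. (1 + X x) * p0 x)"
      using is_densityD(2)[OF p0] X1 by (intro Bochner_Integration.integrable_cong refl real_sqrt_pow2 mult_nonneg_nonneg) (auto intro: order_trans[of 0 "1/2"])
    then show ?thesis using rI by (simp add: L2_def)
  qed
  have \<phi>I: "integrable (law M p0) \<phi>"
    unfolding integrable_law[OF p0 \<phi>m]
    using L2_integrable_mult[OF is_densityD(6)[OF q] rL2] \<phi>eq by (simp cong: Bochner_Integration.integrable_cong)
  have \<phi>int: "(\<integral>x. \<phi> x \<partial>law M p0) = (\<integral>x. sqrt (q x) * sqrt ((1 + X x) * p0 x) \<partial>M)"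
    unfolding integral_law[OF p0 \<phi>m] by (rule Bochner_Integration.integral_cong) (simp_all only: \<phi>eq)
  have RI: "integrable ?Pn ?R" "(\<integral>x. ?R x \<partial>?Pn) = 1"
    using PP.product_integrable_prod[of "{..<n}" "\<lambda>_ x. 1 + X x"] PP.product_integral_prod[of "{..<n}" "\<lambda>_ x. 1 + X x"] X1I XI X0
    by (simp_all add: product_law_def P1)
  have sqI: "integrable (law M p0) (\<lambda>x. (1 + X x)\<^sup>2)" and sqv: "(\<integral>x. (1 + X x)\<^sup>2 \<partial>law M p0) = 1 + (\<integral>x. (X x)\<^sup>2 \<partial>law M p0)"
    using XI X2I X0 by (simp_all add: power2_sum P1)
  have R2I: "integrable ?Pn (\<lambda>x. (?R x)\<^sup>2)" and R2v: "(\<integral>x. (?R x)\<^sup>2 \<partial>?Pn) = (1 + (\<integral>x. (X x)\<^sup>2 \<partial>law M p0)) ^ n"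
    using PP.product_integrable_prod[of "{..<n}" "\<lambda>_ x. (1 + X x)\<^sup>2"] PP.product_integral_prod[of "{..<n}" "\<lambda>_ x. (1 + X x)\<^sup>2"] sqI sqv
    by (simp_all add: product_law_def prod_power_distrib)
  have BI: "integrable ?Pn (indicator B :: _ \<Rightarrow> real)"
    by (rule Pn.integrable_const_bound[where B=1]) (auto simp: indicator_def)
  have RL2: "?R \<in> L2 ?Pn" using R2I by (simp add: L2_def)
  have BL2: "(indicator B :: _ \<Rightarrow> real) \<in> L2 ?Pn"
    unfolding L2_def by (auto intro!: Pn.integrable_const_bound[where B=1] simp: indicator_def)
  have "(\<integral>x. indicator B x * ?R x \<partial>?Pn) \<le> sqrt ((\<integral>x. (indicator B x)\<^sup>2 \<partial>?Pn) * (\<integral>x. (?R x)\<^sup>2 \<partial>?Pn))"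
    by (intro real_le_rsqrt L2_Cauchy_Schwarz BL2 RL2)
  also have "(\<integral>x. (indicator B x)\<^sup>2 \<partial>?Pn) = measure ?Pn B"
  proof -
    have "(\<integral>x. (indicator B x :: real)\<^sup>2 \<partial>?Pn) = (\<integral>x. indicator B x \<partial>?Pn)"
      by (intro Bochner_Integration.integral_cong) (auto simp: indicator_def)
    then show ?thesis by (simp add: Int_absorb1 sets.sets_into_space[OF B])
  qed
  also have "(\<integral>x. (?R x)\<^sup>2 \<partial>?Pn) = (1 + (\<integral>x. (X x)\<^sup>2 \<partial>law M p0)) ^ n" by (rule R2v)
  also have "sqrt (measure ?Pn B * (1 + (\<integral>x. (X x)\<^sup>2 \<partial>law M p0)) ^ n) \<le> sqrt (measure ?Pn B * exp (n * (\<integral>x. (X x)\<^sup>2 \<partial>law M p0)))"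
  proof -
    have "(1 + (\<integral>x. (X x)\<^sup>2 \<partial>law M p0)) ^ n \<le> exp (\<integral>x. (X x)\<^sup>2 \<partial>law M p0) ^ n"
      by (intro power_mono exp_ge_add_one_self add_nonneg_nonneg integral_nonneg_AE) auto
    then show ?thesis by (simp add: exp_of_nat_mult mult_left_mono)
  qed
  finally have mass: "(\<integral>x. indicator B x * ?R x \<partial>?Pn) \<le> sqrt (measure ?Pn B * exp (n * (\<integral>x. (X x)\<^sup>2 \<partial>law M p0)))" .
  \<comment> \<open>On \<open>B\<close> the left side is 0. Off \<open>B\<close> the product of the
    \<open>\<phi>\<close> is the root of the likelihood ratio times \<open>?R x\<close>, and
    replacing the ratio by its lower bound leaves \<open>exp (- \<delta>) * ?R x\<close>.\<close>
  have \<phi>R: "exp (- \<delta>) * (?R x - indicator B x * ?R x) \<le> (\<Prod>i<n. \<phi> (x i))" if x: "x \<in> space ?N" for x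
  proof -
    have xi: "x i \<in> space M" if "i < n" for i using x that by (auto simp: space_PiM PiE_iff)
    have nn: "0 \<le> \<phi> (x i)" if "i < n" for i
      unfolding \<phi>_def using is_densityD(2)[OF p0 xi[OF that]] is_densityD(2)[OF q xi[OF that]] X1[of "x i"] by simp
    show ?thesis
    proof (cases "x \<in> B")
      case True
      then show ?thesis using nn by (auto intro!: prod_nonneg)
    next
      case False
      have "(\<Prod>i<n. \<phi> (x i)) = sqrt ((\<Prod>i<n. q (x i) / p0 (x i)) * ?R x)"
      proof -
        have "(\<Prod>i<n. sqrt (f i)) = sqrt (\<Prod>i<n. f i)" for f :: "nat \<Rightarrow> real"
          by (induction n) (auto simp: real_sqrt_mult)
        then show ?thesis by (simp only: \<phi>_def prod.distrib)
      qed
      moreover have "(exp (- \<delta>) * ?R x)\<^sup>2 \<le> (\<Prod>i<n. q (x i) / p0 (x i)) * ?R x"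
      proof -
        have "(exp (- \<delta>) * ?R x)\<^sup>2 = (exp (- (2 * \<delta>)) * ?R x) * ?R x"
          by (simp add: power2_eq_square mult_ac flip: exp_add)
        also have "\<dots> \<le> (\<Prod>i<n. q (x i) / p0 (x i)) * ?R x"
          using R0[of x] by (intro mult_right_mono off x False) auto
        finally show ?thesis .
      qed
      ultimately have "exp (- \<delta>) * ?R x \<le> (\<Prod>i<n. \<phi> (x i))" by (simp add: real_le_rsqrt)
      then show ?thesis using False by simp
    qed
  qed
  have IR: "integrable ?Pn (\<lambda>x. indicator B x * ?R x)"
    using L2_integrable_mult[OF BL2 RL2] .
  have "exp (- \<delta>) * (1 - (\<integral>x. indicator B x * ?R x \<partial>?Pn)) = (\<integral>x. exp (- \<delta>) * (?R x - indicator B x * ?R x) \<partial>?Pn)"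
    using RI IR by simp
  also have "\<dots> \<le> (\<integral>x. (\<Prod>i<n. \<phi> (x i)) \<partial>?Pn)"
  proof (rule integral_mono)
    show "integrable ?Pn (\<lambda>x. \<Prod>i<n. \<phi> (x i))"
      using PP.product_integrable_prod[of "{..<n}" "\<lambda>_. \<phi>"] \<phi>I by (simp add: product_law_def)
  qed (use RI IR \<phi>R in auto)
  also have "\<dots> = (\<integral>x. sqrt (q x) * sqrt ((1 + X x) * p0 x) \<partial>M) ^ n"
    using PP.product_integral_prod[of "{..<n}" "\<lambda>_. \<phi>"] \<phi>I by (simp add: product_law_def \<phi>int)
  finally have "exp (- \<delta>) * (1 - (\<integral>x. indicator B x * ?R x \<partial>?Pn)) \<le> (\<integral>x. sqrt (q x) * sqrt ((1 + X x) * p0 x) \<partial>M) ^ n" .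
  moreover have "exp (- \<delta>) * (1 - sqrt (measure ?Pn B * exp (n * (\<integral>x. (X x)\<^sup>2 \<partial>law M p0)))) \<le> exp (- \<delta>) * (1 - (\<integral>x. indicator B x * ?R x \<partial>?Pn))"
    using mass by (intro mult_left_mono) auto
  ultimately show ?thesis by linarith
qed

lemma L2_lim_of_rate:
  fixes f :: "nat \<Rightarrow> 'a \<Rightarrow> real"
  assumes f: "\<And>n. f n \<in> L2 M" and u: "u \<in> L2 M" and d: "L2_lim M (\<lambda>n x. sqrt n * (f n x - u x)) w"
  shows "L2_lim M f u"
  unfolding L2_lim_def
proof (intro conjI allI f u)
  have "(\<lambda>n. (\<integral>x. (sqrt n * (f n x - u x))\<^sup>2 \<partial>M) / n) \<longlonglongrightarrow> 0"
    by (rule real_tendsto_divide_at_top[OF L2_lim_integral_square[OF d] filterlim_real_sequentially])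
  moreover have "\<forall>\<^sub>F n in sequentially. (\<integral>x. (sqrt n * (f n x - u x))\<^sup>2 \<partial>M) / n = (\<integral>x. (f n x - u x)\<^sup>2 \<partial>M)"
    using eventually_gt_at_top[of 0] by eventually_elim (simp add: power_mult_distrib)
  ultimately show "(\<lambda>n. \<integral>x. (f n x - u x)\<^sup>2 \<partial>M) \<longlonglongrightarrow> 0"
    by (rule Lim_transform_eventually)
qed

lemma hellinger_eq_affinity:
  assumes p: "is_density M p" and q: "is_density M q"
  shows "(\<integral>x. (sqrt (q x) - sqrt (p x))\<^sup>2 \<partial>M) = 2 - 2 * (\<integral>x. sqrt (q x) * sqrt (p x) \<partial>M)"
proof -
  have "(\<integral>x. (sqrt (q x) - sqrt (p x))\<^sup>2 \<partial>M) = (\<integral>x. q x + p x - 2 * (sqrt (q x) * sqrt (p x)) \<partial>M)"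
    using is_densityD(2)[OF p] is_densityD(2)[OF q]
    by (intro Bochner_Integration.integral_cong) (auto simp: power2_diff)
  then show ?thesis
    using is_densityD(4,5)[OF p] is_densityD(4,5)[OF q] L2_integrable_mult[OF is_densityD(6)[OF q] is_densityD(6)[OF p]] by simp
qed

lemma is_density_perturb:
  fixes X :: "'a \<Rightarrow> real"
  assumes p0: "is_density M p0" and X: "X \<in> borel_measurable M" "\<And>x. \<bar>X x\<bar> \<le> 1/2" "(\<integral>x. X x \<partial>law M p0) = 0"
  shows "is_density M (\<lambda>x. (1 + X x) * p0 x)"
  unfolding is_density_def
proof (intro conjI ballI)
  note [measurable] = is_densityD(1)[OF p0] X(1)
  interpret P: prob_space "law M p0" by (rule is_densityD[OF p0])
  have P1: "measure (law M p0) (space M) = 1" using P.prob_space by simp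
  have X1: "0 \<le> 1 + X x" for x using X(2)[of x] by (auto simp: abs_le_iff)
  show "(\<lambda>x. (1 + X x) * p0 x) \<in> borel_measurable M" by measurable
  show nn: "0 \<le> (1 + X x) * p0 x" if "x \<in> space M" for x using X1 is_densityD(2)[OF p0 that] by simp
  have XI: "integrable (law M p0) X" by (rule P.integrable_const_bound[where B="1/2"]) (use X in auto)
  then have i: "integrable (law M p0) (\<lambda>x. 1 + X x)" by simp
  have "integrable M (\<lambda>x. (1 + X x) * p0 x)"
    using i by (subst (asm) integrable_law[OF p0]) (auto simp: mult.commute)
  then have "(\<integral>\<^sup>+x. ennreal ((1 + X x) * p0 x) \<partial>M) = ennreal (\<integral>x. (1 + X x) * p0 x \<partial>M)"
    using nn by (intro nn_integral_eq_integral) (auto intro: AE_I2)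
  also have "(\<integral>x. (1 + X x) * p0 x \<partial>M) = (\<integral>x. 1 + X x \<partial>law M p0)"
    by (subst integral_law[OF p0]) (auto simp: mult.commute)
  also have "\<dots> = 1" using XI X(3) by (simp add: P1)
  finally show "(\<integral>\<^sup>+x. ennreal ((1 + X x) * p0 x) \<partial>M) = 1" by simp
qed

text \<open>A deterministic inequality, valid at every sample point where the two averages are
  small. The sum of cubes is at most the largest term times the sum of squares, and the latter is
  close to \<open>m\<close>.\<close>

lemma log_product_expansion:
  fixes y z :: "nat \<Rightarrow> real"
  assumes n: "256 \<le> n" and y: "\<And>i. i < n \<Longrightarrow> \<bar>y i\<bar> \<le> 2 * sqrt (sqrt n)"
    and U: "\<bar>(1 / sqrt n) * (\<Sum>i<n. y i - z i)\<bar> \<le> \<delta> / 4" and V: "\<bar>(1 / n) * (\<Sum>i<n. (y i)\<^sup>2 - m)\<bar> \<le> \<delta> / 8"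
    and m: "0 \<le> m" "m \<le> v" "4 * v / sqrt (sqrt n) + \<bar>m - v\<bar> / 2 \<le> \<delta> / 2"
  shows "\<bar>(\<Sum>i<n. ln (1 + y i / sqrt n)) - ((1 / sqrt n) * (\<Sum>i<n. z i) - v / 2)\<bar> \<le> \<delta>"
proof -
  define K where "K = sqrt (sqrt n)"
  have K2: "K * K = sqrt n" by (simp add: K_def)
  \<comment> \<open>256 is the fourth power of 4: then \<open>K \<ge> 4\<close>, so that
    \<open>2 / K \<le> 1/2\<close> as the expansion of the logarithm asks, and
    \<open>4 / K \<le> 1\<close>.\<close>
  have "sqrt (real n) \<ge> sqrt (16\<^sup>2)" using n by (intro real_sqrt_le_mono) simp
  then have "sqrt (real n) \<ge> 16" by simp
  then have "sqrt (sqrt (real n)) \<ge> sqrt (4\<^sup>2)" by (intro real_sqrt_le_mono) simp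
  then have K4: "K \<ge> 4" by (simp add: K_def)
  define x where "x i = y i / sqrt n" for i
  have xb: "\<bar>x i\<bar> \<le> 2 / K" if "i < n" for i
  proof -
    have "\<bar>x i\<bar> = \<bar>y i\<bar> / (K * K)" by (simp add: x_def K2)
    also have "\<dots> \<le> 2 * K / (K * K)" using y[OF that] K4 by (intro divide_right_mono) (auto simp: K_def)
    also have "\<dots> = 2 / K" using K4 by simp
    finally show ?thesis .
  qed
  have K2': "2 / K \<le> 1/2" using K4 by (simp add: divide_le_eq)
  define V' U' where "V' = (1 / n) * (\<Sum>i<n. (y i)\<^sup>2 - m)" and "U' = (1 / sqrt n) * (\<Sum>i<n. y i - z i)"
  have x2: "(\<Sum>i<n. (x i)\<^sup>2) = V' + m"
  proof -
    have "(\<Sum>i<n. (x i)\<^sup>2) = (1 / n) * (\<Sum>i<n. (y i)\<^sup>2)" by (simp add: x_def power_divide sum_divide_distrib)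
    then show ?thesis using n by (simp add: V'_def sum_subtractf right_diff_distrib)
  qed
  have x1: "(\<Sum>i<n. x i) = U' + (1 / sqrt n) * (\<Sum>i<n. z i)"
    by (simp add: U'_def x_def sum_subtractf right_diff_distrib sum_divide_distrib)
  let ?E = "\<Sum>i<n. ln (1 + x i) - x i + (x i)\<^sup>2 / 2"
  have "\<bar>?E\<bar> \<le> (\<Sum>i<n. \<bar>ln (1 + x i) - x i + (x i)\<^sup>2 / 2\<bar>)" by (rule sum_abs)
  also have "\<dots> \<le> (\<Sum>i<n. 4 / K * (x i)\<^sup>2)"
  proof (rule sum_mono)
    fix i assume "i \<in> {..<n}"
    then have b: "\<bar>x i\<bar> \<le> 2 / K" using xb by simp
    have "\<bar>ln (1 + x i) - x i + (x i)\<^sup>2 / 2\<bar> \<le> 2 * \<bar>x i\<bar> ^ 3"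
      using b K2' by (intro ln_one_plus_third_order) linarith
    also have "\<dots> = 2 * \<bar>x i\<bar> * (x i)\<^sup>2" by (simp add: power3_eq_cube power2_eq_square)
    also have "\<dots> \<le> 4 / K * (x i)\<^sup>2" using b by (intro mult_right_mono) auto
    finally show "\<bar>ln (1 + x i) - x i + (x i)\<^sup>2 / 2\<bar> \<le> 4 / K * (x i)\<^sup>2" .
  qed
  also have "\<dots> = 4 / K * (V' + m)" by (simp add: x2[symmetric] sum_distrib_left)
  also have "\<dots> \<le> \<bar>V'\<bar> + 4 * v / K"
  proof -
    have "4 / K * V' \<le> 4 / K * \<bar>V'\<bar>" using K4 by (intro mult_left_mono) auto
    also have "\<dots> \<le> 1 * \<bar>V'\<bar>" using K4 by (intro mult_right_mono) (auto simp: divide_le_eq)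
    finally have "4 / K * V' \<le> \<bar>V'\<bar>" by simp
    moreover have "4 / K * m \<le> 4 / K * v" using K4 m by (intro mult_left_mono) auto
    ultimately show ?thesis by (simp add: distrib_left)
  qed
  finally have E: "\<bar>?E\<bar> \<le> \<bar>V'\<bar> + 4 * v / K" .
  have "?E = (\<Sum>i<n. ln (1 + x i)) - (\<Sum>i<n. x i) + (\<Sum>i<n. (x i)\<^sup>2) / 2"
    by (simp add: sum.distrib sum_subtractf sum_divide_distrib)
  moreover have "t - (w - v / 2) = e + U' - V' / 2 - m / 2 + v / 2" if "e = t - a + b / 2" "a = U' + w" "b = V' + m" for e t a b w
    using that by (simp add: field_simps)
  ultimately have eq: "(\<Sum>i<n. ln (1 + x i)) - ((1 / sqrt n) * (\<Sum>i<n. z i) - v / 2) = ?E + U' - V' / 2 - m / 2 + v / 2"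
    using x1 x2 by blast
  have UV: "\<bar>U'\<bar> \<le> \<delta> / 4" "\<bar>V'\<bar> \<le> \<delta> / 8" using U V by (simp_all add: U'_def V'_def)
  have mK: "4 * v / K + (v / 2 - m / 2) \<le> \<delta> / 2"
    using m(3) abs_of_nonpos[of "m - v"] m(2) by (simp add: K_def diff_divide_distrib)
  \<comment> \<open>The budget: \<delta>/4 from \<open>U'\<close>, three halves of \<delta>/8 from
    \<open>V'\<close>, which enters both the remainder and the quadratic term, and \<delta>/2 from
    the deterministic terms.\<close>
  have "\<bar>a\<bar> \<le> \<delta>" if "a = e + U' - V' / 2 - m / 2 + v / 2" "\<bar>e\<bar> \<le> \<bar>V'\<bar> + 4 * v / K" for a e
    using that UV mK m(2) by linarith
  from this[OF eq E] show ?thesis unfolding x_def .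
qed

text \<open>The logarithms of the likelihood ratios of \<open>q n\<close> and of the truncated path
  have the same expansion, so on events of probability tending to 1 the ratios agree up to a factor
  near 1. The lower bound on the affinity converts this into a Hellinger distance of smaller order
  than that of the path from \<open>p0\<close>. The path itself is explicit enough for its mean
  square expansion to be computed.\<close>

theorem lan_imp_differentiable_in_quadratic_mean:
  fixes q :: "nat \<Rightarrow> 'a \<Rightarrow> real"
  assumes p0: "is_density M p0" and q: "\<And>n. is_density M (q n)"
    and g: "g \<in> L2 (law M p0)" and g0: "(\<integral>x. g x \<partial>law M p0) = 0"
    and lan: "negligible_in_probability (\<lambda>n. product_law n (law M p0))
         (\<lambda>n x. \<bar>log_likelihood_ratio n (q n) p0 x - ereal (normalized_sum n g x - (1/2) * (\<integral>y. (g y)\<^sup>2 \<partial>law M p0))\<bar>)"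
  shows "L2_lim M (\<lambda>n x. sqrt n * (sqrt (q n x) - sqrt (p0 x))) (\<lambda>x. g x / 2 * sqrt (p0 x))"
proof -
  interpret P: prob_space "law M p0" by (rule is_densityD[OF p0])
  interpret Pn: prob_space "product_law n (law M p0)" for n by (rule prob_space_product_law[OF P.prob_space_axioms])
  have gm[measurable]: "g \<in> borel_measurable M" using L2D(1)[OF g] by (simp add: law_def)
  note [measurable] = is_densityD(1)[OF p0] is_densityD(1)[OF q]

  \<comment> \<open>The truncated reference path\<close>
  define K where "K n = sqrt (sqrt (real n))" for n
  have Klim: "filterlim K at_top sequentially"
    unfolding K_def by (intro filterlim_compose[OF sqrt_at_top] filterlim_real_sequentially)
  have K0: "0 \<le> K n" for n by (simp add: K_def)
  obtain G where Gm: "\<And>n. G n \<in> borel_measurable (law M p0)" and Gb: "\<And>n x. \<bar>G n x\<bar> \<le> 2 * K n"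
    and G0: "\<And>n. (\<integral>x. G n x \<partial>law M p0) = 0" and G2: "\<And>n. (\<integral>x. (G n x)\<^sup>2 \<partial>law M p0) \<le> (\<integral>x. (g x)\<^sup>2 \<partial>law M p0)"
    and Glim: "L2_lim (law M p0) G g"
    using truncation[OF P.prob_space_axioms g g0 Klim K0] by metis
  have Gm'[measurable]: "G n \<in> borel_measurable M" for n using Gm[of n] by (simp add: law_def)
  define v where "v = (\<integral>x. (g x)\<^sup>2 \<partial>law M p0)"
  define m where "m n = (\<integral>x. (G n x)\<^sup>2 \<partial>law M p0)" for n
  have mlim: "m \<longlonglongrightarrow> v" unfolding m_def v_def by (rule L2_lim_integral_square[OF Glim])
  have mv: "0 \<le> m n" "m n \<le> v" for n using G2[of n] by (auto simp: m_def v_def)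
  have GL2: "G n \<in> L2 (law M p0)" for n by (rule L2_limD(1)[OF Glim])
  have GI: "integrable (law M p0) (G n)" for n by (rule L2_integrable[OF P.finite_measure_axioms GL2])
  define X where "X n x = G n x / sqrt n" for n x
  have Xm[measurable]: "X n \<in> borel_measurable M" for n unfolding X_def by measurable
  have X0: "(\<integral>x. X n x \<partial>law M p0) = 0" for n by (simp add: X_def G0)
  have K4: "4 \<le> K n" if "256 \<le> n" for n
  proof -
    have "sqrt (real n) \<ge> sqrt (16\<^sup>2)" using that by (intro real_sqrt_le_mono) simp
    then have "sqrt (sqrt (real n)) \<ge> sqrt (4\<^sup>2)" by (intro real_sqrt_le_mono) simp
    then show ?thesis by (simp add: K_def)
  qed
  have KK: "K n * K n = sqrt n" for n by (simp add: K_def)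
  have Xb: "\<bar>X n x\<bar> \<le> 1/2" if "256 \<le> n" for n x
  proof -
    have "\<bar>X n x\<bar> = \<bar>G n x\<bar> / (K n * K n)" by (simp add: X_def KK)
    also have "\<dots> \<le> 2 * K n / (K n * K n)" using Gb by (intro divide_right_mono) auto
    also have "\<dots> = 2 / K n" using K4[OF that] by simp
    also have "\<dots> \<le> 1/2" using K4[OF that] by (simp add: divide_le_eq)
    finally show ?thesis .
  qed
  define r where "r n x = (1 + X n x) * p0 x" for n x
  have rd: "is_density M (r n)" if "256 \<le> n" for n
    unfolding r_def by (rule is_density_perturb[OF p0 Xm Xb[OF that] X0])

  \<comment> \<open>Laws of large numbers for the truncation error and for the squares\<close>
  define U where "U n x = (1 / sqrt n) * (\<Sum>i<n. G n (x i) - g (x i))" for n and x :: "nat \<Rightarrow> 'a"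
  define V where "V n x = (1 / n) * (\<Sum>i<n. (G n (x i))\<^sup>2 - m n)" for n and x :: "nat \<Rightarrow> 'a"
  have Um[measurable]: "U n \<in> borel_measurable (\<Pi>\<^sub>M i\<in>{..<n}. M)" and Vm[measurable]: "V n \<in> borel_measurable (\<Pi>\<^sub>M i\<in>{..<n}. M)" for n
    unfolding U_def V_def by measurable
  have Ulim: "(\<lambda>n. measure (product_law n (law M p0)) {x \<in> space (product_law n (law M p0)). \<bar>U n x\<bar> > \<epsilon>}) \<longlonglongrightarrow> 0" if "\<epsilon> > 0" for \<epsilon>
    unfolding U_def
  proof (rule product_law_weak_law[where c="\<lambda>n. 1 / sqrt n" and f="\<lambda>n x. G n x - g x", OF P.prob_space_axioms _ _ _ that])
    show "(\<lambda>x. G n x - g x) \<in> L2 (law M p0)" for n by (rule L2_diff[OF GL2 g])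
    show "(\<integral>x. G n x - g x \<partial>law M p0) = 0" for n
      using GI L2_integrable[OF P.finite_measure_axioms g] by (simp add: G0 g0)
    have "\<forall>\<^sub>F n in sequentially. (\<integral>x. (G n x - g x)\<^sup>2 \<partial>law M p0) = n * (1 / sqrt n)\<^sup>2 * (\<integral>x. (G n x - g x)\<^sup>2 \<partial>law M p0)"
      using eventually_gt_at_top[of 0] by eventually_elim (simp add: power_divide)
    then show "(\<lambda>n. n * (1 / sqrt n)\<^sup>2 * (\<integral>x. (G n x - g x)\<^sup>2 \<partial>law M p0)) \<longlonglongrightarrow> 0"
      by (rule Lim_transform_eventually[OF L2_limD(3)[OF Glim]])
  qed
  \<comment> \<open>The choice of the truncation level pays here: fourth moments are at most
    \<open>4 * sqrt n\<close> times second moments, so the average of \<open>n\<close> squares has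
    variance of order \<open>1 / sqrt n\<close> although \<open>g\<close> has only two
    moments.\<close>
  have G4: "(G n x)\<^sup>2 \<le> 4 * sqrt n" for n x
    using power_mono[OF Gb[of n x], of 2] KK[of n] by (simp add: power2_eq_square)
  have G2I: "integrable (law M p0) (\<lambda>x. (G n x)\<^sup>2)" for n by (rule L2D(2)[OF GL2])
  have G4I: "integrable (law M p0) (\<lambda>x. ((G n x)\<^sup>2)\<^sup>2)" for n
  proof (rule P.integrable_const_bound[where B="(4 * sqrt n)\<^sup>2"])
    show "AE x in law M p0. norm (((G n x)\<^sup>2)\<^sup>2) \<le> (4 * sqrt n)\<^sup>2"
      unfolding real_norm_def abs_power2 by (intro AE_I2 power_mono G4) simp
  qed simp
  have Vlim: "(\<lambda>n. measure (product_law n (law M p0)) {x \<in> space (product_law n (law M p0)). \<bar>V n x\<bar> > \<epsilon>}) \<longlonglongrightarrow> 0" if "\<epsilon> > 0" for \<epsilon>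
    unfolding V_def
  proof (rule product_law_weak_law[where c="\<lambda>n. 1 / n" and f="\<lambda>n x. (G n x)\<^sup>2 - m n", OF P.prob_space_axioms _ _ _ that])
    show L: "(\<lambda>x. (G n x)\<^sup>2 - m n) \<in> L2 (law M p0)" for n
    proof (rule L2_diff)
      show "(\<lambda>x. (G n x)\<^sup>2) \<in> L2 (law M p0)"
        unfolding L2_def by (intro CollectI conjI G4I) measurable
      show "(\<lambda>x. m n) \<in> L2 (law M p0)" by (simp add: L2_def)
    qed
    show "(\<integral>x. (G n x)\<^sup>2 - m n \<partial>law M p0) = 0" for n
      using G2I P.prob_space by (simp add: m_def)
    show "(\<lambda>n. n * (1 / real n)\<^sup>2 * (\<integral>x. ((G n x)\<^sup>2 - m n)\<^sup>2 \<partial>law M p0)) \<longlonglongrightarrow> 0"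
    proof (rule tendsto_sandwich[OF _ _ tendsto_const])
      show "(\<lambda>n. 4 * v / sqrt n) \<longlonglongrightarrow> 0"
        by (rule real_tendsto_divide_at_top[OF tendsto_const filterlim_compose[OF sqrt_at_top filterlim_real_sequentially]])
      show "\<forall>\<^sub>F n in sequentially. n * (1 / real n)\<^sup>2 * (\<integral>x. ((G n x)\<^sup>2 - m n)\<^sup>2 \<partial>law M p0) \<le> 4 * v / sqrt n"
        using eventually_gt_at_top[of 0]
      proof eventually_elim
        case (elim n)
        have "(\<integral>x. ((G n x)\<^sup>2 - m n)\<^sup>2 \<partial>law M p0) \<le> (\<integral>x. ((G n x)\<^sup>2)\<^sup>2 \<partial>law M p0)"
          using P.variance_eq[OF G2I G4I, of n] by (simp add: m_def)
        also have "\<dots> \<le> (\<integral>x. 4 * sqrt n * (G n x)\<^sup>2 \<partial>law M p0)"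
        proof (intro integral_mono G4I integrable_mult_right G2I)
          show "((G n x)\<^sup>2)\<^sup>2 \<le> 4 * sqrt n * (G n x)\<^sup>2" for x
            unfolding power2_eq_square[of "(G n x)\<^sup>2"] by (intro mult_right_mono G4) simp
        qed
        also have "\<dots> = 4 * sqrt n * m n" by (simp add: m_def)
        also have "\<dots> \<le> 4 * sqrt n * v" using mv by (intro mult_left_mono) auto
        finally have "(1 / n) * (\<integral>x. ((G n x)\<^sup>2 - m n)\<^sup>2 \<partial>law M p0) \<le> (1 / n) * (4 * sqrt n * v)"
          by (intro mult_left_mono) auto
        also have "\<dots> = 4 * v / sqrt n" using elim by (simp add: field_simps)
        finally show ?case using elim by (simp add: power2_eq_square)
      qed
    qed (auto intro!: always_eventually)
  qed

  \<comment> \<open>Hellinger distance between the given densities and the path\<close>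
  have hell: "(\<lambda>n. n * (\<integral>x. (sqrt (q n x) - sqrt (r n x))\<^sup>2 \<partial>M)) \<longlonglongrightarrow> 0"
  proof (rule LIMSEQ_I)
    fix e :: real assume "e > 0"
    define \<delta> where "\<delta> = e / 8"
    have \<delta>: "\<delta> > 0" using \<open>e > 0\<close> by (simp add: \<delta>_def)
    define c where "c n x = normalized_sum n g x - (1/2) * v" for n x
    have cm[measurable]: "c n \<in> borel_measurable (\<Pi>\<^sub>M i\<in>{..<n}. M)" for n
      unfolding c_def normalized_sum_def by measurable
    have llm[measurable]: "log_likelihood_ratio n (q n) p0 \<in> borel_measurable (\<Pi>\<^sub>M i\<in>{..<n}. M)" for n
      unfolding log_likelihood_ratio_def Let_def by measurable
    define B1 where "B1 n = {x \<in> space (product_law n (law M p0)). \<bar>log_likelihood_ratio n (q n) p0 x - ereal (c n x)\<bar> > ereal \<delta>}" for n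
    define B2 where "B2 n = {x \<in> space (product_law n (law M p0)). \<bar>U n x\<bar> > \<delta> / 4}" for n
    define B3 where "B3 n = {x \<in> space (product_law n (law M p0)). \<bar>V n x\<bar> > \<delta> / 8}" for n
    have Bm[measurable]: "B1 n \<in> sets (\<Pi>\<^sub>M i\<in>{..<n}. M)" "B2 n \<in> sets (\<Pi>\<^sub>M i\<in>{..<n}. M)" "B3 n \<in> sets (\<Pi>\<^sub>M i\<in>{..<n}. M)" for n
      unfolding B1_def B2_def B3_def space_product_law_law by measurable
    define B where "B n = B1 n \<union> (B2 n \<union> B3 n)" for n
    have Bs[measurable]: "B n \<in> sets (\<Pi>\<^sub>M i\<in>{..<n}. M)" for n unfolding B_def by measurable
    have "(\<lambda>n. measure (product_law n (law M p0)) (B1 n) + (measure (product_law n (law M p0)) (B2 n) + measure (product_law n (law M p0)) (B3 n))) \<longlonglongrightarrow> 0 + (0 + 0)"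
    proof (intro tendsto_add)
      show "(\<lambda>n. measure (product_law n (law M p0)) (B1 n)) \<longlonglongrightarrow> 0"
        using lan \<delta> unfolding negligible_in_probability_def B1_def c_def v_def by blast
    qed (use Ulim[of "\<delta>/4"] Vlim[of "\<delta>/8"] \<delta> in \<open>simp_all add: B2_def B3_def\<close>)
    then have sum0: "(\<lambda>n. measure (product_law n (law M p0)) (B1 n) + (measure (product_law n (law M p0)) (B2 n) + measure (product_law n (law M p0)) (B3 n))) \<longlonglongrightarrow> 0"
      by simp
    have Blim: "(\<lambda>n. measure (product_law n (law M p0)) (B n)) \<longlonglongrightarrow> 0"
    proof (rule tendsto_sandwich[OF _ _ tendsto_const sum0])
      show "\<forall>\<^sub>F n in sequentially. measure (product_law n (law M p0)) (B n) \<le> measure (product_law n (law M p0)) (B1 n) + (measure (product_law n (law M p0)) (B2 n) + measure (product_law n (law M p0)) (B3 n))"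
        unfolding B_def by (intro always_eventually allI order_trans[OF measure_Un_le] add_left_mono measure_Un_le) auto
    qed simp
    have "(\<lambda>n. sqrt (measure (product_law n (law M p0)) (B n) * exp v)) \<longlonglongrightarrow> sqrt (0 * exp v)"
      by (intro tendsto_intros Blim)
    \<comment> \<open>This threshold makes the second factor of the affinity bound at least
      \<open>exp (- \<delta>)\<close>, as large as the first.\<close>
    then have "\<forall>\<^sub>F n in sequentially. sqrt (measure (product_law n (law M p0)) (B n) * exp v) < 1 - exp (- \<delta>)"
      using \<delta> by (intro order_tendstoD(2)) auto
    moreover have "(\<lambda>n. 4 * v / K n + \<bar>m n - v\<bar> / 2) \<longlonglongrightarrow> 0 + \<bar>v - v\<bar> / 2"
      by (intro tendsto_intros mlim real_tendsto_divide_at_top[OF tendsto_const Klim]) simp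
    then have "\<forall>\<^sub>F n in sequentially. 4 * v / K n + \<bar>m n - v\<bar> / 2 < \<delta> / 2"
      using \<delta> by (intro order_tendstoD(2)) auto
    ultimately have "\<forall>\<^sub>F n in sequentially. norm (n * (\<integral>x. (sqrt (q n x) - sqrt (r n x))\<^sup>2 \<partial>M) - 0) < e"
      using eventually_ge_at_top[of 256]
    proof eventually_elim
      case (elim n)
      define \<rho> where "\<rho> = (\<integral>x. sqrt (q n x) * sqrt ((1 + X n x) * p0 x) \<partial>M)"
      have "exp (- \<delta>) * (1 - sqrt (measure (product_law n (law M p0)) (B n) * exp (n * (\<integral>x. (X n x)\<^sup>2 \<partial>law M p0)))) \<le> \<rho> ^ n"
        unfolding \<rho>_def
      proof (rule affinity_power_ge[OF p0 q Xm Xb[OF elim(3)] X0 Bs])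
        fix x assume x: "x \<in> space (\<Pi>\<^sub>M i\<in>{..<n}. M)" "x \<notin> B n"
        have xi: "x i \<in> space M" if "i < n" for i using x that by (auto simp: space_PiM PiE_iff)
        let ?r = "\<Prod>i<n. q n (x i) / p0 (x i)"
        have nB: "\<not> ereal \<delta> < \<bar>log_likelihood_ratio n (q n) p0 x - ereal (c n x)\<bar>" "\<not> \<delta> / 4 < \<bar>U n x\<bar>" "\<not> \<delta> / 8 < \<bar>V n x\<bar>"
          using x by (auto simp: B_def B1_def B2_def B3_def)
        \<comment> \<open>A vanishing likelihood ratio has logarithm minus infinity, at infinite
          distance from the real number \<open>c n x\<close>, and thus lies in
          \<open>B1 n\<close>.\<close>
        have r0: "?r \<noteq> 0" and lr: "\<bar>ln ?r - c n x\<bar> \<le> \<delta>"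
          using nB(1) by (auto simp: log_likelihood_ratio_def Let_def split: if_splits)
        have "0 \<le> ?r" using is_densityD(2)[OF p0 xi] is_densityD(2)[OF q xi] by (intro prod_nonneg) auto
        with r0 have rp: "0 < ?r" by linarith
        have T: "\<bar>(\<Sum>i<n. ln (1 + G n (x i) / sqrt n)) - ((1 / sqrt n) * (\<Sum>i<n. g (x i)) - v / 2)\<bar> \<le> \<delta>"
          by (rule log_product_expansion[OF elim(3), where m="m n"])
             (use Gb[of n] nB mv[of n] elim(2) in \<open>auto simp: K_def U_def V_def\<close>)
        have "(\<Prod>i<n. 1 + X n (x i)) = exp (\<Sum>i<n. ln (1 + X n (x i)))"
        proof -
          have "1 + X n y > 0" for y using Xb[OF elim(3), of y] by (auto simp: abs_le_iff)
          then show ?thesis by (simp add: exp_sum)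
        qed
        \<comment> \<open>One \<delta> is spent on the expansion of the path and one on that of the
          given likelihood ratio.\<close>
        moreover have "exp (- (2 * \<delta>)) * exp (\<Sum>i<n. ln (1 + X n (x i))) \<le> exp (ln ?r)"
          using T lr unfolding exp_add[symmetric] by (simp add: X_def c_def normalized_sum_def) 
        ultimately show "exp (- (2 * \<delta>)) * (\<Prod>i<n. 1 + X n (x i)) \<le> ?r"
          using rp by simp
      qed
      also have "n * (\<integral>x. (X n x)\<^sup>2 \<partial>law M p0) = m n"
        using elim(3) by (simp add: X_def m_def power_divide)
      finally have 1: "exp (- \<delta>) * (1 - sqrt (measure (product_law n (law M p0)) (B n) * exp (m n))) \<le> \<rho> ^ n" .
      have "sqrt (measure (product_law n (law M p0)) (B n) * exp (m n)) \<le> sqrt (measure (product_law n (law M p0)) (B n) * exp v)"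
        using mv by (intro real_sqrt_le_mono mult_left_mono) auto
      then have "exp (- \<delta>) \<le> 1 - sqrt (measure (product_law n (law M p0)) (B n) * exp (m n))" using elim(1) by linarith
      then have "exp (- \<delta>) * exp (- \<delta>) \<le> \<rho> ^ n" using 1 by (smt (verit) exp_gt_zero mult_left_mono)
      \<comment> \<open>This linearizes the power: the lower bound becomes
        \<open>n * (1 - \<rho>) \<le> 2 * \<delta>\<close>. The squared Hellinger distance is
        \<open>2 * (1 - \<rho>)\<close>, so \<open>n\<close> times it is at most
        \<open>4 * \<delta> = e / 2\<close>.\<close>
      also have "\<rho> ^ n \<le> exp (\<rho> - 1) ^ n"
      proof (rule power_mono)
        show "\<rho> \<le> exp (\<rho> - 1)" using exp_ge_add_one_self[of "\<rho> - 1"] by simp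
        show "0 \<le> \<rho>" unfolding \<rho>_def using is_densityD(2)[OF q] is_densityD(2)[OF rd[OF elim(3)]]
          by (intro integral_nonneg_AE AE_I2) (auto simp: r_def)
      qed
      finally have "exp (- (2 * \<delta>)) \<le> exp (n * (\<rho> - 1))"
        by (simp add: exp_of_nat_mult flip: exp_add)
      then have "n * (1 - \<rho>) \<le> 2 * \<delta>" by (simp add: right_diff_distrib)
      moreover have "(\<integral>x. (sqrt (q n x) - sqrt (r n x))\<^sup>2 \<partial>M) = 2 * (1 - \<rho>)"
        unfolding hellinger_eq_affinity[OF rd[OF elim(3)] q] by (simp add: \<rho>_def r_def)
      ultimately have "n * (\<integral>x. (sqrt (q n x) - sqrt (r n x))\<^sup>2 \<partial>M) \<le> 4 * \<delta>"
        by (simp add: mult.left_commute del: right_diff_distrib_numeral)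
      moreover have "0 \<le> n * (\<integral>x. (sqrt (q n x) - sqrt (r n x))\<^sup>2 \<partial>M)" by simp
      ultimately show ?case using \<open>e > 0\<close> unfolding \<delta>_def real_norm_def by linarith
    qed
    then show "\<exists>N. \<forall>n\<ge>N. norm (n * (\<integral>x. (sqrt (q n x) - sqrt (r n x))\<^sup>2 \<partial>M) - 0) < e"
      by (simp add: eventually_sequentially)
  qed

  \<comment> \<open>Mean square expansion of the path around \<open>p0\<close>\<close>
  have gL2: "(\<lambda>x. g x / 2 * sqrt (p0 x)) \<in> L2 M"
    using L2_cmult[of "\<lambda>x. g x * sqrt (p0 x)" M "1/2"] g unfolding L2_law_iff[OF p0 gm] by simp
  have dL2: "(\<lambda>x. sqrt n * (sqrt (q n x) - sqrt (p0 x))) \<in> L2 M" for n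
    by (intro L2_cmult L2_diff is_densityD(6)[OF p0] is_densityD(6)[OF q])
  have ref: "(\<integral>x. (sqrt n * (sqrt (r n x) - sqrt (p0 x)) - g x / 2 * sqrt (p0 x))\<^sup>2 \<partial>M) \<le> 2 * v / sqrt n + (\<integral>x. (G n x - g x)\<^sup>2 \<partial>law M p0)"
    if n: "256 \<le> n" for n
  proof -
    have sn: "sqrt n > 0" using n by simp
    define y where "y x = sqrt n * (sqrt (1 + X n x) - 1) - g x / 2" for x
    have ym[measurable]: "y \<in> borel_measurable M" unfolding y_def by measurable
    \<comment> \<open>The first summand comes from the second-order error of the square root, again
      estimated with the truncation level; the second is the truncation error.\<close>
    have yb: "(y x)\<^sup>2 \<le> 2 / sqrt n * (G n x)\<^sup>2 + (G n x - g x)\<^sup>2" for x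
    proof -
      let ?t = "sqrt (1 + X n x) - 1 - X n x / 2"
      have "\<bar>?t\<bar> \<le> (X n x)\<^sup>2 / 2"
        using Xb[OF n, of x] by (intro sqrt_one_plus_second_order) (auto simp: abs_le_iff)
      then have "sqrt n * \<bar>?t\<bar> \<le> sqrt n * ((X n x)\<^sup>2 / 2)" using sn by (intro mult_left_mono) auto
      also have "\<dots> = (G n x)\<^sup>2 / (2 * sqrt n)" using sn by (simp add: X_def power_divide field_simps)
      finally have "\<bar>sqrt n * ?t\<bar> \<le> (G n x)\<^sup>2 / (2 * sqrt n)" by (simp add: abs_mult)
      then have "(sqrt n * ?t)\<^sup>2 \<le> ((G n x)\<^sup>2 / (2 * sqrt n))\<^sup>2"
        by (metis abs_ge_zero power2_abs power_mono)
      also have "\<dots> = (G n x)\<^sup>2 * (G n x)\<^sup>2 / (4 * n)" using sn by (simp add: power_divide power2_eq_square[of "(G n x)\<^sup>2"] power_mult_distrib)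
      also have "\<dots> \<le> (4 * sqrt n) * (G n x)\<^sup>2 / (4 * n)"
        using G4[of n x] by (intro divide_right_mono mult_right_mono) auto
      also have "\<dots> = 1 / sqrt n * (G n x)\<^sup>2" using n by (simp add: field_simps)
      finally have 1: "(sqrt n * ?t)\<^sup>2 \<le> 1 / sqrt n * (G n x)\<^sup>2" .
      have "y x = sqrt n * ?t + (G n x - g x) / 2"
        using sn by (simp add: y_def X_def field_simps)
      then have "(y x)\<^sup>2 \<le> 2 * (sqrt n * ?t)\<^sup>2 + 2 * ((G n x - g x) / 2)\<^sup>2"
        using sum_squares_bound[of "sqrt n * ?t" "(G n x - g x) / 2"] by (simp add: power2_sum)
      also have "2 * ((G n x - g x) / 2)\<^sup>2 \<le> (G n x - g x)\<^sup>2" by (simp add: power_divide)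
      finally show ?thesis using 1 by simp
    qed
    have bi: "integrable (law M p0) (\<lambda>x. 2 / sqrt n * (G n x)\<^sup>2 + (G n x - g x)\<^sup>2)"
      using G2I[of n] L2D(2)[OF L2_diff[OF GL2[of n] g]] by (intro Bochner_Integration.integrable_add integrable_mult_right)
    have yi: "integrable (law M p0) (\<lambda>x. (y x)\<^sup>2)"
      by (rule Bochner_Integration.integrable_bound[OF bi]) (use yb in \<open>auto intro!: AE_I2 simp: abs_of_nonneg intro: order_trans\<close>)
    have "(\<integral>x. (sqrt n * (sqrt (r n x) - sqrt (p0 x)) - g x / 2 * sqrt (p0 x))\<^sup>2 \<partial>M) = (\<integral>x. (y x * sqrt (p0 x)) * (y x * sqrt (p0 x)) \<partial>M)"
      unfolding r_def real_sqrt_mult by (simp add: y_def power2_eq_square algebra_simps)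
    also have "\<dots> = (\<integral>x. y x * y x \<partial>law M p0)"
      by (rule integral_law_mult[OF p0 ym ym, symmetric])
    also have "\<dots> = (\<integral>x. (y x)\<^sup>2 \<partial>law M p0)" by (simp add: power2_eq_square)
    also have "\<dots> \<le> (\<integral>x. 2 / sqrt n * (G n x)\<^sup>2 + (G n x - g x)\<^sup>2 \<partial>law M p0)"
      by (rule integral_mono[OF yi bi yb])
    also have "\<dots> = 2 / sqrt n * m n + (\<integral>x. (G n x - g x)\<^sup>2 \<partial>law M p0)"
      using G2I[of n] L2D(2)[OF L2_diff[OF GL2[of n] g]] by (simp add: m_def)
    also have "2 / sqrt n * m n \<le> 2 / sqrt n * v" using mv by (intro mult_left_mono) auto
    finally show ?thesis by simp
  qed
  show ?thesis
    unfolding L2_lim_def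
  proof (intro conjI allI dL2 gL2)
    let ?b = "\<lambda>n. 2 * (n * (\<integral>x. (sqrt (q n x) - sqrt (r n x))\<^sup>2 \<partial>M)) + 2 * (2 * v / sqrt n + (\<integral>x. (G n x - g x)\<^sup>2 \<partial>law M p0))"
    have "(\<lambda>n. 2 * v / sqrt n) \<longlonglongrightarrow> 0"
      by (rule real_tendsto_divide_at_top[OF tendsto_const filterlim_compose[OF sqrt_at_top filterlim_real_sequentially]])
    then have bl: "?b \<longlonglongrightarrow> 2 * 0 + 2 * (0 + 0)"
      by (intro tendsto_intros hell L2_limD(3)[OF Glim])
    show "(\<lambda>n. \<integral>x. (sqrt n * (sqrt (q n x) - sqrt (p0 x)) - g x / 2 * sqrt (p0 x))\<^sup>2 \<partial>M) \<longlonglongrightarrow> 0"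
    proof (rule tendsto_sandwich[OF _ _ tendsto_const])
      show "?b \<longlonglongrightarrow> 0" using bl by simp
      show "\<forall>\<^sub>F n in sequentially. (\<integral>x. (sqrt n * (sqrt (q n x) - sqrt (p0 x)) - g x / 2 * sqrt (p0 x))\<^sup>2 \<partial>M) \<le> ?b n"
        using eventually_ge_at_top[of 256]
      proof eventually_elim
        case (elim n)
        have a: "(\<lambda>x. sqrt n * (sqrt (q n x) - sqrt (r n x))) \<in> L2 M"
          "(\<lambda>x. sqrt n * (sqrt (r n x) - sqrt (p0 x)) - g x / 2 * sqrt (p0 x)) \<in> L2 M"
          by (intro L2_diff L2_cmult gL2 is_densityD(6)[OF p0] is_densityD(6)[OF q] is_densityD(6)[OF rd[OF elim]])+
        have "(\<integral>x. (sqrt n * (sqrt (q n x) - sqrt (p0 x)) - g x / 2 * sqrt (p0 x))\<^sup>2 \<partial>M)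
            = (\<integral>x. (sqrt n * (sqrt (q n x) - sqrt (r n x)) + (sqrt n * (sqrt (r n x) - sqrt (p0 x)) - g x / 2 * sqrt (p0 x)))\<^sup>2 \<partial>M)"
          by (simp add: algebra_simps)
        also have "\<dots> \<le> 2 * (\<integral>x. (sqrt n * (sqrt (q n x) - sqrt (r n x)))\<^sup>2 \<partial>M)
            + 2 * (\<integral>x. (sqrt n * (sqrt (r n x) - sqrt (p0 x)) - g x / 2 * sqrt (p0 x))\<^sup>2 \<partial>M)"
          by (rule integral_square_add_le[OF a])
        also have "(\<integral>x. (sqrt n * (sqrt (q n x) - sqrt (r n x)))\<^sup>2 \<partial>M) = n * (\<integral>x. (sqrt (q n x) - sqrt (r n x))\<^sup>2 \<partial>M)"
          by (simp add: power_mult_distrib)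
        finally show ?case using ref[OF elim] by simp
      qed
    qed simp
  qed
qed

section \<open>Efficient scores and best regularity\<close>

lemma L2_limI_nn_integral:
  assumes f: "\<And>n. f n \<in> L2 M" and g: "g \<in> L2 M"
    and lim: "(\<lambda>n. \<integral>\<^sup>+x. ennreal ((f n x - g x)\<^sup>2) \<partial>M) \<longlonglongrightarrow> 0"
  shows "L2_lim M f g"
  unfolding L2_lim_def
proof (intro conjI allI f g)
  have "(\<integral>x. (f n x - g x)\<^sup>2 \<partial>M) = enn2real (\<integral>\<^sup>+x. ennreal ((f n x - g x)\<^sup>2) \<partial>M)" for n
    using L2D(1)[OF f] L2D(1)[OF g] by (intro integral_eq_nn_integral) auto
  moreover have "(\<lambda>n. enn2real (\<integral>\<^sup>+x. ennreal ((f n x - g x)\<^sup>2) \<partial>M)) \<longlonglongrightarrow> enn2real 0"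
    using tendsto_enn2real[of "\<lambda>n. \<integral>\<^sup>+x. ennreal ((f n x - g x)\<^sup>2) \<partial>M" 0] lim by simp
  ultimately show "(\<lambda>n. \<integral>x. (f n x - g x)\<^sup>2 \<partial>M) \<longlonglongrightarrow> 0" by simp
qed

lemma tendsto_det:
  fixes A :: "nat \<Rightarrow> real^'n^'n"
  assumes "\<And>i j. (\<lambda>n. A n $ i $ j) \<longlonglongrightarrow> B $ i $ j"
  shows "(\<lambda>n. det (A n)) \<longlonglongrightarrow> det B"
  unfolding det_def by (intro tendsto_intros assms)

text \<open>By Cramer's rule each coordinate is a quotient of determinants, which are polynomials in
  the entries. A nonzero limiting determinant also forces invertibility for large
  \<open>n\<close>.\<close>

lemma matrix_inv_mult_vec_tendsto:
  fixes A :: "nat \<Rightarrow> real^'n^'n"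
  assumes A: "\<And>i j. (\<lambda>n. A n $ i $ j) \<longlonglongrightarrow> B $ i $ j" and B: "invertible B"
  shows "(\<lambda>n. (matrix_inv (A n) *v t) $ k) \<longlonglongrightarrow> (matrix_inv B *v t) $ k"
    and "\<forall>\<^sub>F n in sequentially. invertible (A n)"
proof -
  have cram: "(matrix_inv C *v t) $ k = det (\<chi> i j. if j = k then t $ i else C $ i $ j) / det C" if C: "invertible C" for C :: "real^'n^'n"
  proof -
    obtain D where D: "C ** D = mat 1" using C unfolding invertible_def by blast
    have "C *v (matrix_inv C *v t) = t"
      unfolding matrix_inv_eqI(1)[OF D] by (simp add: matrix_vector_mul_assoc D)
    then show ?thesis
      using cramer[of C "matrix_inv C *v t" t] C by (simp add: invertible_det_nz)
  qed
  have dB: "det B \<noteq> 0" using B by (simp add: invertible_det_nz)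
  show inv: "\<forall>\<^sub>F n in sequentially. invertible (A n)"
    using tendsto_imp_eventually_ne[OF tendsto_det[OF A] dB] by (simp add: invertible_det_nz)
  have "(\<lambda>n. det (\<chi> i j. if j = k then t $ i else A n $ i $ j) / det (A n)) \<longlonglongrightarrow> det (\<chi> i j. if j = k then t $ i else B $ i $ j) / det B"
    using A by (intro tendsto_divide tendsto_det dB) auto
  then show "(\<lambda>n. (matrix_inv (A n) *v t) $ k) \<longlonglongrightarrow> (matrix_inv B *v t) $ k"
    unfolding cram[OF B]
    by (rule Lim_transform_eventually) (use inv in \<open>eventually_elim, simp add: cram\<close>)
qed

lemma vec_mult_matrix_inv_symmetric:
  fixes J :: "real^'n^'n"
  assumes J: "invertible J" and sym: "transpose J = J"
  shows "t v* matrix_inv J = matrix_inv J *v t"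
proof -
  obtain D where D: "J ** D = mat 1" using J unfolding invertible_def by blast
  then have "transpose D ** J = mat 1"
    by (metis matrix_transpose_mul sym transpose_mat)
  then have "J ** transpose D = mat 1" using matrix_left_right_inverse by blast
  then have "transpose (matrix_inv J) = matrix_inv J"
    using matrix_inv_eqI(1)[OF D] matrix_inv_eqI(1)[of J "transpose D"] by simp
  then show ?thesis by (metis transpose_matrix_vector)
qed

lemma second_moment_symmetric: "transpose (second_moment P f) = second_moment P f"
  by (simp add: second_moment_def transpose_def vec_eq_iff mult.commute)

lemma second_moment_inner:
  fixes f :: "'a \<Rightarrow> real^'n"
  assumes f: "\<And>j. (\<lambda>x. f x $ j) \<in> L2 P"
  shows "s \<bullet> (second_moment P f *v t) = (\<integral>x. (s \<bullet> f x) * (t \<bullet> f x) \<partial>P)"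
proof -
  have i: "integrable P (\<lambda>x. f x $ i * f x $ j)" for i j by (rule L2_integrable_mult[OF f f])
  have "(\<integral>x. (s \<bullet> f x) * (t \<bullet> f x) \<partial>P) = (\<integral>x. (\<Sum>i\<in>UNIV. \<Sum>j\<in>UNIV. s $ i * t $ j * (f x $ i * f x $ j)) \<partial>P)"
    by (simp add: inner_vec_def sum_product mult_ac)
  also have "\<dots> = (\<Sum>i\<in>UNIV. \<Sum>j\<in>UNIV. s $ i * t $ j * (\<integral>x. f x $ i * f x $ j \<partial>P))"
    using i by (simp add: integrable_mult_right)
  also have "\<dots> = s \<bullet> (second_moment P f *v t)"
    by (simp add: inner_vec_def matrix_vector_mult_def second_moment_def sum_distrib_left mult_ac)
  finally show ?thesis ..
qed

lemma inner_L2: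
  fixes f :: "'a \<Rightarrow> real^'n"
  assumes "\<And>j. (\<lambda>x. f x $ j) \<in> L2 P"
  shows "(\<lambda>x. s \<bullet> f x) \<in> L2 P"
  unfolding inner_vec_def inner_real_def by (intro L2_sum L2_cmult assms)

text \<open>A second moment matrix is positive semidefinite. If its quadratic form vanishes at
  \<open>x\<close>, the Cauchy-Schwarz inequality puts \<open>x\<close> in the kernel, which an
  invertible matrix excludes.\<close>

lemma second_moment_pos_def:
  fixes f :: "'a \<Rightarrow> real^'n"
  assumes f: "\<And>j. (\<lambda>x. f x $ j) \<in> L2 P" and inv: "invertible (second_moment P f)" and x: "x \<noteq> 0"
  shows "0 < x \<bullet> (second_moment P f *v x)"
proof (rule ccontr)
  let ?J = "second_moment P f"
  assume "\<not> 0 < x \<bullet> (?J *v x)"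
  moreover have "0 \<le> x \<bullet> (?J *v x)" unfolding second_moment_inner[OF f] by simp
  ultimately have 0: "x \<bullet> (?J *v x) = 0" by simp
  have "y \<bullet> (?J *v x) = 0" for y
  proof -
    have "(y \<bullet> (?J *v x))\<^sup>2 \<le> (y \<bullet> (?J *v y)) * (x \<bullet> (?J *v x))"
      using L2_Cauchy_Schwarz[OF inner_L2[OF f, of y] inner_L2[OF f, of x]]
      unfolding second_moment_inner[OF f] by (simp add: power2_eq_square)
    then show ?thesis using 0 by simp
  qed
  then have "?J *v x = 0" using inner_eq_zero_iff by blast
  moreover obtain D where "D ** ?J = mat 1" using inv unfolding invertible_def by blast
  ultimately have "x = 0" by (metis matrix_vector_mul_assoc matrix_vector_mul_lid matrix_vector_mult_0_right)
  with x show False by simp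
qed

text \<open>With \<open>A\<close> from Gram-Schmidt the law is the image of the standard normal law
  under \<open>A\<close>; moving \<open>A\<close> to the frequency side leaves the standard
  characteristic function at \<open>t v* A\<close>, whose squared length is the quadratic form of
  \<open>matrix_inv J\<close> at \<open>t\<close>.\<close>

lemma mv_normal_inverse:
  fixes J :: "real^'n^'n"
  assumes sym: "transpose J = J" and pos: "\<And>x. x \<noteq> 0 \<Longrightarrow> 0 < x \<bullet> (J *v x)"
  shows prob_space_mv_normal: "prob_space (mv_normal 0 (matrix_inv J))"
    and char_mv_normal: "(CLINT x|mv_normal 0 (matrix_inv J). iexp (t \<bullet> x)) = complex_of_real (exp (- (t \<bullet> (matrix_inv J *v t)) / 2))"
proof -
  obtain A :: "real^'n^'n" where A: "transpose A ** J ** A = mat 1"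
    using gram_schmidt_quadratic_form[OF sym pos] by blast
  interpret N: prob_space "std_mv_normal :: (real^'n) measure" by (rule prob_space_std_mv_normal)
  have Am[measurable]: "(*v) A \<in> borel_measurable borel"
    by (intro borel_measurable_continuous_onI matrix_vector_mult_linear_continuous_on)
  show "prob_space (mv_normal 0 (matrix_inv J))"
    unfolding mv_normal_eq_distr(1)[OF A] by (rule N.prob_space_distr) measurable
  have "(CLINT x|mv_normal 0 (matrix_inv J). iexp (t \<bullet> x)) = (CLINT x|std_mv_normal. iexp (t \<bullet> (A *v x)))"
    unfolding mv_normal_eq_distr(1)[OF A] by (rule integral_distr) measurable
  also have "\<dots> = (CLINT x|std_mv_normal. iexp ((t v* A) \<bullet> x))" by (simp add: dot_lmul_matrix)
  also have "\<dots> = complex_of_real (exp (- ((t v* A) \<bullet> (t v* A)) / 2))" by (rule char_std_mv_normal)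
  also have "(t v* A) \<bullet> (t v* A) = t \<bullet> (matrix_inv J *v t)"
    unfolding mv_normal_eq_distr(3)[OF A] by (simp add: dot_lmul_matrix flip: matrix_vector_mul_assoc)
  finally show "(CLINT x|mv_normal 0 (matrix_inv J). iexp (t \<bullet> x)) = complex_of_real (exp (- (t \<bullet> (matrix_inv J *v t)) / 2))" .
qed

text \<open>Slutsky's lemma at the level of characteristic functions: two unit complex exponentials
  differ by at most 2 and by at most the distance of their arguments.\<close>

lemma char_negligible_remainder:
  fixes Z S R :: "nat \<Rightarrow> 'a \<Rightarrow> real" and P :: "nat \<Rightarrow> 'a measure"
  assumes P: "\<And>n. prob_space (P n)"
    and m[measurable]: "\<And>n. Z n \<in> borel_measurable (P n)" "\<And>n. S n \<in> borel_measurable (P n)" "\<And>n. R n \<in> borel_measurable (P n)"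
    and le: "\<And>n x. x \<in> space (P n) \<Longrightarrow> \<bar>Z n x - S n x\<bar> \<le> C * R n x" and C: "0 \<le> C"
    and lim: "\<And>\<epsilon>. 0 < \<epsilon> \<Longrightarrow> (\<lambda>n. measure (P n) {x \<in> space (P n). \<epsilon> < R n x}) \<longlonglongrightarrow> 0"
    and S: "(\<lambda>n. CLINT x|P n. iexp (S n x)) \<longlonglongrightarrow> L"
  shows "(\<lambda>n. CLINT x|P n. iexp (Z n x)) \<longlonglongrightarrow> L"
proof -
  interpret P: prob_space "P n" for n by (rule P)
  have "(\<lambda>n. (CLINT x|P n. iexp (Z n x)) - (CLINT x|P n. iexp (S n x))) \<longlonglongrightarrow> 0"
  proof (rule LIMSEQ_I)
    fix e :: real assume e: "0 < e"
    \<comment> \<open>\<open>C + 1\<close> rather than \<open>C\<close>, because \<open>C\<close>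
      may be 0. Half of \<open>e\<close> goes to \<open>C * \<epsilon>\<close>, half to twice the
      probability of a large remainder.\<close>
    define \<epsilon> where "\<epsilon> = e / (2 * (C + 1))"
    have \<epsilon>: "0 < \<epsilon>" using e C by (simp add: \<epsilon>_def)
    have C\<epsilon>: "C * \<epsilon> \<le> e / 2" using e C by (simp add: \<epsilon>_def field_simps)
    have "\<forall>\<^sub>F n in sequentially. measure (P n) {x \<in> space (P n). \<epsilon> < R n x} < e / 4"
      using order_tendstoD(2)[OF lim[OF \<epsilon>], of "e / 4"] e by simp
    then have "\<forall>\<^sub>F n in sequentially. norm ((CLINT x|P n. iexp (Z n x)) - (CLINT x|P n. iexp (S n x)) - 0) < e"
    proof eventually_elim
      case (elim n)
      let ?B = "{x \<in> space (P n). \<epsilon> < R n x}"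
      have i: "integrable (P n) (\<lambda>x. iexp (Z n x))" "integrable (P n) (\<lambda>x. iexp (S n x))"
        by (rule P.integrable_const_bound[where B=1]; simp)+
      have iB: "integrable (P n) (\<lambda>x. C * \<epsilon> + 2 * indicator ?B x)"
        by (rule P.integrable_const_bound[where B="C * \<epsilon> + 2"]) (use C \<epsilon> in \<open>auto simp: indicator_def\<close>)
      have "norm ((CLINT x|P n. iexp (Z n x)) - (CLINT x|P n. iexp (S n x))) = norm (CLINT x|P n. iexp (Z n x) - iexp (S n x))"
        using i by simp
      also have "\<dots> \<le> (\<integral>x. norm (iexp (Z n x) - iexp (S n x)) \<partial>P n)" by (rule integral_norm_bound)
      also have "\<dots> \<le> (\<integral>x. C * \<epsilon> + 2 * indicator ?B x \<partial>P n)"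
      proof (intro integral_mono integrable_norm Bochner_Integration.integrable_diff i iB)
        fix x assume x: "x \<in> space (P n)"
        show "norm (iexp (Z n x) - iexp (S n x)) \<le> C * \<epsilon> + 2 * indicator ?B x"
        proof (cases "\<epsilon> < R n x")
          case True
          have "norm (iexp (Z n x) - iexp (S n x)) \<le> 2" using norm_triangle_ineq4[of "iexp (Z n x)" "iexp (S n x)"] by simp
          then show ?thesis using True x C \<epsilon> by (simp add: add_increasing)
        next
          case False
          have "iexp (Z n x) - iexp (S n x) = iexp (S n x) * (iexp (Z n x - S n x) - 1)"
            by (simp add: right_diff_distrib flip: exp_add)
          then have "norm (iexp (Z n x) - iexp (S n x)) = norm (iexp (Z n x - S n x) - 1)" by (simp only: norm_mult norm_exp_i_times mult_1_left)
          also have "\<dots> \<le> \<bar>Z n x - S n x\<bar>" using iexp_approx1[of "Z n x - S n x" 0] by simp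
          also have "\<dots> \<le> C * R n x" by (rule le[OF x])
          also have "\<dots> \<le> C * \<epsilon>" using False C by (intro mult_left_mono) auto
          finally show ?thesis using False by simp
        qed
      qed
      also have "\<dots> = C * \<epsilon> + 2 * measure (P n) ?B"
      proof -
        have "integrable (P n) (indicator ?B :: 'a \<Rightarrow> real)"
          by (rule P.integrable_const_bound[where B=1]) (auto simp: indicator_def)
        then have "(\<integral>x. C * \<epsilon> + 2 * indicator ?B x \<partial>P n) = C * \<epsilon> + 2 * (\<integral>x. indicator ?B x \<partial>P n)"
          by (subst Bochner_Integration.integral_add) (auto simp: P.prob_space)
        moreover have "?B \<inter> space (P n) = ?B" by auto
        ultimately show ?thesis by simp
      qed
      finally show ?case using elim C\<epsilon> by simp
    qed
    then show "\<exists>N. \<forall>n\<ge>N. norm ((CLINT x|P n. iexp (Z n x)) - (CLINT x|P n. iexp (S n x)) - 0) < e"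
      by (simp add: eventually_sequentially)
  qed
  from tendsto_add[OF this S] show ?thesis by simp
qed

text \<open>The efficient score is orthogonal to the closed nuisance space, which contains both
  \<open>D b\<close> and the difference between score and efficient score. Only the
  \<open>\<tau>\<close> part survives, and in it the score may be replaced by its efficient
  version.\<close>

lemma efficient_score_covariance:
  fixes l leff :: "'x \<Rightarrow> real^'p"
  assumes score: "score_decomposition P A l D" and eff: "is_efficient_score P l D leff" and "A (\<tau>, b) \<in> L2 P"
  shows efficient_score_L2: "\<And>j. (\<lambda>x. leff x $ j) \<in> L2 P"
    and "(\<integral>x. (c \<bullet> leff x) * A (\<tau>, b) x \<partial>P) = c \<bullet> (second_moment P leff *v \<tau>)"
proof -
  have lL2: "(\<lambda>x. l x $ j) \<in> L2 P" and DL2: "D b \<in> L2 P" for j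
    using score by (auto simp: score_decomposition_def linear_into_L2_def)
  have Adec: "AE x in P. A (\<tau>, b) x = \<tau> \<bullet> l x + D b x"
    using score by (auto simp: score_decomposition_def)
  let ?V = "L2_closure P (range D)"
  have proj: "(\<lambda>x. l x $ j - leff x $ j) \<in> ?V" "\<And>s. s \<in> ?V \<Longrightarrow> (\<integral>x. leff x $ j * s x \<partial>P) = 0" for j
    using eff by (auto simp: is_efficient_score_def is_L2_projection_def)
  have pL2: "(\<lambda>x. l x $ j - leff x $ j) \<in> L2 P" for j using proj(1) by (auto simp: L2_closure_def)
  show fL2: "(\<lambda>x. leff x $ j) \<in> L2 P" for j using L2_diff[OF lL2 pL2, of j j] by simp
  \<comment> \<open>\<open>D b\<close> is approximated by itself, with error 0.\<close>
  have DV: "D b \<in> ?V" using DL2 by (auto simp: L2_closure_def intro!: exI[of _ b])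
  have cl: "(\<integral>x. leff x $ j * l x $ i \<partial>P) = second_moment P leff $ j $ i" for i j
  proof -
    have "(\<integral>x. leff x $ j * l x $ i \<partial>P) = (\<integral>x. leff x $ j * (l x $ i - leff x $ i) + leff x $ j * leff x $ i \<partial>P)"
      by (simp add: right_diff_distrib)
    also have "\<dots> = second_moment P leff $ j $ i"
      using L2_integrable_mult[OF fL2 pL2, of j i] L2_integrable_mult[OF fL2 fL2, of j i] proj(2)[OF proj(1)[of i], of j]
      by (simp add: second_moment_def)
    finally show ?thesis .
  qed
  have AEm: "(\<integral>x. leff x $ j * A (\<tau>, b) x \<partial>P) = (second_moment P leff *v \<tau>) $ j" for j
  proof -
    have "(\<integral>x. leff x $ j * A (\<tau>, b) x \<partial>P) = (\<integral>x. leff x $ j * (\<tau> \<bullet> l x + D b x) \<partial>P)"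
    proof (rule integral_cong_AE)
      show "(\<lambda>x. leff x $ j * A (\<tau>, b) x) \<in> borel_measurable P" "(\<lambda>x. leff x $ j * (\<tau> \<bullet> l x + D b x)) \<in> borel_measurable P"
        using L2D(1)[OF fL2[of j]] L2D(1)[OF assms(3)] L2D(1)[OF L2_add[OF inner_L2[OF lL2, of \<tau>] DL2]] by measurable
    qed (use Adec in \<open>eventually_elim, simp\<close>)
    also have "\<dots> = (\<integral>x. (\<Sum>i\<in>UNIV. \<tau> $ i * (leff x $ j * l x $ i)) + leff x $ j * D b x \<partial>P)"
      by (simp add: inner_vec_def distrib_left sum_distrib_left mult_ac)
    also have "\<dots> = (\<Sum>i\<in>UNIV. \<tau> $ i * (\<integral>x. leff x $ j * l x $ i \<partial>P)) + (\<integral>x. leff x $ j * D b x \<partial>P)"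
      using L2_integrable_mult[OF fL2 lL2] L2_integrable_mult[OF fL2 DL2] by (simp add: integrable_mult_right)
    also have "\<dots> = (second_moment P leff *v \<tau>) $ j"
      unfolding cl proj(2)[OF DV] by (simp add: matrix_vector_mult_def mult.commute)
    finally show ?thesis .
  qed
  have "(\<integral>x. (c \<bullet> leff x) * A (\<tau>, b) x \<partial>P) = (\<integral>x. (\<Sum>j\<in>UNIV. c $ j * (leff x $ j * A (\<tau>, b) x)) \<partial>P)"
    unfolding inner_vec_def inner_real_def sum_distrib_right by (simp add: mult.assoc)
  also have "\<dots> = (\<Sum>j\<in>UNIV. c $ j * (\<integral>x. leff x $ j * A (\<tau>, b) x \<partial>P))"
    using L2_integrable_mult[OF fL2 assms(3)] by (simp add: integrable_mult_right)
  finally show "(\<integral>x. (c \<bullet> leff x) * A (\<tau>, b) x \<partial>P) = c \<bullet> (second_moment P leff *v \<tau>)"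
    by (simp add: AEm inner_vec_def)
qed

lemma parametric_efficient_score_L2:
  assumes "\<And>j. (\<lambda>x. l x $ j) \<in> L2 P" and "\<And>a. a < k \<Longrightarrow> (\<lambda>x. v x a) \<in> L2 P"
  shows "(\<lambda>x. parametric_efficient_score P k l v x $ j) \<in> L2 P"
  unfolding parametric_efficient_score_def vec_lambda_beta
  by (intro L2_diff L2_sum L2_cmult assms) auto

text \<open>Weak convergence ignores finitely many terms, so the laws may be replaced at the indices
  where a local alternative lies outside the model.\<close>

lemma weakly_converges_eventually_cong:
  assumes "weakly_converges Q L" and eq: "\<forall>\<^sub>F n in sequentially. Q n = R n"
  shows "weakly_converges R L"
  unfolding weakly_converges_def
proof (intro allI impI)
  fix f :: "'a \<Rightarrow> real" assume f: "continuous_on UNIV f" "bounded (range f)"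
  then have "(\<lambda>n. \<integral>x. f x \<partial>Q n) \<longlonglongrightarrow> (\<integral>x. f x \<partial>L)"
    using assms(1) unfolding weakly_converges_def by blast
  then show "(\<lambda>n. \<integral>x. f x \<partial>R n) \<longlonglongrightarrow> (\<integral>x. f x \<partial>L)"
    by (rule Lim_transform_eventually) (use eq in \<open>eventually_elim, simp\<close>)
qed

theorem theorem4p1:
  fixes \<mu> :: "'x measure"
    and p :: "real^'p \<Rightarrow> 'h::topological_space \<Rightarrow> 'x \<Rightarrow> real"
    and \<Theta> :: "(real^'p) set" and H :: "'h set"
    and \<theta>\<^sub>0 :: "real^'p" and \<eta>\<^sub>0 :: 'h
    and k :: "nat \<Rightarrow> nat" and \<Gamma> :: "nat \<Rightarrow> (nat \<Rightarrow> real) set"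
    and Hm :: "nat \<Rightarrow> 'h set" and T :: "nat \<Rightarrow> 'h \<Rightarrow> nat \<Rightarrow> real"
    and \<gamma>\<^sub>0 :: "nat \<Rightarrow> nat \<Rightarrow> real"
    and Tinv :: "nat \<Rightarrow> (nat \<Rightarrow> real) \<Rightarrow> 'h"
    and p\<^sub>0 :: "'x \<Rightarrow> real" and pm :: "nat \<Rightarrow> 'x \<Rightarrow> real"
    and P\<^sub>0 :: "'x measure" and Pm :: "nat \<Rightarrow> 'x measure"
    and \<eta>loc :: "nat \<Rightarrow> 'b::real_normed_vector \<Rightarrow> 'h"
    and A :: "(real^'p) \<times> 'b \<Rightarrow> 'x \<Rightarrow> real"
    and l :: "'x \<Rightarrow> real^'p" and D :: "'b \<Rightarrow> 'x \<Rightarrow> real"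
    and leff :: "'x \<Rightarrow> real^'p"
    and lm :: "nat \<Rightarrow> 'x \<Rightarrow> real^'p" and vm :: "nat \<Rightarrow> 'x \<Rightarrow> nat \<Rightarrow> real"
    and leffm :: "nat \<Rightarrow> 'x \<Rightarrow> real^'p"
    and \<theta>hat :: "nat \<Rightarrow> nat \<Rightarrow> (nat \<Rightarrow> 'x) \<Rightarrow> real^'p"
    and m :: "nat \<Rightarrow> nat" and g :: "'x \<Rightarrow> real"
  assumes sigma_finite: "sigma_finite_measure \<mu>"
    and true_parameter: "\<theta>\<^sub>0 \<in> \<Theta>" "\<eta>\<^sub>0 \<in> H"
    and parametric_family:
      "\<And>j. j \<ge> 1 \<Longrightarrow> \<Gamma> j \<subseteq> {..<k j} \<rightarrow>\<^sub>E UNIV"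
      "\<And>j. j \<ge> 1 \<Longrightarrow> bij_betw (T j) (Hm j) (\<Gamma> j)"
      "\<And>j. j \<ge> 1 \<Longrightarrow> \<gamma>\<^sub>0 j \<in> \<Gamma> j"
    and Tinv: "\<And>j. Tinv j = inv_into (Hm j) (T j)"
    and densities:
      "\<And>\<theta> \<eta>. \<theta> \<in> \<Theta> \<Longrightarrow> \<eta> \<in> H \<union> (\<Union>j\<in>{1..}. Hm j) \<Longrightarrow> is_density \<mu> (p \<theta> \<eta>)"
    and approximation: "(\<lambda>j. Tinv j (\<gamma>\<^sub>0 j)) \<longlonglongrightarrow> \<eta>\<^sub>0"
    and p0: "p\<^sub>0 = p \<theta>\<^sub>0 \<eta>\<^sub>0" and P0: "P\<^sub>0 = law \<mu> p\<^sub>0"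
    and pm: "\<And>j. pm j = p \<theta>\<^sub>0 (Tinv j (\<gamma>\<^sub>0 j))" and Pm: "\<And>j. Pm j = law \<mu> (pm j)"
    and estimator:
      "\<And>j n. j \<ge> 1 \<Longrightarrow> \<theta>hat j n \<in> borel_measurable (\<Pi>\<^sub>M i\<in>{..<n}. \<mu>)"
    and qmd: "differentiable_in_quadratic_mean \<mu> p \<Theta> H \<theta>\<^sub>0 \<eta>\<^sub>0 \<eta>loc A"
    and score: "score_decomposition P\<^sub>0 A l D"
    and efficient_score: "is_efficient_score P\<^sub>0 l D leff"
    and nonsingular: "invertible (second_moment P\<^sub>0 leff)"
    and indices: "\<And>n. n \<ge> 1 \<Longrightarrow> m n \<ge> 1" "filterlim m at_top sequentially"
    and hyp1_g: "g \<in> L2 P\<^sub>0" "(\<integral>x. g x \<partial>P\<^sub>0) = 0" "\<And>j. (\<integral>x. g x * leff x $ j \<partial>P\<^sub>0) = 0"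
    and hyp1:
      "negligible_in_probability (\<lambda>n. product_law n P\<^sub>0)
         (\<lambda>n x. \<bar>log_likelihood_ratio n (pm (m n)) p\<^sub>0 x
                 - ereal (normalized_sum n g x - (1/2) * (\<integral>y. (g y)\<^sup>2 \<partial>P\<^sub>0))\<bar>)"
    and hyp2_exists:
      "\<And>n. n \<ge> 1 \<Longrightarrow> efficient_score_exists \<mu> p \<Theta> \<theta>\<^sub>0 (k (m n)) (\<Gamma> (m n)) (Tinv (m n)) (\<gamma>\<^sub>0 (m n))
                       (lm (m n)) (vm (m n))"
    and leffm: "\<And>j. leffm j = parametric_efficient_score (Pm j) (k j) (lm j) (vm j)"
    and hyp2:
      "(\<lambda>n. \<integral>\<^sup>+ x. ennreal ((norm (sqrt (pm (m n) x) *\<^sub>R leffm (m n) x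
                                   - sqrt (p\<^sub>0 x) *\<^sub>R leff x))\<^sup>2) \<partial>\<mu>) \<longlonglongrightarrow> 0"
    and hyp3:
      "negligible_in_probability (\<lambda>n. product_law n (Pm (m n)))
         (\<lambda>n x. ereal (norm (sqrt (real n) *\<^sub>R (\<theta>hat (m n) n x - \<theta>\<^sub>0)
                 - normalized_sum n
                     (\<lambda>y. matrix_inv (second_moment (Pm (m n)) (leffm (m n))) *v leffm (m n) y) x)))"
  shows "best_regular \<mu> p \<theta>\<^sub>0 \<eta>\<^sub>0 \<eta>loc leff (\<lambda>n. \<theta>hat (m n) n)"
proof -
  \<comment> \<open>The conditions on the models \<open>m n\<close> and on their scores are given
    for \<open>n \<ge> 1\<close>, whereas the limit lemmas quantify over every \<open>n\<close>. The
    true density and the zero score fill index 0 without harm.\<close>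
  define Q where "Q n = (if 1 \<le> n then pm (m n) else p\<^sub>0)" for n
  define F where "F n = (if 1 \<le> n then leffm (m n) else (\<lambda>_. 0))" for n
  define J where "J = second_moment P\<^sub>0 leff"
  define Jn where "Jn n = second_moment (law \<mu> (Q n)) (F n)" for n
  have p0d: "is_density \<mu> p\<^sub>0" using densities[of \<theta>\<^sub>0 \<eta>\<^sub>0] true_parameter by (simp add: p0)
  have Qd: "is_density \<mu> (Q n)" for n
  proof (cases "1 \<le> n")
    case True
    then have mn: "1 \<le> m n" by (rule indices)
    have "Tinv (m n) (\<gamma>\<^sub>0 (m n)) \<in> Hm (m n)"
      unfolding Tinv using parametric_family(2,3)[OF mn] by (metis bij_betw_imp_surj_on inv_into_into)
    then show ?thesis using True mn densities[of \<theta>\<^sub>0] true_parameter by (auto simp: Q_def pm)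
  qed (simp add: Q_def p0d)
  have lawQ: "law \<mu> (Q n) = Pm (m n)" if "1 \<le> n" for n using that by (simp add: Q_def Pm)
  interpret P0: prob_space P\<^sub>0 unfolding P0 by (rule is_densityD[OF p0d])

  \<comment> \<open>Integrability, centring and convergence of the efficient scores\<close>
  have es: "efficient_score_exists \<mu> p \<Theta> \<theta>\<^sub>0 (k (m n)) (\<Gamma> (m n)) (Tinv (m n)) (\<gamma>\<^sub>0 (m n)) (lm (m n)) (vm (m n))"
    if "1 \<le> n" for n using hyp2_exists that .
  have lawm: "law \<mu> (p \<theta>\<^sub>0 (Tinv j (\<gamma>\<^sub>0 j))) = Pm j" for j by (simp add: Pm pm)
  have FL2: "(\<lambda>x. F n x $ j) \<in> L2 (law \<mu> (Q n))" for n j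
  proof (cases "1 \<le> n")
    case True
    have sc: "\<And>j. (\<lambda>x. lm (m n) x $ j) \<in> L2 (Pm (m n))" "\<And>a. a < k (m n) \<Longrightarrow> (\<lambda>x. vm (m n) x a) \<in> L2 (Pm (m n))"
      using es[OF True] by (auto simp: efficient_score_exists_def are_parametric_scores_def Let_def lawm)
    have "(\<lambda>x. parametric_efficient_score (Pm (m n)) (k (m n)) (lm (m n)) (vm (m n)) x $ j) \<in> L2 (Pm (m n))"
      by (rule parametric_efficient_score_L2) (use sc in auto)
    then show ?thesis
      using True by (simp add: F_def lawQ leffm)
  qed (simp add: F_def L2_def)
  have Fm: "(\<lambda>x. F n x $ j) \<in> borel_measurable \<mu>" for n j using L2D(1)[OF FL2[of n j]] by (simp add: law_def)
  have F0: "(\<integral>x. F n x $ j \<partial>law \<mu> (Q n)) = 0" for n j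
  proof (cases "1 \<le> n")
    case True
    then show ?thesis
      using es[OF True] by (simp add: F_def lawQ leffm efficient_score_exists_def Let_def lawm)
  qed (simp add: F_def)

  have qmdA: "A (\<tau>, b) \<in> L2 P\<^sub>0" for \<tau> b
    using qmd by (auto simp: differentiable_in_quadratic_mean_def bounded_linear_into_L2_def linear_into_L2_def P0 p0)
  note leffL2 = efficient_score_L2[OF score efficient_score qmdA]
  have leffm': "(\<lambda>x. leff x $ j) \<in> borel_measurable \<mu>" for j using L2D(1)[OF leffL2[of j]] by (simp add: P0 law_def)
  have gm: "g \<in> borel_measurable \<mu>" using L2D(1)[OF hyp1_g(1)] by (simp add: P0 law_def)

  have Flim: "L2_lim \<mu> (\<lambda>n x. F n x $ j * sqrt (Q n x)) (\<lambda>x. leff x $ j * sqrt (p\<^sub>0 x))" for j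
  proof (rule L2_limI_nn_integral)
    show "(\<lambda>x. F n x $ j * sqrt (Q n x)) \<in> L2 \<mu>" for n using FL2 L2_law_iff[OF Qd Fm] by blast
    show "(\<lambda>x. leff x $ j * sqrt (p\<^sub>0 x)) \<in> L2 \<mu>" using leffL2 L2_law_iff[OF p0d leffm'] unfolding P0 by blast
    show "(\<lambda>n. \<integral>\<^sup>+x. ennreal ((F n x $ j * sqrt (Q n x) - leff x $ j * sqrt (p\<^sub>0 x))\<^sup>2) \<partial>\<mu>) \<longlonglongrightarrow> 0"
    proof (rule tendsto_sandwich[OF _ _ tendsto_const hyp2])
      show "\<forall>\<^sub>F n in sequentially. (\<integral>\<^sup>+x. ennreal ((F n x $ j * sqrt (Q n x) - leff x $ j * sqrt (p\<^sub>0 x))\<^sup>2) \<partial>\<mu>)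
          \<le> (\<integral>\<^sup>+x. ennreal ((norm (sqrt (pm (m n) x) *\<^sub>R leffm (m n) x - sqrt (p\<^sub>0 x) *\<^sub>R leff x))\<^sup>2) \<partial>\<mu>)"
        using eventually_ge_at_top[of 1]
      proof eventually_elim
        case (elim n)
        show ?case
        proof (intro nn_integral_mono ennreal_leI)
          fix x
          let ?y = "sqrt (pm (m n) x) *\<^sub>R leffm (m n) x - sqrt (p\<^sub>0 x) *\<^sub>R leff x"
          have "\<bar>?y $ j\<bar>\<^sup>2 \<le> (norm ?y)\<^sup>2" by (intro power_mono component_le_norm_cart) simp
          then show "(F n x $ j * sqrt (Q n x) - leff x $ j * sqrt (p\<^sub>0 x))\<^sup>2 \<le> (norm ?y)\<^sup>2"
            using elim by (simp add: F_def Q_def mult.commute)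
        qed
      qed
    qed simp
  qed

  \<comment> \<open>Information matrices and the limit law\<close>
  have Jlim: "(\<lambda>n. Jn n $ i $ j) \<longlonglongrightarrow> J $ i $ j" for i j
    using L2_lim_integral_mult[OF Flim[of i] Flim[of j]]
      integral_law_mult[OF Qd Fm Fm] integral_law_mult[OF p0d leffm' leffm']
    by (simp add: Jn_def J_def second_moment_def P0)
  have Jinv: "invertible J" and Jsym: "transpose J = J"
    using nonsingular second_moment_symmetric by (auto simp: J_def)
  have Jpos: "0 < x \<bullet> (J *v x)" if "x \<noteq> 0" for x
    unfolding J_def by (rule second_moment_pos_def[OF leffL2 nonsingular that])
  define L where "L = mv_normal 0 (matrix_inv J)"
  have Lp: "prob_space L" "sets L = sets borel"
    unfolding L_def by (rule prob_space_mv_normal[OF Jsym Jpos]) simp_all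

  \<comment> \<open>Rate of approach of the parametric laws to the true law\<close>
  have gdiff: "L2_lim \<mu> (\<lambda>n x. sqrt n * (sqrt (Q n x) - sqrt (p\<^sub>0 x))) (\<lambda>x. g x / 2 * sqrt (p\<^sub>0 x))"
  proof (rule lan_imp_differentiable_in_quadratic_mean[OF p0d Qd])
    show "g \<in> L2 (law \<mu> p\<^sub>0)" "(\<integral>x. g x \<partial>law \<mu> p\<^sub>0) = 0" using hyp1_g by (simp_all add: P0)
    show "negligible_in_probability (\<lambda>n. product_law n (law \<mu> p\<^sub>0))
         (\<lambda>n x. \<bar>log_likelihood_ratio n (Q n) p\<^sub>0 x - ereal (normalized_sum n g x - (1/2) * (\<integral>y. (g y)\<^sup>2 \<partial>law \<mu> p\<^sub>0))\<bar>)"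
      unfolding negligible_in_probability_def
    proof (intro allI impI)
      fix \<epsilon> :: real assume "0 < \<epsilon>"
      then have lr: "(\<lambda>n. measure (product_law n P\<^sub>0) {x \<in> space (product_law n P\<^sub>0).
          ereal \<epsilon> < \<bar>log_likelihood_ratio n (pm (m n)) p\<^sub>0 x - ereal (normalized_sum n g x - (1/2) * (\<integral>y. (g y)\<^sup>2 \<partial>P\<^sub>0))\<bar>}) \<longlonglongrightarrow> 0"
        using hyp1 by (simp add: negligible_in_probability_def)
      show "(\<lambda>n. measure (product_law n (law \<mu> p\<^sub>0)) {x \<in> space (product_law n (law \<mu> p\<^sub>0)).
          ereal \<epsilon> < \<bar>log_likelihood_ratio n (Q n) p\<^sub>0 x - ereal (normalized_sum n g x - (1/2) * (\<integral>y. (g y)\<^sup>2 \<partial>law \<mu> p\<^sub>0))\<bar>}) \<longlonglongrightarrow> 0"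
        by (rule Lim_transform_eventually[OF lr], rule eventually_mono[OF eventually_ge_at_top[of 1]])
          (simp add: Q_def P0)
    qed
  qed
  have Qlim: "L2_lim \<mu> (\<lambda>n x. sqrt (Q n x)) (\<lambda>x. sqrt (p\<^sub>0 x))"
    by (rule L2_lim_of_rate[OF is_densityD(6)[OF Qd] is_densityD(6)[OF p0d] gdiff])

  \<comment> \<open>The remainder of the estimator under the parametric laws\<close>
  define Rem where "Rem n x = (if 1 \<le> n then norm (sqrt (real n) *\<^sub>R (\<theta>hat (m n) n x - \<theta>\<^sub>0)
       - normalized_sum n (\<lambda>y. matrix_inv (Jn n) *v F n y) x) else 0)" for n x
  have theta_m: "\<theta>hat (m n) n \<in> borel_measurable (\<Pi>\<^sub>M i\<in>{..<n}. \<mu>)" if "1 \<le> n" for n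
    using estimator[OF indices(1)[OF that]] .
  have Fvm: "F n \<in> borel_measurable \<mu>" for n
    by (rule borel_measurable_euclidean_space[THEN iffD2]) (auto simp: Basis_vec_def inner_axis Fm)
  have JFm[measurable]: "(\<lambda>y. matrix_inv (Jn n) *v F n y) \<in> borel_measurable \<mu>" for n
    by (rule measurable_compose[OF Fvm]) (intro borel_measurable_continuous_onI matrix_vector_mult_linear_continuous_on)
  have Remm[measurable]: "Rem n \<in> borel_measurable (\<Pi>\<^sub>M i\<in>{..<n}. \<mu>)" for n
  proof (cases "1 \<le> n")
    case True
    note theta_m[OF True, measurable]
    have "(\<lambda>x. norm (sqrt (real n) *\<^sub>R (\<theta>hat (m n) n x - \<theta>\<^sub>0) - normalized_sum n (\<lambda>y. matrix_inv (Jn n) *v F n y) x)) \<in> borel_measurable (\<Pi>\<^sub>M i\<in>{..<n}. \<mu>)"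
      unfolding normalized_sum_def by measurable
    then show ?thesis using True by (simp add: Rem_def[abs_def])
  qed (simp add: Rem_def[abs_def])
  have RemQ: "(\<lambda>n. measure (product_law n (law \<mu> (Q n))) {x \<in> space (\<Pi>\<^sub>M i\<in>{..<n}. \<mu>). \<epsilon> < Rem n x}) \<longlonglongrightarrow> 0" if "0 < \<epsilon>" for \<epsilon>
  proof -
    have *: "(\<lambda>n. measure (product_law n (Pm (m n))) {x \<in> space (product_law n (Pm (m n))). ereal \<epsilon> < ereal (norm (sqrt (real n) *\<^sub>R (\<theta>hat (m n) n x - \<theta>\<^sub>0)
         - normalized_sum n (\<lambda>y. matrix_inv (second_moment (Pm (m n)) (leffm (m n))) *v leffm (m n) y) x))}) \<longlonglongrightarrow> 0"
      using hyp3 that unfolding negligible_in_probability_def by blast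
    show ?thesis
    proof (rule Lim_transform_eventually[OF *], rule eventually_mono[OF eventually_ge_at_top[of 1]])
      fix n :: nat assume n: "1 \<le> n"
      have "space (product_law n (Pm (m n))) = space (\<Pi>\<^sub>M i\<in>{..<n}. \<mu>)"
        unfolding lawQ[OF n, symmetric] by simp
      then show "measure (product_law n (Pm (m n))) {x \<in> space (product_law n (Pm (m n))). ereal \<epsilon> < ereal (norm (sqrt (real n) *\<^sub>R (\<theta>hat (m n) n x - \<theta>\<^sub>0)
         - normalized_sum n (\<lambda>y. matrix_inv (second_moment (Pm (m n)) (leffm (m n))) *v leffm (m n) y) x))}
        = measure (product_law n (law \<mu> (Q n))) {x \<in> space (\<Pi>\<^sub>M i\<in>{..<n}. \<mu>). \<epsilon> < Rem n x}"
        using n by (simp add: Rem_def Jn_def lawQ F_def)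
    qed
  qed

  \<comment> \<open>Limit law under a fixed local alternative\<close>
  have weak: "weakly_converges
        (\<lambda>n. distr (product_law n (law \<mu> (p (\<theta>\<^sub>0 + (1 / sqrt (real n)) *\<^sub>R \<tau>) (\<eta>loc n b)))) borel
               (\<lambda>x. sqrt (real n) *\<^sub>R (\<theta>hat (m n) n x - \<theta>\<^sub>0 - (1 / sqrt (real n)) *\<^sub>R \<tau>))) L" for \<tau> b
  proof -
    define good where "good n \<longleftrightarrow> 1 \<le> n \<and> \<theta>\<^sub>0 + (1 / sqrt (real n)) *\<^sub>R \<tau> \<in> \<Theta> \<and> \<eta>loc n b \<in> H" for n
    have good: "\<forall>\<^sub>F n in sequentially. good n"
    proof -
      have "\<forall>\<^sub>F n in sequentially. \<theta>\<^sub>0 + (1 / sqrt (real n)) *\<^sub>R \<tau> \<in> \<Theta> \<and> \<eta>loc n b \<in> H"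
        using qmd unfolding differentiable_in_quadratic_mean_def by blast
      then show ?thesis using eventually_ge_at_top[of 1] by eventually_elim (simp add: good_def)
    qed
    \<comment> \<open>The local parameters are known to lie in the model only for large
      \<open>n\<close>; elsewhere the true density keeps \<open>S n\<close> a density.\<close>
    define S where "S n = (if good n then p (\<theta>\<^sub>0 + (1 / sqrt (real n)) *\<^sub>R \<tau>) (\<eta>loc n b) else p\<^sub>0)" for n
    have Sd: "is_density \<mu> (S n)" for n
      using densities[of "\<theta>\<^sub>0 + (1 / sqrt (real n)) *\<^sub>R \<tau>" "\<eta>loc n b"] p0d by (auto simp: S_def good_def)
    have Am: "A (\<tau>, b) \<in> borel_measurable \<mu>" using L2D(1)[OF qmdA[of \<tau> b]] by (simp add: P0 law_def)
    have Adiff: "L2_lim \<mu> (\<lambda>n x. sqrt n * (sqrt (S n x) - sqrt (p\<^sub>0 x))) (\<lambda>x. A (\<tau>, b) x / 2 * sqrt (p\<^sub>0 x))"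
    proof (rule L2_limI_nn_integral)
      show "(\<lambda>x. sqrt n * (sqrt (S n x) - sqrt (p\<^sub>0 x))) \<in> L2 \<mu>" for n :: nat
        by (intro L2_cmult L2_diff is_densityD(6)[OF Sd] is_densityD(6)[OF p0d])
      have "(\<lambda>x. A (\<tau>, b) x * sqrt (p\<^sub>0 x)) \<in> L2 \<mu>" using qmdA L2_law_iff[OF p0d Am] unfolding P0 by blast
      from L2_cmult[OF this, of "1/2"] show "(\<lambda>x. A (\<tau>, b) x / 2 * sqrt (p\<^sub>0 x)) \<in> L2 \<mu>" by simp
      have *: "(\<lambda>n. \<integral>\<^sup>+ x. ennreal
           ((sqrt (real n) * (sqrt (p (\<theta>\<^sub>0 + (1 / sqrt (real n)) *\<^sub>R \<tau>) (\<eta>loc n b) x) - sqrt (p \<theta>\<^sub>0 \<eta>\<^sub>0 x))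
             - (1/2) * A (\<tau>, b) x * sqrt (p \<theta>\<^sub>0 \<eta>\<^sub>0 x))\<^sup>2) \<partial>\<mu>) \<longlonglongrightarrow> 0"
        using qmd unfolding differentiable_in_quadratic_mean_def by blast
      show "(\<lambda>n. \<integral>\<^sup>+x. ennreal ((sqrt n * (sqrt (S n x) - sqrt (p\<^sub>0 x)) - A (\<tau>, b) x / 2 * sqrt (p\<^sub>0 x))\<^sup>2) \<partial>\<mu>) \<longlonglongrightarrow> 0"
        by (rule Lim_transform_eventually[OF *], rule eventually_mono[OF good]) (simp add: S_def p0)
    qed
    have Slim: "L2_lim \<mu> (\<lambda>n x. sqrt (S n x)) (\<lambda>x. sqrt (p\<^sub>0 x))"
      by (rule L2_lim_of_rate[OF is_densityD(6)[OF Sd] is_densityD(6)[OF p0d] Adiff])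
    define w where "w x = A (\<tau>, b) x / 2 - g x / 2" for x
    have wm: "w \<in> borel_measurable \<mu>" unfolding w_def using Am gm by measurable
    have SQ: "L2_lim \<mu> (\<lambda>n x. sqrt n * (sqrt (S n x) - sqrt (Q n x))) (\<lambda>x. w x * sqrt (p\<^sub>0 x))"
      using L2_lim_diff[OF Adiff gdiff] by (simp add: w_def algebra_simps)
    have Pn: "prob_space (product_law n (law \<mu> (S n)))" for n by (rule prob_space_product_law[OF is_densityD(3)[OF Sd]])
    have RemS: "(\<lambda>n. measure (product_law n (law \<mu> (S n))) {x \<in> space (product_law n (law \<mu> (S n))). \<epsilon> < Rem n x}) \<longlonglongrightarrow> 0" if "0 < \<epsilon>" for \<epsilon>
      unfolding space_product_law_law
      by (rule contiguity[OF sigma_finite Sd Qd p0d Slim SQ wm _ RemQ[OF that]]) measurable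

    define Y where "Y n x = (if 1 \<le> n then sqrt (real n) *\<^sub>R (\<theta>hat (m n) n x - \<theta>\<^sub>0 - (1 / sqrt (real n)) *\<^sub>R \<tau>) else 0)" for n x
    have Ym: "Y n \<in> borel_measurable (\<Pi>\<^sub>M i\<in>{..<n}. \<mu>)" for n
    proof (cases "1 \<le> n")
      case True
      note theta_m[OF True, measurable]
      have "(\<lambda>x. sqrt (real n) *\<^sub>R (\<theta>hat (m n) n x - \<theta>\<^sub>0 - (1 / sqrt (real n)) *\<^sub>R \<tau>)) \<in> borel_measurable (\<Pi>\<^sub>M i\<in>{..<n}. \<mu>)"
        by measurable
      then show ?thesis using True by (simp add: Y_def[abs_def])
    qed (simp add: Y_def[abs_def])
    have Ym'[measurable]: "Y n \<in> borel_measurable (product_law n (law \<mu> (S n)))" for n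
      using Ym[of n] by (simp cong: measurable_cong_sets)

    have char: "(\<lambda>n. CLINT x|product_law n (law \<mu> (S n)). iexp (t \<bullet> Y n x)) \<longlonglongrightarrow> (CLINT x|L. iexp (t \<bullet> x))" for t
    proof -
      \<comment> \<open>Multiplying from the left makes \<open>c n \<bullet> F n x\<close> equal to
        \<open>t \<bullet> (matrix_inv (Jn n) *v F n x)\<close> for every \<open>n\<close>, even
        when \<open>Jn n\<close> is singular. The form with the inverse on the left, needed for the
        limit, holds once \<open>Jn n\<close> is invertible.\<close>
      define c where "c n = t v* matrix_inv (Jn n)" for n
      define c0 where "c0 = matrix_inv J *v t"
      have Jnsym: "transpose (Jn n) = Jn n" for n unfolding Jn_def by (rule second_moment_symmetric)
      have "\<forall>\<^sub>F n in sequentially. matrix_inv (Jn n) *v t = c n"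
        using matrix_inv_mult_vec_tendsto(2)[OF Jlim Jinv]
        by eventually_elim (simp only: c_def vec_mult_matrix_inv_symmetric[OF _ Jnsym])
      then have clim: "(\<lambda>n. c n $ j) \<longlonglongrightarrow> c0 $ j" for j
        unfolding c0_def
        by (intro Lim_transform_eventually[OF matrix_inv_mult_vec_tendsto(1)[OF Jlim Jinv]]) (auto elim!: eventually_mono)
      define a where "a n x = c n \<bullet> F n x" for n x
      have am: "a n \<in> borel_measurable \<mu>" for n
        unfolding a_def using borel_measurable_inner[OF borel_measurable_const Fvm] .
      have c0m: "(\<lambda>x. c0 \<bullet> leff x) \<in> borel_measurable \<mu>"
        using L2D(1)[OF inner_L2[OF leffL2, of c0]] by (simp add: P0 law_def)
      have alim: "L2_lim \<mu> (\<lambda>n x. a n x * sqrt (Q n x)) (\<lambda>x. (c0 \<bullet> leff x) * sqrt (p\<^sub>0 x))"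
      proof -
        have "L2_lim \<mu> (\<lambda>n x. \<Sum>j\<in>UNIV. c n $ j * (F n x $ j * sqrt (Q n x))) (\<lambda>x. \<Sum>j\<in>UNIV. c0 $ j * (leff x $ j * sqrt (p\<^sub>0 x)))"
          by (intro L2_lim_sum L2_lim_cmult Flim clim)
        then show ?thesis by (simp add: a_def inner_vec_def sum_distrib_right mult.assoc)
      qed
      have a0: "(\<integral>x. a n x \<partial>law \<mu> (Q n)) = 0" for n
      proof -
        have "integrable (law \<mu> (Q n)) (\<lambda>x. F n x $ j)" for j
          by (rule L2_integrable[OF prob_space.finite_measure[OF is_densityD(3)[OF Qd]] FL2])
        then show ?thesis by (simp add: a_def inner_vec_def F0 integrable_mult_right)
      qed
      have Jc0: "J *v c0 = t"
      proof -
        obtain D where D: "J ** D = mat 1" using Jinv unfolding invertible_def by blast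
        show ?thesis unfolding c0_def matrix_inv_eqI(1)[OF D] by (simp add: matrix_vector_mul_assoc D)
      qed
      have bb: "(\<integral>x. (c0 \<bullet> leff x)\<^sup>2 \<partial>law \<mu> p\<^sub>0) = t \<bullet> (matrix_inv J *v t)"
      proof -
        have "(\<integral>x. (c0 \<bullet> leff x)\<^sup>2 \<partial>P\<^sub>0) = c0 \<bullet> (J *v c0)"
          unfolding J_def second_moment_inner[OF leffL2] by (simp add: power2_eq_square)
        then show ?thesis by (simp add: P0 Jc0 inner_commute[of _ t] flip: c0_def)
      qed
      \<comment> \<open>The factor 2 undoes the halves in \<open>w\<close>, and
        \<open>J *v c0 = t\<close> removes the information matrix, so the drift depends neither on
        \<open>b\<close> nor on \<open>g\<close>.\<close>
      have bw: "2 * (\<integral>x. (c0 \<bullet> leff x) * w x \<partial>law \<mu> p\<^sub>0) = t \<bullet> \<tau>"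
      proof -
        note i1 = L2_integrable_mult[OF inner_L2[OF leffL2, of c0] qmdA[of \<tau> b]]
        note i2 = L2_integrable_mult[OF inner_L2[OF leffL2, of c0] hyp1_g(1)]
        have "(\<integral>x. (c0 \<bullet> leff x) * g x \<partial>P\<^sub>0) = (\<integral>x. (\<Sum>j\<in>UNIV. c0 $ j * (g x * leff x $ j)) \<partial>P\<^sub>0)"
          unfolding inner_vec_def inner_real_def sum_distrib_right by (simp add: mult_ac)
        also have "\<dots> = (\<Sum>j\<in>UNIV. c0 $ j * (\<integral>x. g x * leff x $ j \<partial>P\<^sub>0))"
          using L2_integrable_mult[OF hyp1_g(1) leffL2] by (simp add: integrable_mult_right)
        finally have g0: "(\<integral>x. (c0 \<bullet> leff x) * g x \<partial>P\<^sub>0) = 0" by (simp add: hyp1_g)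
        have "2 * (\<integral>x. (c0 \<bullet> leff x) * w x \<partial>P\<^sub>0) = (\<integral>x. 2 * ((c0 \<bullet> leff x) * w x) \<partial>P\<^sub>0)" by simp
        also have "\<dots> = (\<integral>x. (c0 \<bullet> leff x) * A (\<tau>, b) x - (c0 \<bullet> leff x) * g x \<partial>P\<^sub>0)"
          by (simp add: w_def right_diff_distrib)
        also have "\<dots> = (\<integral>x. (c0 \<bullet> leff x) * A (\<tau>, b) x \<partial>P\<^sub>0)" using i1 i2 g0 by simp
        also have "\<dots> = c0 \<bullet> (J *v \<tau>)"
          unfolding J_def by (rule efficient_score_covariance(2)[OF score efficient_score qmdA])
        also have "\<dots> = (J *v c0) \<bullet> \<tau>"
          by (metis Jsym dot_lmul_matrix transpose_matrix_vector)
        finally show ?thesis by (simp add: P0 Jc0)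
      qed
      have "(\<lambda>n. CLINT x|product_law n (law \<mu> (S n)). iexp (normalized_sum n (a n) x))
          \<longlonglongrightarrow> exp (\<i> * complex_of_real (2 * (\<integral>x. (c0 \<bullet> leff x) * w x \<partial>law \<mu> p\<^sub>0)) - complex_of_real ((\<integral>x. (c0 \<bullet> leff x)\<^sup>2 \<partial>law \<mu> p\<^sub>0) / 2))"
        by (rule char_product_law_tendsto[OF Sd Qd p0d Qlim SQ wm am c0m alim a0])
      then have "(\<lambda>n. CLINT x|product_law n (law \<mu> (S n)). iexp (normalized_sum n (a n) x))
          \<longlonglongrightarrow> exp (\<i> * complex_of_real (t \<bullet> \<tau>) - complex_of_real (t \<bullet> (matrix_inv J *v t) / 2))"
        unfolding bb bw .
      \<comment> \<open>Recentring at the local parameter multiplies by this phase and cancels the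
        whole drift. The limit is the same for all \<open>\<tau>\<close> and \<open>b\<close>, which
        is regularity.\<close>
      then have "(\<lambda>n. iexp (- (t \<bullet> \<tau>)) * (CLINT x|product_law n (law \<mu> (S n)). iexp (normalized_sum n (a n) x)))
          \<longlonglongrightarrow> iexp (- (t \<bullet> \<tau>)) * exp (\<i> * complex_of_real (t \<bullet> \<tau>) - complex_of_real (t \<bullet> (matrix_inv J *v t) / 2))"
        by (intro tendsto_mult tendsto_const)
      also have "iexp (- (t \<bullet> \<tau>)) * exp (\<i> * complex_of_real (t \<bullet> \<tau>) - complex_of_real (t \<bullet> (matrix_inv J *v t) / 2)) = (CLINT x|L. iexp (t \<bullet> x))"
      proof -
        have "(CLINT x|L. iexp (t \<bullet> x)) = complex_of_real (exp (- (t \<bullet> (matrix_inv J *v t)) / 2))"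
          unfolding L_def by (rule char_mv_normal[OF Jsym]) (rule Jpos)
        then show ?thesis by (simp flip: exp_add exp_of_real)
      qed
      also have "(\<lambda>n. iexp (- (t \<bullet> \<tau>)) * (CLINT x|product_law n (law \<mu> (S n)). iexp (normalized_sum n (a n) x)))
          = (\<lambda>n. CLINT x|product_law n (law \<mu> (S n)). iexp (normalized_sum n (a n) x - t \<bullet> \<tau>))"
        by (simp add: exp_diff exp_minus field_simps)
      finally have lim: "(\<lambda>n. CLINT x|product_law n (law \<mu> (S n)). iexp (normalized_sum n (a n) x - t \<bullet> \<tau>)) \<longlonglongrightarrow> (CLINT x|L. iexp (t \<bullet> x))" .
      have nsm: "normalized_sum n (a n) \<in> borel_measurable (\<Pi>\<^sub>M i\<in>{..<n}. \<mu>)" for n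
        unfolding normalized_sum_def using am[of n] by measurable
      \<comment> \<open>At index 0 both \<open>Y\<close> and \<open>Rem\<close> are 0 while the
        approximation equals minus \<open>t \<bullet> \<tau>\<close>; setting \<open>Z\<close> equal
        to it there makes the remainder bound hold for every \<open>n\<close>.\<close>
      define Z where "Z n x = (if 1 \<le> n then t \<bullet> Y n x else normalized_sum n (a n) x - t \<bullet> \<tau>)" for n x
      have "(\<lambda>n. CLINT x|product_law n (law \<mu> (S n)). iexp (Z n x)) \<longlonglongrightarrow> (CLINT x|L. iexp (t \<bullet> x))"
      proof (rule char_negligible_remainder[OF Pn _ _ _ _ norm_ge_zero[of t] RemS lim])
        show "Z n \<in> borel_measurable (product_law n (law \<mu> (S n)))"
          "(\<lambda>x. normalized_sum n (a n) x - t \<bullet> \<tau>) \<in> borel_measurable (product_law n (law \<mu> (S n)))"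
          "Rem n \<in> borel_measurable (product_law n (law \<mu> (S n)))" for n
          using Ym[of n] nsm[of n] Remm[of n] unfolding Z_def[abs_def]
          by (cases "1 \<le> n"; simp cong: measurable_cong_sets)+
        fix n x
        show "\<bar>Z n x - (normalized_sum n (a n) x - t \<bullet> \<tau>)\<bar> \<le> norm t * Rem n x"
        proof (cases "1 \<le> n")
          case True
          have "normalized_sum n (a n) x = t \<bullet> normalized_sum n (\<lambda>y. matrix_inv (Jn n) *v F n y) x"
            by (simp add: normalized_sum_def a_def c_def dot_lmul_matrix inner_sum_right)
          moreover have "Y n x = sqrt (real n) *\<^sub>R (\<theta>hat (m n) n x - \<theta>\<^sub>0) - \<tau>"
            using True by (simp add: Y_def scaleR_diff_right)
          ultimately have "Z n x - (normalized_sum n (a n) x - t \<bullet> \<tau>)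
              = t \<bullet> (sqrt (real n) *\<^sub>R (\<theta>hat (m n) n x - \<theta>\<^sub>0) - normalized_sum n (\<lambda>y. matrix_inv (Jn n) *v F n y) x)"
            using True by (simp add: Z_def inner_diff_right)
          then show ?thesis using True Cauchy_Schwarz_ineq2 by (simp add: Rem_def)
        qed (simp add: Z_def Rem_def)
      qed
      moreover have "\<forall>\<^sub>F n in sequentially. (CLINT x|product_law n (law \<mu> (S n)). iexp (Z n x)) = (CLINT x|product_law n (law \<mu> (S n)). iexp (t \<bullet> Y n x))"
        using eventually_ge_at_top[of 1] by eventually_elim (simp add: Z_def)
      ultimately show ?thesis by (rule Lim_transform_eventually)
    qed

    \<comment> \<open>From characteristic functions to weak convergence of the estimator\<close>
    have "weakly_converges (\<lambda>n. distr (product_law n (law \<mu> (S n))) borel (Y n)) L"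
    proof (rule mv_levy_continuity)
      show "prob_space (distr (product_law n (law \<mu> (S n))) borel (Y n))" for n
        by (rule prob_space.prob_space_distr[OF Pn Ym'])
      fix t
      have "(CLINT x|distr (product_law n (law \<mu> (S n))) borel (Y n). iexp (t \<bullet> x)) = (CLINT x|product_law n (law \<mu> (S n)). iexp (t \<bullet> Y n x))" for n
        by (rule integral_distr[OF Ym']) measurable
      then show "(\<lambda>n. CLINT x|distr (product_law n (law \<mu> (S n))) borel (Y n). iexp (t \<bullet> x)) \<longlonglongrightarrow> (CLINT x|L. iexp (t \<bullet> x))"
        using char by simp
    qed (use Lp in simp_all)
    moreover have "\<forall>\<^sub>F n in sequentially. distr (product_law n (law \<mu> (S n))) borel (Y n)
       = distr (product_law n (law \<mu> (p (\<theta>\<^sub>0 + (1 / sqrt (real n)) *\<^sub>R \<tau>) (\<eta>loc n b)))) borel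
               (\<lambda>x. sqrt (real n) *\<^sub>R (\<theta>hat (m n) n x - \<theta>\<^sub>0 - (1 / sqrt (real n)) *\<^sub>R \<tau>))"
      using good
    proof eventually_elim
      case (elim n)
      have "Y n = (\<lambda>x. sqrt (real n) *\<^sub>R (\<theta>hat (m n) n x - \<theta>\<^sub>0 - (1 / sqrt (real n)) *\<^sub>R \<tau>))"
        using elim by (simp add: Y_def[abs_def] good_def)
      then show ?case using elim by (simp only: S_def if_True)
    qed
    ultimately show ?thesis by (rule weakly_converges_eventually_cong)
  qed
  show ?thesis
    unfolding best_regular_def regular_with_limit_def
    using weak Lp unfolding L_def J_def by (simp add: P0 p0)
qed

end
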